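(* Let $d\in\mathbb{N}_{>0}$, $\beta\ge0$, $\theta>1$, $K>0$. There is a constant $C>0$ depending only on $\theta,\beta,d,K$ such that the following holds. Let $a\in\mathcal{H}^{\beta,\theta}_K(\mathbb{R}^d,\mathbb{R})$ and let $\mu$ be the probability measure with density $$d\mu(x)=\exp\left(-\|x\|^2/2+a(x)+c_a\right)dx$$ with respect to the $d$-dimensional Lebesgue measure, $c_a\in\mathbb{R}$ being a normalizing constant. Then for all $k\in\{1,\dots,\lfloor\beta\rfloor+1\}$ and all $f:\mathbb{R}^d\to\mathbb{R}$ with $\|f\|_{L^2_\mu}=1$ (having weak partial derivatives up to order $k$ in $L^2_\mu$), $$\int|f(x)|^2\,\big|\log(|f(x)|)\big|^{k}\,d\mu(x)\le C\sum_{|\alpha|=0}^{k}\|D^\alpha f\|_{L^2_\mu}^2 .$$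
   Context: $D^\alpha f$ is the partial derivative of $f$ for the multi-index $\alpha\in\mathbb{N}_0^d$; the sum is over all multi-indices with $0\le|\alpha|\le k$. The integrand on the left is taken to be $0$ where $f=0$. $\|g\|_{L^2_\mu}^2=\int g^2d\mu$. $\lfloor\eta\rfloor=\max\{k\in\mathbb{N}_0: k\le\eta\}$. Hölder spaces: for $\eta\ge0$, $\alpha\ge 0$ and a real function $g$, put $$\|g\|_{\eta-\lfloor\eta\rfloor,\alpha}=\sup_{x\ne y}\frac{|g(x)-g(y)|}{\|x-y\|^{\eta-\lfloor\eta\rfloor}}\log\Big(\big(\|x-y\|\wedge\tfrac12\big)^{-1}\Big)^{\alpha}.$$ For $K>0$, $\mathcal{H}^{\eta,\alpha}_K(\mathbb{R}^d,\mathbb{R})$ is the set of $f:\mathbb{R}^d\to\mathbb{R}$ in $C^{\lfloor\eta\rfloor}$ (the $\lfloor\eta\rfloor$ times differentiable functions, almost everywhere) with $$\sum_{|\nu|\le\lfloor\eta\rfloor}\|\partial^\nu f\|_{L^\infty}+\sum_{|\nu|=\lfloor\eta\rfloor}\|\partial^\nu f\|_{\eta-\lfloor\eta\rfloor,\alpha}\le K,$$ $\nu$ ranging over multi-indices. *)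

theory Defs
  imports "HOL-Probability.Probability"
begin

text \<open>Multi-indices are functions \<^typ>\<open>'n \<Rightarrow> nat\<close> on the finite index type of \<^typ>\<open>real ^ 'n\<close>.\<close>

definition mi_order :: "('n::finite \<Rightarrow> nat) \<Rightarrow> nat" where
  "mi_order \<nu> = (\<Sum>i\<in>UNIV. \<nu> i)"

lemma finite_mi_order_le: "finite {\<nu> :: 'n::finite \<Rightarrow> nat. mi_order \<nu> \<le> k}"
proof (rule finite_subset)
  show "{\<nu> :: 'n \<Rightarrow> nat. mi_order \<nu> \<le> k} \<subseteq> (UNIV :: 'n set) \<rightarrow>\<^sub>E {..k}"
  proof
    fix \<nu> :: "'n \<Rightarrow> nat"
    assume "\<nu> \<in> {\<nu>. mi_order \<nu> \<le> k}"
    then have "(\<Sum>i\<in>UNIV. \<nu> i) \<le> k" by (simp add: mi_order_def)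
    moreover have "\<nu> i \<le> (\<Sum>i\<in>UNIV. \<nu> i)" for i
      by (rule member_le_sum) auto
    ultimately show "\<nu> \<in> UNIV \<rightarrow>\<^sub>E {..k}" by (auto intro: order_trans)
  qed
qed (simp add: finite_PiE)

lemma finite_mi_order_eq: "finite {\<nu> :: 'n::finite \<Rightarrow> nat. mi_order \<nu> = k}"
  by (rule finite_subset[OF _ finite_mi_order_le[of k]]) auto

text \<open>A family \<^term>\<open>D\<close> indexed by multi-indices collects the derivatives \<open>\<partial>\<^sup>\<nu> f\<close> of
  \<open>f = D 0\<close>. The predicate says that at \<open>x\<close> the function \<open>D \<nu>\<close> is (Frechet) differentiable
  and its \<open>i\<close>-th partial derivative is \<open>D (\<nu> + e\<^sub>i)\<close>.\<close>

definition partials_at ::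
  "(('n::finite \<Rightarrow> nat) \<Rightarrow> real ^ 'n \<Rightarrow> real) \<Rightarrow> ('n \<Rightarrow> nat) \<Rightarrow> real ^ 'n \<Rightarrow> bool" where
  "partials_at D \<nu> x \<longleftrightarrow>
     (D \<nu> has_derivative (\<lambda>h. \<Sum>i\<in>UNIV. h $ i * D (\<nu>(i := Suc (\<nu> i))) x)) (at x)"

text \<open>\<open>f\<close> is \<open>m\<close> times differentiable almost everywhere, with derivatives \<open>D\<close>; being
  \<open>0\<close> times differentiable means being continuous. Outside a null set the values of
  \<open>D \<nu>\<close> for \<open>0 < |\<nu>| \<le> m\<close> are determined by \<open>f\<close>; on the null set they are free.\<close>

definition ae_partials ::
  "nat \<Rightarrow> (real ^ 'n::finite \<Rightarrow> real) \<Rightarrow> (('n \<Rightarrow> nat) \<Rightarrow> real ^ 'n \<Rightarrow> real) \<Rightarrow> bool" where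
  "ae_partials m f D \<longleftrightarrow>
     D (\<lambda>_. 0) = f \<and>
     (AE x in lebesgue. isCont f x) \<and>
     (AE x in lebesgue. \<forall>\<nu>. mi_order \<nu> < m \<longrightarrow> partials_at D \<nu> x)"

definition Linf_norm :: "(real ^ 'n::finite \<Rightarrow> real) \<Rightarrow> ennreal" where
  "Linf_norm g = esssup lebesgue (\<lambda>x. ennreal \<bar>g x\<bar>)"

definition log_holder_seminorm :: "real \<Rightarrow> real \<Rightarrow> (real ^ 'n::finite \<Rightarrow> real) \<Rightarrow> ennreal" where
  "log_holder_seminorm s \<alpha> g =
     (SUP (x, y) \<in> {(x, y). x \<noteq> y}.
        ennreal (\<bar>g x - g y\<bar> / norm (x - y) powr s
                 * ln (inverse (min (norm (x - y)) (1/2))) powr \<alpha>))"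

definition holder_class :: "real \<Rightarrow> real \<Rightarrow> real \<Rightarrow> (real ^ 'n::finite \<Rightarrow> real) set" where
  "holder_class \<eta> \<alpha> K =
     {f. \<exists>D. ae_partials (nat \<lfloor>\<eta>\<rfloor>) f D \<and>
            (\<Sum>\<nu> | mi_order \<nu> \<le> nat \<lfloor>\<eta>\<rfloor>. Linf_norm (D \<nu>)) +
            (\<Sum>\<nu> | mi_order \<nu> = nat \<lfloor>\<eta>\<rfloor>. log_holder_seminorm (\<eta> - of_int \<lfloor>\<eta>\<rfloor>) \<alpha> (D \<nu>))
            \<le> ennreal K}"

text \<open>\<open>\<Phi> 0\<close> is a smooth compactly supported function and \<open>\<Phi> \<nu>\<close> its derivatives.\<close>

definition test_jet :: "(('n::finite \<Rightarrow> nat) \<Rightarrow> real ^ 'n \<Rightarrow> real) \<Rightarrow> bool" where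
  "test_jet \<Phi> \<longleftrightarrow> (\<forall>\<nu> x. partials_at \<Phi> \<nu> x) \<and> compact (closure {x. \<Phi> (\<lambda>_. 0) x \<noteq> 0})"

definition locally_integrable :: "(real ^ 'n::finite \<Rightarrow> real) \<Rightarrow> bool" where
  "locally_integrable f \<longleftrightarrow> (\<forall>S. compact S \<longrightarrow> set_integrable lebesgue S f)"

definition weak_deriv ::
  "('n::finite \<Rightarrow> nat) \<Rightarrow> (real ^ 'n \<Rightarrow> real) \<Rightarrow> (real ^ 'n \<Rightarrow> real) \<Rightarrow> bool" where
  "weak_deriv \<alpha> f g \<longleftrightarrow>
     locally_integrable f \<and> locally_integrable g \<and>
     (\<forall>\<Phi>. test_jet \<Phi> \<longrightarrow>
        (LINT x|lebesgue. f x * \<Phi> \<alpha> x) =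
        (-1) ^ mi_order \<alpha> * (LINT x|lebesgue. g x * \<Phi> (\<lambda>_. 0) x))"

definition in_L2 :: "'a measure \<Rightarrow> ('a \<Rightarrow> real) \<Rightarrow> bool" where
  "in_L2 M g \<longleftrightarrow> g \<in> borel_measurable M \<and> integrable M (\<lambda>x. (g x)\<^sup>2)"

definition L2_norm :: "'a measure \<Rightarrow> ('a \<Rightarrow> real) \<Rightarrow> real" where
  "L2_norm M g = sqrt (LINT x|M. (g x)\<^sup>2)"

definition perturbed_gaussian ::
  "(real ^ 'n::finite \<Rightarrow> real) \<Rightarrow> real \<Rightarrow> (real ^ 'n) measure" where
  "perturbed_gaussian a c =
     density lebesgue (\<lambda>x. ennreal (exp (- (norm x)\<^sup>2 / 2 + a x + c)))"

end

theory Submission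
  imports Defs
begin

text \<open>
  A bounded \<open>a\<close> makes \<open>\<mu>\<close> comparable to the standard Gaussian, so the inequality is proved for the
  weight \<open>gauss x = exp (- \<parallel>x\<parallel>\<^sup>2 / 2)\<close>. Weak derivatives enter only through the identity
  \<open>u (x + h) - u x = \<integral>\<^sub>0\<^sup>1 (h \<bullet> \<nabla>u) (x + t h) dt\<close>, valid for each \<open>h\<close> and almost every \<open>x\<close>.

  Where \<open>1 < |f| \<le> exp (\<parallel>x\<parallel>\<^sup>2 / 2)\<close>, \<open>ln |f|\<close> is at most \<open>\<parallel>x\<parallel>\<^sup>2\<close>, and one needs
  \<open>\<integral> \<parallel>x\<parallel>\<^bsup>2 k\<^esup> f\<^sup>2 gauss \<le> C \<Sum> \<integral> (D\<^sup>\<alpha> f)\<^sup>2 gauss\<close>, where each derivative trades for two powers of a coordinate;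
  here all \<open>k\<close> derivatives are used. Where \<open>|f|\<close> is larger, put \<open>q = f\<^sup>2 gauss\<close>, so that \<open>|f| \<le> q\<close>. Comparing
  \<open>f\<close> with its averages over cubes of side \<open>r\<close> gives \<open>\<integral> q \<le> C r\<^sup>2 \<integral> \<parallel>\<nabla>f\<parallel>\<^sup>2 gauss\<close> over \<open>{q \<ge> c r\<^bsup>- d\<^esup>}\<close>, and
  summing over dyadic \<open>r\<close> bounds \<open>\<integral> q (ln q)\<^sup>k\<close> over \<open>{q \<ge> 1}\<close> by first derivatives alone.
\<close>

section \<open>Smooth bump functions and test jets\<close>

text \<open>Each weak derivative is defined by testing against \<open>f\<close> itself. Products of
  one-variable bumps turn this into relations between consecutive derivatives: differentiating the
  \<open>i\<close>-th factor raises the \<open>i\<close>-th index of the jet, so the identities for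
  \<alpha> and for \<alpha> with \<open>\<alpha> i\<close> increased by one can be compared. Such
  products also approximate indicators of boxes, hence they identify functions almost everywhere.

  The threshold for \<open>q\<close> at scale \<open>r\<close> comes from Chebyshev's inequality.
  Averages over a cube of volume \<open>r ^ d\<close> contribute at most a multiple of
  \<open>|E| / r ^ d\<close> for the superlevel set \<open>E = {q >= L}\<close>, and
  \<open>L * |E|\<close> is at most the integral of \<open>q\<close> over \<open>E\<close>; with
  \<open>L\<close> of order \<open>r ^ (- d)\<close> half of the left side absorbs this. At
  \<open>r = 2 ^ (- j)\<close> the gain is \<open>4 ^ (- j)\<close>, while \<open>(ln q) ^ k\<close>
  grows polynomially in \<open>j\<close>; so one derivative suffices for every \<open>k\<close>.

  The inequality is not homogeneous in \<open>f\<close>. Small values of \<open>|f|\<close> leave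
  the Gaussian mass, and moderate values of \<open>q\<close> leave a multiple of the mass of
  \<open>f ^ 2\<close>. Both are absorbed at the end because the order-zero term of the right-hand
  side equals \<open>1\<close>.\<close>

definition smooth_tower :: "(nat \<Rightarrow> real \<Rightarrow> real) \<Rightarrow> bool" where
  "smooth_tower T \<longleftrightarrow> (\<forall>n x. (T n has_real_derivative T (Suc n) x) (at x))"

text \<open>The derivatives are carried along as data because \<open>test_jet\<close> asks for the
  whole family. One \<open>R\<close> serves all orders, so a product of towers has a support radius
  independent of the multi-index.\<close>

definition bump_tower :: "(nat \<Rightarrow> real \<Rightarrow> real) \<Rightarrow> bool" where
  "bump_tower T \<longleftrightarrow> smooth_tower T \<and> (\<exists>R. \<forall>n x. R < \<bar>x\<bar> \<longrightarrow> T n x = 0)"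

text \<open>The functions \<open>(1 / s) ^ k exp (- 1 / s)\<close> span a space that is closed under differentiation.\<close>

definition flat_exp :: "nat \<Rightarrow> real \<Rightarrow> real" where
  "flat_exp k s = (if s \<le> 0 then 0 else inverse s ^ k * exp (- inverse s))"

lemma flat_exp_div: "flat_exp k s / s = flat_exp (Suc k) s"
  by (simp add: flat_exp_def divide_inverse)

lemma flat_exp_tendsto_0: "(flat_exp k \<longlongrightarrow> 0) (at 0)"
proof (rule filterlim_split_at)
  show "(flat_exp k \<longlongrightarrow> 0) (at_left 0)"
    by (rule tendsto_eventually) (auto simp: flat_exp_def eventually_at_filter)
  have "((\<lambda>x::real. x ^ k / exp x) \<longlongrightarrow> 0) at_top" by (rule tendsto_power_div_exp_0)
  then have "((\<lambda>s::real. inverse s ^ k / exp (inverse s)) \<longlongrightarrow> 0) (at_right 0)"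
    by (rule filterlim_compose) (rule filterlim_inverse_at_top_right)
  moreover have "eventually (\<lambda>s. inverse s ^ k / exp (inverse s) = flat_exp k s) (at_right 0)"
    by (auto simp: flat_exp_def eventually_at_filter exp_minus divide_inverse)
  ultimately show "(flat_exp k \<longlongrightarrow> 0) (at_right 0)"
    using tendsto_cong by fast
qed

text \<open>At \<open>0\<close> the difference quotient of \<open>flat_exp k\<close> is
  \<open>flat_exp (Suc k)\<close>, so the derivative there is the limit \<open>0\<close> found
  above. Away from \<open>0\<close> this is the product rule.\<close>

lemma flat_exp_has_derivative:
  "(flat_exp k has_real_derivative flat_exp (k + 2) s - real k * flat_exp (k + 1) s) (at s)"
proof (cases s "0::real" rule: linorder_cases)
  case less
  have "((\<lambda>_. 0) has_real_derivative 0) (at s)" by simp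
  then have "(flat_exp k has_real_derivative 0) (at s)"
    by (rule has_field_derivative_transform_within_open[of _ _ _ "{..<0}"])
       (use less in \<open>auto simp: flat_exp_def\<close>)
  then show ?thesis using less by (simp add: flat_exp_def)
next
  case equal
  have "((\<lambda>h. flat_exp k (0 + h) / h) \<longlongrightarrow> 0) (at 0)"
    using flat_exp_tendsto_0[of "Suc k"] by (simp add: flat_exp_div)
  then show ?thesis
    using equal by (simp add: DERIV_def flat_exp_def)
next
  case greater
  have "((\<lambda>s. inverse s ^ k * exp (- inverse s)) has_real_derivative
      (inverse s ^ k * (exp (- inverse s) * (inverse s ^ 2))
       + (real k * inverse s ^ (k - 1) * (- (inverse s ^ 2))) * exp (- inverse s))) (at s)"
    using greater by (auto intro!: derivative_eq_intros simp: power2_eq_square)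
  \<comment> \<open>Splitting on \<open>k\<close> handles the truncated exponent
    \<open>k - 1\<close>; at \<open>k = 0\<close> its coefficient is \<open>0\<close>.\<close>
  moreover have "(inverse s ^ k * (exp (- inverse s) * (inverse s ^ 2))
       + (real k * inverse s ^ (k - 1) * (- (inverse s ^ 2))) * exp (- inverse s))
     = flat_exp (k + 2) s - real k * flat_exp (k + 1) s"
    using greater by (cases k) (auto simp: flat_exp_def algebra_simps power2_eq_square)
  ultimately have "((\<lambda>s. inverse s ^ k * exp (- inverse s)) has_real_derivative
      flat_exp (k + 2) s - real k * flat_exp (k + 1) s) (at s)" by simp
  then show ?thesis
    by (rule has_field_derivative_transform_within_open[of _ _ _ "{0<..}"])
       (use greater in \<open>auto simp: flat_exp_def\<close>)
qed

text \<open>The recursion replaces the starting function by its derivative instead of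
  differentiating the previous level. Every level is then a combination of functions
  \<open>flat_exp\<close>, and smoothness follows by induction on \<open>n\<close> with
  \<open>k\<close> arbitrary.\<close>

fun flat_exp_tower :: "nat \<Rightarrow> nat \<Rightarrow> real \<Rightarrow> real" where
  "flat_exp_tower k 0 s = flat_exp k s"
| "flat_exp_tower k (Suc n) s = flat_exp_tower (k + 2) n s - real k * flat_exp_tower (k + 1) n s"

lemma smooth_tower_flat_exp: "smooth_tower (flat_exp_tower k)"
  unfolding smooth_tower_def
proof (intro allI)
  fix n x show "(flat_exp_tower k n has_real_derivative flat_exp_tower k (Suc n) x) (at x)"
  proof (induction n arbitrary: k)
    case 0
    have "flat_exp_tower k 0 = flat_exp k" by (rule ext) simp
    then show ?case using flat_exp_has_derivative[of k x] by simp
  next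
    case (Suc n)
    have "flat_exp_tower k (Suc n)
        = (\<lambda>s. flat_exp_tower (k + 2) n s - real k * flat_exp_tower (k + 1) n s)" by (rule ext) simp
    moreover have "((\<lambda>s. flat_exp_tower (k + 2) n s - real k * flat_exp_tower (k + 1) n s)
       has_real_derivative flat_exp_tower (k + 2) (Suc n) x - real k * flat_exp_tower (k + 1) (Suc n) x) (at x)"
      by (intro DERIV_diff DERIV_cmult Suc)
    ultimately show ?case by (simp only: flat_exp_tower.simps)
  qed
qed

lemma flat_exp_tower_nonpos: "s \<le> 0 \<Longrightarrow> flat_exp_tower k n s = 0"
  by (induction n arbitrary: k) (auto simp: flat_exp_def)

section \<open>Affine substitution, products and translates of towers\<close>

lemma smooth_tower_affine:
  assumes "smooth_tower T" shows "smooth_tower (\<lambda>n x. p ^ n * T n (p * x + q))"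
  unfolding smooth_tower_def
proof (intro allI)
  fix n x
  have "(T n has_real_derivative T (Suc n) (p * x + q)) (at (p * x + q))"
    using assms by (auto simp: smooth_tower_def)
  moreover have "((\<lambda>x. p * x + q) has_real_derivative p) (at x)"
    by (auto intro!: derivative_eq_intros)
  ultimately have "((\<lambda>x. T n (p * x + q)) has_real_derivative T (Suc n) (p * x + q) * p) (at x)"
    by (rule DERIV_chain2)
  then have "((\<lambda>x. p ^ n * T n (p * x + q)) has_real_derivative
      p ^ n * (T (Suc n) (p * x + q) * p)) (at x)" by (rule DERIV_cmult)
  then show "((\<lambda>x. p ^ n * T n (p * x + q)) has_real_derivative
      p ^ Suc n * T (Suc n) (p * x + q)) (at x)" by (simp add: ac_simps)
qed

text \<open>The Leibniz rule without binomial coefficients: the derivative of order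
  \<open>n + 1\<close> of \<open>S T\<close> is the derivative of order \<open>n\<close> of
  \<open>S' T + S T'\<close>.\<close>

fun tower_mult :: "nat \<Rightarrow> (nat \<Rightarrow> real \<Rightarrow> real) \<Rightarrow> (nat \<Rightarrow> real \<Rightarrow> real) \<Rightarrow> real \<Rightarrow> real" where
  "tower_mult 0 S T x = S 0 x * T 0 x"
| "tower_mult (Suc n) S T x =
     tower_mult n (\<lambda>m. S (Suc m)) T x + tower_mult n S (\<lambda>m. T (Suc m)) x"

lemma smooth_tower_mult:
  assumes "smooth_tower S" "smooth_tower T" shows "smooth_tower (\<lambda>n. tower_mult n S T)"
  unfolding smooth_tower_def
proof (intro allI)
  fix n x show "(tower_mult n S T has_real_derivative tower_mult (Suc n) S T x) (at x)"
    using assms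
  proof (induction n arbitrary: S T)
    case 0
    have "tower_mult 0 S T = (\<lambda>x. S 0 x * T 0 x)" by (rule ext) simp
    moreover have "((\<lambda>x. S 0 x * T 0 x) has_real_derivative S (Suc 0) x * T 0 x + T (Suc 0) x * S 0 x) (at x)"
      using 0 by (intro DERIV_mult) (auto simp: smooth_tower_def)
    ultimately show ?case by (simp add: mult.commute)
  next
    case (Suc n)
    have "tower_mult (Suc n) S T
        = (\<lambda>x. tower_mult n (\<lambda>m. S (Suc m)) T x + tower_mult n S (\<lambda>m. T (Suc m)) x)" by (rule ext) simp
    moreover have "smooth_tower (\<lambda>m. S (Suc m))" "smooth_tower (\<lambda>m. T (Suc m))"
      using Suc.prems by (auto simp: smooth_tower_def)
    then have "((\<lambda>x. tower_mult n (\<lambda>m. S (Suc m)) T x + tower_mult n S (\<lambda>m. T (Suc m)) x)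
        has_real_derivative tower_mult (Suc n) (\<lambda>m. S (Suc m)) T x + tower_mult (Suc n) S (\<lambda>m. T (Suc m)) x) (at x)"
      by (intro DERIV_add Suc)
        (use Suc.prems in auto)
    ultimately show ?case by (simp only: tower_mult.simps)
  qed
qed

lemma tower_mult_eq_0:
  "(\<forall>m. S m x = 0) \<or> (\<forall>m. T m x = 0) \<Longrightarrow> tower_mult n S T x = 0"
  by (induction n arbitrary: S T) auto

lemma bump_tower_shift: "bump_tower T \<Longrightarrow> bump_tower (\<lambda>n. T (n + m))"
  unfolding bump_tower_def smooth_tower_def by auto metis

text \<open>Translated bumps carry a weak identity to every point of a segment.\<close>

lemma bump_tower_translate:
  assumes "bump_tower T" shows "bump_tower (\<lambda>n x. T n (x - z))"
proof -
  obtain R where R: "\<And>n x. R < \<bar>x\<bar> \<Longrightarrow> T n x = 0" and "smooth_tower T"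
    using assms by (auto simp: bump_tower_def)
  have "T n (x - z) = 0" if "R + \<bar>z\<bar> < \<bar>x\<bar>" for n x using that by (intro R) linarith
  moreover have "smooth_tower (\<lambda>n x. T n (x - z))"
    using smooth_tower_affine[OF \<open>smooth_tower T\<close>, of 1 "- z"] by simp
  ultimately show ?thesis unfolding bump_tower_def by blast
qed


lemma bump_towerI:
  assumes "smooth_tower T" "\<And>n x. R < \<bar>x\<bar> \<Longrightarrow> T n x = 0" shows "bump_tower T"
  using assms unfolding bump_tower_def by blast

text \<open>The tower of a smooth function that vanishes outside the open interval from
  \<open>a\<close> to \<open>b\<close> and tends to its indicator as \<open>m\<close> grows: each
  endpoint contributes a factor \<open>exp (- 1 / s)\<close> dilated by \<open>m + 1\<close>. The
  powers of the slopes are the chain-rule factors of \<open>smooth_tower_affine\<close>.\<close>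

definition interval_tower :: "real \<Rightarrow> real \<Rightarrow> nat \<Rightarrow> nat \<Rightarrow> real \<Rightarrow> real" where
  "interval_tower a b m n = tower_mult n
     (\<lambda>j x. real (Suc m) ^ j * flat_exp_tower 0 j (real (Suc m) * x + - (real (Suc m) * a)))
     (\<lambda>j x. (- real (Suc m)) ^ j * flat_exp_tower 0 j (- real (Suc m) * x + real (Suc m) * b))"

lemma bump_tower_interval: "bump_tower (interval_tower a b m)"
proof (rule bump_towerI)
  show "smooth_tower (interval_tower a b m)"
    unfolding interval_tower_def
    by (intro smooth_tower_mult smooth_tower_affine smooth_tower_flat_exp)
  fix n :: nat and x :: real assume "\<bar>a\<bar> + \<bar>b\<bar> < \<bar>x\<bar>"
  then have "x \<le> a \<or> b \<le> x" by linarith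
  then show "interval_tower a b m n x = 0"
    unfolding interval_tower_def
  proof (intro tower_mult_eq_0, elim disj_forward)
    assume "x \<le> a"
    then have "real (Suc m) * x \<le> real (Suc m) * a" by (intro mult_left_mono) auto
    then show "\<forall>k. real (Suc m) ^ k * flat_exp_tower 0 k (real (Suc m) * x + - (real (Suc m) * a)) = 0"
      by (auto intro!: flat_exp_tower_nonpos)
  next
    assume "b \<le> x"
    then have "real (Suc m) * b \<le> real (Suc m) * x" by (intro mult_left_mono) auto
    then show "\<forall>k. (- real (Suc m)) ^ k * flat_exp_tower 0 k (- real (Suc m) * x + real (Suc m) * b) = 0"
      by (auto intro!: flat_exp_tower_nonpos simp: algebra_simps)
  qed
qed

lemma interval_tower_0:
  "interval_tower a b m 0 x =
     flat_exp 0 (real (Suc m) * (x - a)) * flat_exp 0 (real (Suc m) * (b - x))"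
  by (simp add: interval_tower_def algebra_simps)

lemma flat_exp_0_bounds: "0 \<le> flat_exp 0 s" "flat_exp 0 s \<le> 1"
  by (auto simp: flat_exp_def)

lemma flat_exp_0_tendsto: "(\<lambda>m. flat_exp 0 (real (Suc m) * s)) \<longlonglongrightarrow> indicator {0<..} s"
proof (cases "s > 0")
  case True
  have "(\<lambda>m. exp (- (inverse (real (Suc m)) * inverse s))) \<longlonglongrightarrow> exp (- (0 * inverse s))"
    by (intro tendsto_intros LIMSEQ_inverse_real_of_nat)
  moreover have "flat_exp 0 (real (Suc m) * s) = exp (- (inverse (real (Suc m)) * inverse s))" for m
    using True by (auto simp: flat_exp_def mult_le_0_iff simp del: of_nat_Suc)
  ultimately show ?thesis using True by simp
next
  case False
  then have "flat_exp 0 (real (Suc m) * s) = 0" for m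
    by (auto simp: flat_exp_def mult_le_0_iff simp del: of_nat_Suc)
  then show ?thesis using False by simp
qed

section \<open>Product test functions, whose mixed partial derivatives are explicit products\<close>

definition prod_jet ::
  "('n::finite \<Rightarrow> nat \<Rightarrow> real \<Rightarrow> real) \<Rightarrow> ('n \<Rightarrow> nat) \<Rightarrow> real ^ 'n \<Rightarrow> real" where
  "prod_jet T \<nu> x = (\<Prod>i\<in>UNIV. T i (\<nu> i) (x $ i))"

lemma partials_at_prod_jet:
  fixes T :: "'n::finite \<Rightarrow> nat \<Rightarrow> real \<Rightarrow> real"
  assumes "\<And>i. smooth_tower (T i)" shows "partials_at (prod_jet T) \<nu> x"
proof -
  have "((\<lambda>x. T i (\<nu> i) (x $ i)) has_derivative (\<lambda>h. T i (Suc (\<nu> i)) (x $ i) * h $ i)) (at x)" for i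
  proof -
    have "(T i (\<nu> i) has_derivative (*) (T i (Suc (\<nu> i)) (x $ i))) (at (x $ i))"
      using assms[of i] by (auto simp: smooth_tower_def has_field_derivative_def)
    moreover have "((\<lambda>x. x $ i) has_derivative (\<lambda>h. h $ i)) (at x)"
      by (intro bounded_linear_imp_has_derivative bounded_linear_vec_nth)
    ultimately show ?thesis by (rule has_derivative_compose[rotated])
  qed
  from has_derivative_prod[where I = UNIV, OF this]
  have "((\<lambda>x. prod_jet T \<nu> x) has_derivative
     (\<lambda>h. \<Sum>i\<in>UNIV. T i (Suc (\<nu> i)) (x $ i) * h $ i * (\<Prod>j\<in>UNIV - {i}. T j (\<nu> j) (x $ j)))) (at x)"
    unfolding prod_jet_def .
  moreover have "T i (Suc (\<nu> i)) (x $ i) * h $ i * (\<Prod>j\<in>UNIV - {i}. T j (\<nu> j) (x $ j))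
      = h $ i * prod_jet T (\<nu>(i := Suc (\<nu> i))) x" for i h
    unfolding prod_jet_def by (subst prod.remove[of UNIV i]) auto
  ultimately show ?thesis by (simp add: partials_at_def)
qed

lemma prod_jet_continuous:
  "(\<And>i. smooth_tower (T i)) \<Longrightarrow> continuous_on S (prod_jet T \<nu>)"
  using partials_at_prod_jet[of T \<nu>] unfolding partials_at_def
  by (meson continuous_at_imp_continuous_on has_derivative_continuous)

lemma prod_jet_support:
  fixes T :: "'n::finite \<Rightarrow> nat \<Rightarrow> real \<Rightarrow> real"
  assumes "\<And>i. bump_tower (T i)"
  shows "\<exists>R>0. \<forall>\<nu> x. R < norm x \<longrightarrow> prod_jet T \<nu> x = 0"
proof -
  from assms have "\<forall>i. \<exists>R. \<forall>n x. R < \<bar>x\<bar> \<longrightarrow> T i n x = 0" by (auto simp: bump_tower_def)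
  then obtain R where R: "\<And>i n x. R i < \<bar>x\<bar> \<Longrightarrow> T i n x = 0" by metis
  have "prod_jet T \<nu> x = 0" if "(\<Sum>i\<in>UNIV. \<bar>R i\<bar>) + 1 < norm x" for \<nu> x
  proof -
    have "\<exists>i. R i < \<bar>x $ i\<bar>"
    proof (rule ccontr)
      assume "\<not> ?thesis"
      then have "\<bar>x $ i\<bar> \<le> \<bar>R i\<bar>" for i by (meson abs_ge_self not_less order_trans)
      then have "(\<Sum>i\<in>UNIV. \<bar>x $ i\<bar>) \<le> (\<Sum>i\<in>UNIV. \<bar>R i\<bar>)" by (intro sum_mono)
      with norm_le_l1_cart[of x] that show False by linarith
    qed
    then show ?thesis using R by (fastforce simp: prod_jet_def)
  qed
  moreover have "(\<Sum>i\<in>UNIV. \<bar>R i\<bar>) + 1 > 0" by (simp add: sum_nonneg add_nonneg_pos)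
  ultimately show ?thesis by blast
qed

lemma prod_jet_bounded:
  fixes T :: "'n::finite \<Rightarrow> nat \<Rightarrow> real \<Rightarrow> real"
  assumes "\<And>i. bump_tower (T i)"
  shows "\<exists>B. \<forall>x. \<bar>prod_jet T \<nu> x\<bar> \<le> B"
proof -
  obtain R where R: "R > 0" "\<And>x. R < norm x \<Longrightarrow> prod_jet T \<nu> x = 0"
    using prod_jet_support[of T] assms by blast
  have "compact (prod_jet T \<nu> ` cball 0 R)"
    by (intro compact_continuous_image prod_jet_continuous compact_cball)
       (use assms in \<open>auto simp: bump_tower_def\<close>)
  then obtain B where "\<forall>y\<in>prod_jet T \<nu> ` cball 0 R. norm y \<le> B"
    by (meson compact_imp_bounded bounded_iff)
  then have B: "norm (prod_jet T \<nu> x) \<le> B" if "x \<in> cball 0 R" for x using that by blast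
  have "\<bar>prod_jet T \<nu> x\<bar> \<le> max B 0" for x
    using B[of x] R(2)[of x] by (cases "norm x \<le> R") auto
  then show ?thesis by blast
qed

lemma test_jet_prod_jet:
  fixes T :: "'n::finite \<Rightarrow> nat \<Rightarrow> real \<Rightarrow> real"
  assumes "\<And>i. bump_tower (T i)"
  shows "test_jet (prod_jet T)"
proof -
  obtain R where "\<And>x. R < norm x \<Longrightarrow> prod_jet T (\<lambda>_. 0) x = 0"
    using prod_jet_support[of T] assms by blast
  then have "{x. prod_jet T (\<lambda>_. 0) x \<noteq> 0} \<subseteq> cball 0 R"
    by (auto simp flip: not_less)
  then have "bounded {x. prod_jet T (\<lambda>_. 0) x \<noteq> 0}" by (rule bounded_subset[OF bounded_cball])
  moreover have "smooth_tower (T i)" for i using assms by (auto simp: bump_tower_def)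
  ultimately show ?thesis
    by (simp add: test_jet_def partials_at_prod_jet compact_eq_bounded_closed bounded_closure)
qed

lemma integrable_mult_prod_jet:
  fixes u :: "real ^ 'n::finite \<Rightarrow> real"
  assumes "\<And>i. bump_tower (T i)" and u: "\<And>R. set_integrable lborel (cball 0 R) u"
  shows "integrable lborel (\<lambda>x. u x * prod_jet T \<nu> x)"
proof -
  obtain R where R: "\<And>x. R < norm x \<Longrightarrow> prod_jet T \<nu> x = 0"
    using prod_jet_support[of T] assms(1) by blast
  obtain B where B: "\<And>x. \<bar>prod_jet T \<nu> x\<bar> \<le> B" using prod_jet_bounded[of T \<nu>] assms(1) by blast
  have "smooth_tower (T i)" for i using assms by (auto simp: bump_tower_def)
  then have [measurable]: "prod_jet T \<nu> \<in> borel_measurable borel"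
    by (intro borel_measurable_continuous_onI prod_jet_continuous)
  have 1: "integrable lborel (\<lambda>x. indicator (cball 0 R) x * u x)"
    using u[of R] by (simp add: set_integrable_def)
  note [measurable] = borel_measurable_integrable[OF 1]
  have "integrable lborel (\<lambda>x. (indicator (cball 0 R) x * u x) * prod_jet T \<nu> x)"
  proof (rule Bochner_Integration.integrable_bound)
    show "integrable lborel (\<lambda>x. B * (indicator (cball 0 R) x * u x))" using 1 by simp
    have "B \<ge> 0" using B[of 0] by linarith
    then show "AE x in lborel. norm (indicator (cball 0 R) x * u x * prod_jet T \<nu> x)
                  \<le> norm (B * (indicator (cball 0 R) x * u x))"
      using B by (intro AE_I2) (auto simp: abs_mult indicator_def mult.commute[of B] intro!: mult_left_mono)
  qed measurable
  moreover have "(indicator (cball 0 R) x * u x) * prod_jet T \<nu> x = u x * prod_jet T \<nu> x" for x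
    using R[of x] by (cases "norm x \<le> R") (auto simp: indicator_def)
  ultimately show ?thesis by simp
qed

section \<open>Weak derivatives along segments\<close>

text \<open>Boxes form an intersection-stable generator of the Borel sets, so vanishing integrals
  spread from boxes to all Borel sets by a Dynkin argument. Cutting \<open>F\<close> off to a large
  box first makes it integrable, and complements are then handled by subtracting from the integral
  over that box, which vanishes as well.\<close>

lemma AE_zero_if_box_integrals_zero:
  fixes F :: "'a::euclidean_space \<Rightarrow> real"
  assumes int: "\<And>R. set_integrable lborel (cball 0 R) F"
    and zero: "\<And>a b. (LINT x:box a b|lborel. F x) = 0"
  shows "AE x in lborel. F x = 0"
proof -
  let ?A = "\<lambda>n::nat. box (- (real n *\<^sub>R One)) (real n *\<^sub>R One) :: 'a set"
  have "AE x in lborel. indicator (?A n) x * F x = 0" for n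
  proof (rule sigma_finite_measure.density_zero[OF sigma_finite_lborel])
    have box_int: "set_integrable lborel (box a b) F" for a b
    proof -
      obtain R where "\<forall>x\<in>box a b. norm x \<le> R" using bounded_box[of a b] unfolding bounded_iff by blast
      then have "box a b \<subseteq> cball 0 R" by auto
      then show ?thesis using int[of R] by (rule set_integrable_subset[rotated 2]) auto
    qed
    then show I: "integrable lborel (\<lambda>x. indicator (?A n) x * F x)"
      by (simp add: set_integrable_def)
    let ?E = "range (\<lambda>(a, b). box a b::'a set)"
    have SI: "set_integrable lborel A (\<lambda>x. indicator (?A n) x * F x)" if "A \<in> sets borel" for A
      using integrable_mult_indicator[OF _ I, of A] that by (simp add: set_integrable_def)
    have whole: "(LINT x|lborel. indicator (?A n) x * F x) = 0"
      using zero[of "- (real n *\<^sub>R One)" "real n *\<^sub>R One"] by (simp add: set_lebesgue_integral_def)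
    fix A :: "'a set" assume "A \<in> sets lborel"
    then have "A \<in> sigma_sets UNIV ?E" by (simp add: borel_eq_box)
    have "Int_stable ?E" by (auto simp: Int_stable_def box_Int_box)
    moreover have "?E \<subseteq> Pow UNIV" by simp
    ultimately show "(LINT x:A|lborel. indicator (?A n) x * F x) = 0"
      using \<open>A \<in> sigma_sets UNIV ?E\<close>
    proof (induction rule: sigma_sets_induct_disjoint)
      case (basic A)
      then obtain a b where A: "A = box a b" by auto
      obtain l u where lu: "A \<inter> ?A n = box l u" unfolding A box_Int_box by blast
      have "(LINT x:A|lborel. indicator (?A n) x * F x) = (LINT x:box l u|lborel. F x)"
        unfolding set_lebesgue_integral_def lu[symmetric]
        by (intro Bochner_Integration.integral_cong) (auto simp: indicator_def)
      then show ?case using zero by simp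
    next
      case empty show ?case by (simp add: set_lebesgue_integral_def)
    next
      case (compl A)
      then have A: "A \<in> sets lborel" by (simp add: borel_eq_box)
      have "(LINT x:UNIV - A|lborel. indicator (?A n) x * F x) =
         (LINT x|lborel. indicator (?A n) x * F x - indicator A x *\<^sub>R (indicator (?A n) x * F x))"
        unfolding set_lebesgue_integral_def
        by (intro Bochner_Integration.integral_cong) (auto simp: indicator_def)
      also have "\<dots> = (LINT x|lborel. indicator (?A n) x * F x) - (LINT x:A|lborel. indicator (?A n) x * F x)"
        unfolding set_lebesgue_integral_def
        using I SI[of A] A by (intro Bochner_Integration.integral_diff) (auto simp: set_integrable_def)
      finally have "(LINT x:UNIV - A|lborel. indicator (?A n) x * F x) =
         (LINT x|lborel. indicator (?A n) x * F x) - (LINT x:A|lborel. indicator (?A n) x * F x)" .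
      then show ?case using whole compl by simp
    next
      case (union A)
      then have A: "\<And>i. A i \<in> sets lborel" by (auto simp: borel_eq_box)
      have "(LINT x:(\<Union>i. A i)|lborel. indicator (?A n) x * F x)
        = (\<Sum>i. (LINT x:A i|lborel. indicator (?A n) x * F x))"
        using A union by (intro lebesgue_integral_countable_add SI) (auto simp: disjoint_family_on_def)
      then show ?case using union by simp
    qed
  qed
  then have "AE x in lborel. \<forall>n. indicator (?A n) x * F x = 0"
    by (subst AE_all_countable) blast
  then show ?thesis
  proof eventually_elim
    case (elim x)
    have "x \<in> (\<Union>n. ?A n)" using UN_box_eq_UNIV by auto
    then obtain n where "x \<in> ?A n" by auto
    then show ?case using elim[rule_format, of n] by simp
  qed
qed

text \<open>The fundamental lemma of the calculus of variations for product tests. The products of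
  \<open>interval_tower\<close> stay below the indicator of the box and converge to it pointwise, so
  dominated convergence yields vanishing box integrals.\<close>

lemma AE_zero_if_weakly_zero:
  fixes F :: "real ^ 'n::finite \<Rightarrow> real"
  assumes int: "\<And>R. set_integrable lborel (cball 0 R) F"
    and weak: "\<And>T. (\<And>i. bump_tower (T i)) \<Longrightarrow> (LINT x|lborel. F x * prod_jet T (\<lambda>_. 0) x) = 0"
  shows "AE x in lborel. F x = 0"
proof (rule AE_zero_if_box_integrals_zero[OF int])
  fix a b :: "real ^ 'n"
  define T where "T m i = interval_tower (a $ i) (b $ i) m" for m i
  have bump: "bump_tower (T m i)" for m i by (simp add: T_def bump_tower_interval)
  obtain R where "\<forall>x\<in>box a b. norm x \<le> R" using bounded_box[of a b] unfolding bounded_iff by blast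
  then have "set_integrable lborel (box a b) F"
    by (intro set_integrable_subset[OF int[of R]]) auto
  then have FI: "integrable lborel (\<lambda>x. indicator (box a b) x * F x)" by (simp add: set_integrable_def)
  have jet_eq: "prod_jet (T m) (\<lambda>_. 0) x =
      (\<Prod>i\<in>UNIV. flat_exp 0 (real (Suc m) * (x $ i - a $ i)) * flat_exp 0 (real (Suc m) * (b $ i - x $ i)))"
    for m x by (simp add: prod_jet_def T_def interval_tower_0 del: of_nat_Suc)
  have nonneg: "0 \<le> prod_jet (T m) (\<lambda>_. 0) x" for m x
    unfolding jet_eq by (intro prod_nonneg mult_nonneg_nonneg flat_exp_0_bounds)
  have le_ind: "prod_jet (T m) (\<lambda>_. 0) x \<le> indicator (box a b) x" for m x
  proof (cases "x \<in> box a b")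
    case True
    then show ?thesis
      unfolding jet_eq
      by (simp del: of_nat_Suc) (intro prod_le_1 conjI mult_nonneg_nonneg mult_le_one flat_exp_0_bounds)
  next
    case False
    then obtain i where "x $ i \<le> a $ i \<or> b $ i \<le> x $ i" by (auto simp: mem_box_cart not_less)
    then have "flat_exp 0 (real (Suc m) * (x $ i - a $ i)) * flat_exp 0 (real (Suc m) * (b $ i - x $ i)) = 0"
      by (auto simp: flat_exp_def mult_le_0_iff simp del: of_nat_Suc)
    then have "prod_jet (T m) (\<lambda>_. 0) x = 0" unfolding jet_eq by (intro prod_zero bexI[of _ i]) auto
    then show ?thesis by simp
  qed
  have lim: "(\<lambda>m. prod_jet (T m) (\<lambda>_. 0) x) \<longlonglongrightarrow> indicator (box a b) x" for x
  proof -
    have "(\<lambda>m. prod_jet (T m) (\<lambda>_. 0) x) \<longlonglongrightarrow>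
        (\<Prod>i\<in>UNIV. indicator {0<..} (x $ i - a $ i) * indicator {0<..} (b $ i - x $ i))"
      unfolding jet_eq by (intro tendsto_prod tendsto_mult flat_exp_0_tendsto)
    also have "(\<Prod>i\<in>UNIV. indicator {0<..} (x $ i - a $ i) * indicator {0<..} (b $ i - x $ i))
        = (indicator (box a b) x :: real)"
    proof (cases "x \<in> box a b")
      case False
      then obtain i where "x $ i \<le> a $ i \<or> b $ i \<le> x $ i" by (auto simp: mem_box_cart not_less)
      then have "(\<Prod>i\<in>UNIV. indicator {0<..} (x $ i - a $ i) * indicator {0<..} (b $ i - x $ i)) = (0 :: real)"
        by (intro prod_zero bexI[of _ i]) auto
      then show ?thesis using False by simp
    qed (auto simp: mem_box_cart)
    finally show ?thesis .
  qed
  have "smooth_tower (T m i)" for m i using bump by (auto simp: bump_tower_def)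
  then have [measurable]: "prod_jet (T m) \<nu> \<in> borel_measurable borel" for m \<nu>
    by (intro borel_measurable_continuous_onI prod_jet_continuous)
  note [measurable] = borel_measurable_integrable[OF FI]
  have "(\<lambda>m. LINT x|lborel. (indicator (box a b) x * F x) * prod_jet (T m) (\<lambda>_. 0) x)
     \<longlonglongrightarrow> (LINT x|lborel. (indicator (box a b) x * F x) * indicator (box a b) x)"
  proof (rule integral_dominated_convergence[where w="\<lambda>x. norm (indicator (box a b) x * F x)"])
    show "AE x in lborel. norm (indicator (box a b) x * F x * prod_jet (T m) (\<lambda>_. 0) x)
             \<le> norm (indicator (box a b) x * F x)" for m
      using nonneg order_trans[OF le_ind indicator_le_1] by (intro AE_I2) (auto simp: indicator_def abs_mult intro!: mult_left_le)
  qed (use FI lim in \<open>auto intro!: tendsto_intros\<close>)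
  moreover have "(indicator (box a b) x * F x) * prod_jet (T m) (\<lambda>_. 0) x = F x * prod_jet (T m) (\<lambda>_. 0) x" for m x
    using nonneg[of m x] le_ind[of m x] by (cases "x \<in> box a b") auto
  moreover have "(LINT x|lborel. (indicator (box a b) x * F x) * indicator (box a b) x) = (LINT x:box a b|lborel. F x)"
    unfolding set_lebesgue_integral_def by (intro Bochner_Integration.integral_cong) (auto simp: indicator_def)
  ultimately show "(LINT x:box a b|lborel. F x) = 0"
    using weak[OF bump] by (simp add: LIMSEQ_const_iff)
qed

section \<open>Translations and averages over segments\<close>

lemma lborel_integral_translate:
  fixes f :: "'a::euclidean_space \<Rightarrow> real"
  assumes [measurable]: "f \<in> borel_measurable borel"
  shows "(LINT x|lborel. f (x + c)) = (LINT x|lborel. f x)"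
proof -
  have "(LINT x|lborel. f x) = (LINT x|distr lborel borel ((+) c). f x)" by (simp add: lborel_distr_plus)
  also have "\<dots> = (LINT x|lborel. f (c + x))" by (subst integral_distr) auto
  finally show ?thesis by (simp add: add.commute)
qed

lemma lborel_integrable_translate:
  fixes f :: "'a::euclidean_space \<Rightarrow> real"
  assumes "integrable lborel f"
  shows "integrable lborel (\<lambda>x. f (x + c))"
proof -
  note [measurable] = borel_measurable_integrable[OF assms]
  have "integrable (distr lborel borel ((+) c)) f" using assms by (simp add: lborel_distr_plus)
  then have "integrable lborel (\<lambda>x. f (c + x))" by (subst (asm) integrable_distr_eq) auto
  then show ?thesis by (simp add: add.commute)
qed

lemma nn_integral_lborel_translate:
  fixes f :: "'a::euclidean_space \<Rightarrow> ennreal"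
  assumes [measurable]: "f \<in> borel_measurable borel"
  shows "(\<integral>\<^sup>+x. f (x + c) \<partial>lborel) = (\<integral>\<^sup>+x. f x \<partial>lborel)"
proof -
  have "(\<integral>\<^sup>+x. f x \<partial>lborel) = (\<integral>\<^sup>+x. f x \<partial>distr lborel borel ((+) c))" by (simp add: lborel_distr_plus)
  also have "\<dots> = (\<integral>\<^sup>+x. f (c + x) \<partial>lborel)" by (subst nn_integral_distr) auto
  finally show ?thesis by (simp add: add.commute)
qed

text \<open>This licenses the exchange of integrals over the segment parameter and over space. For
  \<open>t\<close> in the unit interval \<open>p (x - t *\<^sub>R h)\<close> vanishes unless
  \<open>x\<close> lies in the ball of radius \<open>R + norm h\<close>, so \<open>B * w' x\<close>
  dominates uniformly in \<open>t\<close>.\<close>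

lemma integrable_segment:
  fixes w p :: "'a::euclidean_space \<Rightarrow> real"
  assumes [measurable]: "w \<in> borel_measurable borel" "p \<in> borel_measurable borel"
    and w: "\<And>R. set_integrable lborel (cball 0 R) w"
    and B: "\<And>x. \<bar>p x\<bar> \<le> B" and R: "\<And>x. R < norm x \<Longrightarrow> p x = 0"
  shows "integrable (lborel \<Otimes>\<^sub>M lborel) (\<lambda>(t, x). indicator {0..1} t * (w x * p (x - t *\<^sub>R h)))" (is ?A)
    and "integrable (lborel \<Otimes>\<^sub>M lborel) (\<lambda>(t, x). indicator {0..1} t * (w (x + t *\<^sub>R h) * p x))" (is ?B)
proof -
  define w' where "w' x = \<bar>indicator (cball 0 (R + norm h)) x * w x\<bar>" for x
  have "integrable lborel w'"
    using integrable_abs[of lborel "\<lambda>x. indicator (cball 0 (R + norm h)) x * w x"] w[of "R + norm h"]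
    unfolding w'_def[abs_def] by (simp add: set_integrable_def)
  then have w': "integrable lborel w'" "integrable lborel (\<lambda>x. B * w' x)" by auto
  note [measurable] = borel_measurable_integrable[OF w'(1)]
  have bound: "\<bar>indicator {0..1} t * (w x * p (x - t *\<^sub>R h))\<bar> \<le> B * w' x" for t x
  proof (cases "t \<in> {0..1} \<and> norm (x - t *\<^sub>R h) \<le> R")
    case True
    have "norm x \<le> norm (x - t *\<^sub>R h) + norm (t *\<^sub>R h)"
      using norm_triangle_ineq[of "x - t *\<^sub>R h" "t *\<^sub>R h"] by simp
    also have "norm (t *\<^sub>R h) \<le> norm h" using True by (auto intro: mult_left_le_one_le)
    finally have "x \<in> cball 0 (R + norm h)" using True by simp
    then show ?thesis using True B[of "x - t *\<^sub>R h"]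
      by (auto simp: w'_def abs_mult mult.commute[of B] intro!: mult_left_mono)
  next
    case False
    moreover have "B \<ge> 0" using B[of 0] by linarith
    ultimately show ?thesis using R by (force simp: w'_def)
  qed
  have [measurable]: "(\<lambda>t. \<integral>x. norm (indicator {0..1} t * (w x * p (x - t *\<^sub>R h))) \<partial>lborel) \<in> borel_measurable borel"
    "(\<lambda>t. \<integral>x. norm (indicator {0..1} t * (w (x + t *\<^sub>R h) * p x)) \<partial>lborel) \<in> borel_measurable borel"
    by measurable
  have int: "integrable lborel (\<lambda>x. indicator {0..1} t * (w x * p (x - t *\<^sub>R h)))" for t :: real
    using bound by (intro Bochner_Integration.integrable_bound[OF w'(2)]) (auto intro!: AE_I2 order_trans[OF _ abs_ge_self])
  have C: "integrable lborel (\<lambda>t::real. indicator {0..1} t * (LINT x|lborel. B * w' x))"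
    by (intro integrable_mult_left integrable_real_indicator) auto
  have le: "(\<integral>x. norm (indicator {0..1} t * (w x * p (x - t *\<^sub>R h))) \<partial>lborel) \<le> indicator {0..1} t * (LINT x|lborel. B * w' x)" for t :: real
    using integral_mono[OF integrable_norm[OF int[of t]] w'(2)] bound
    by (auto simp: indicator_def)
  show ?A
  proof (rule lborel_pair.Fubini_integrable, goal_cases)
    case 2
    show ?case using le
      by (intro Bochner_Integration.integrable_bound[OF C])
        (auto intro!: AE_I2 order_trans[OF _ abs_ge_self] simp: Bochner_Integration.integral_nonneg_AE)
  qed (use int in auto)
  \<comment> \<open>For fixed \<open>t\<close> the second integrand is the first one translated by
    \<open>t *\<^sub>R h\<close>, so it inherits integrability and has the same norm.\<close>
  have int2: "integrable lborel (\<lambda>x. indicator {0..1} t * (w (x + t *\<^sub>R h) * p x))" for t :: real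
    using lborel_integrable_translate[OF int[of t], of "t *\<^sub>R h"] by simp
  have eq: "(\<integral>x. \<bar>indicator {0..1} t * (w (x + t *\<^sub>R h) * p x)\<bar> \<partial>lborel)
      = (\<integral>x. \<bar>indicator {0..1} t * (w x * p (x - t *\<^sub>R h))\<bar> \<partial>lborel)" for t :: real
    using lborel_integral_translate[of "\<lambda>x. \<bar>indicator {0..1} t * (w x * p (x - t *\<^sub>R h))\<bar>" "t *\<^sub>R h"] by simp
  show ?B
  proof (rule lborel_pair.Fubini_integrable, goal_cases)
    case 2
    show ?case using le
      by (intro Bochner_Integration.integrable_bound[OF C])
        (auto intro!: AE_I2 order_trans[OF _ abs_ge_self] simp: Bochner_Integration.integral_nonneg_AE eq)
  qed (use int2 in auto)
qed

lemma prod_jet_measurable: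
  "(\<And>i. bump_tower (T i)) \<Longrightarrow> prod_jet T \<nu> \<in> borel_measurable borel"
  by (intro borel_measurable_continuous_onI prod_jet_continuous) (auto simp: bump_tower_def)

text \<open>The bounded factor \<open>p\<close> of \<open>integrable_segment\<close> need not be
  smooth; here it is the indicator of the ball.\<close>

lemma set_integrable_segment_average:
  fixes v :: "'a::euclidean_space \<Rightarrow> real"
  assumes [measurable]: "v \<in> borel_measurable borel"
    and v: "\<And>R. set_integrable lborel (cball 0 R) v"
  shows "set_integrable lborel (cball 0 R) (\<lambda>x. LINT t|lborel. indicator {0..1} t * v (x + t *\<^sub>R h))"
proof -
  have "integrable (lborel \<Otimes>\<^sub>M lborel) (\<lambda>(t, x). indicator {0..1::real} t * (v (x + t *\<^sub>R h) * indicator (cball 0 R) x))"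
    by (rule integrable_segment(2)[OF _ _ v, of _ 1 R]) (auto intro!: borel_measurable_indicator)
  from lborel_pair.integrable_snd[OF this]
  have "integrable lborel (\<lambda>x. LINT t|lborel. indicator (cball 0 R) x * (indicator {0..1::real} t * v (x + t *\<^sub>R h)))"
    by (simp add: ac_simps)
  then show ?thesis by (simp add: set_integrable_def)
qed


lemma prod_jet_has_derivative_along:
  fixes T :: "'n::finite \<Rightarrow> nat \<Rightarrow> real \<Rightarrow> real"
  assumes "\<And>i. bump_tower (T i)"
  shows "((\<lambda>t. prod_jet T (\<lambda>_. 0) (x - t *\<^sub>R h)) has_real_derivative
     - (\<Sum>i\<in>UNIV. h $ i * prod_jet T ((\<lambda>_. 0)(i := Suc 0)) (x - t *\<^sub>R h))) (at t)"
proof -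
  have "smooth_tower (T i)" for i using assms by (auto simp: bump_tower_def)
  then have "(prod_jet T (\<lambda>_. 0) has_derivative
      (\<lambda>k. \<Sum>i\<in>UNIV. k $ i * prod_jet T ((\<lambda>_. 0)(i := Suc 0)) (x - t *\<^sub>R h))) (at (x - t *\<^sub>R h))"
    using partials_at_prod_jet[of T "\<lambda>_. 0" "x - t *\<^sub>R h"] by (simp add: partials_at_def)
  moreover have "((\<lambda>t. x - t *\<^sub>R h) has_derivative (\<lambda>s. - (s *\<^sub>R h))) (at t)"
    by (auto intro!: derivative_eq_intros)
  ultimately have "((\<lambda>t. prod_jet T (\<lambda>_. 0) (x - t *\<^sub>R h)) has_derivative
      (\<lambda>s. \<Sum>i\<in>UNIV. (- (s *\<^sub>R h)) $ i * prod_jet T ((\<lambda>_. 0)(i := Suc 0)) (x - t *\<^sub>R h))) (at t)"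
    by (rule has_derivative_compose[rotated])
  then show ?thesis
    unfolding has_field_derivative_def
    by (rule has_derivative_eq_rhs) (auto simp: sum_distrib_left sum_negf mult_ac intro!: sum.cong)
qed

text \<open>The fundamental theorem of calculus is applied to the test function \<open>p\<close> and
  never to \<open>u\<close>. Moving the shift onto \<open>p\<close> turns the increment of
  \<open>u\<close> into \<open>p (x - h) - p x\<close>, which is minus the integral of the
  directional derivative \<open>q\<close> of \<open>p\<close> over the segment; the weak identity
  trades \<open>q\<close> for \<open>v\<close> at each \<open>t\<close>, and Fubini collects the
  average \<open>V\<close>.\<close>

lemma weak_derivative_segment:
  fixes u v :: "real ^ 'n::finite \<Rightarrow> real"
  assumes [measurable]: "u \<in> borel_measurable borel" "v \<in> borel_measurable borel"
    and u: "\<And>R. set_integrable lborel (cball 0 R) u"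
    and v: "\<And>R. set_integrable lborel (cball 0 R) v"
    and weak: "\<And>T. (\<And>i. bump_tower (T i)) \<Longrightarrow>
      (LINT x|lborel. u x * (\<Sum>i\<in>UNIV. h $ i * prod_jet T ((\<lambda>_. 0)(i := Suc 0)) x))
      = - (LINT x|lborel. v x * prod_jet T (\<lambda>_. 0) x)"
  shows "AE x in lborel. u (x + h) - u x = (LINT t|lborel. indicator {0..1} t * v (x + t *\<^sub>R h))"
proof -
  define V where "V x = (LINT t|lborel. indicator {0..1} t * v (x + t *\<^sub>R h))" for x
  have [measurable]: "V \<in> borel_measurable borel" unfolding V_def by measurable
  have V: "set_integrable lborel (cball 0 R) V" for R
    unfolding V_def by (rule set_integrable_segment_average) (use v in auto)
  have uh: "set_integrable lborel (cball 0 R) (\<lambda>x. u (x + h))" for R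
  proof -
    have "integrable lborel (\<lambda>x. indicator (cball 0 (R + norm h)) (x + h) * u (x + h))"
      using u[of "R + norm h"] lborel_integrable_translate[of "\<lambda>x. indicator (cball 0 (R + norm h)) x * u x" h]
      by (simp add: set_integrable_def)
    then have "set_integrable lborel ((\<lambda>x. x + h) -` cball 0 (R + norm h)) (\<lambda>x. u (x + h))"
      by (simp add: set_integrable_def indicator_def)
    then show ?thesis
      by (rule set_integrable_subset) (auto intro!: norm_triangle_le)
  qed
  have "AE x in lborel. u (x + h) - u x - V x = 0"
  proof (rule AE_zero_if_weakly_zero)
    show "set_integrable lborel (cball 0 R) (\<lambda>x. u (x + h) - u x - V x)" for R
      using u[of R] V[of R] uh[of R] by (intro set_integral_diff)
    fix T :: "'n \<Rightarrow> nat \<Rightarrow> real \<Rightarrow> real" assume T: "\<And>i. bump_tower (T i)"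
    define p where "p = prod_jet T (\<lambda>_. 0)"
    define q where "q x = (\<Sum>i\<in>UNIV. h $ i * prod_jet T ((\<lambda>_. 0)(i := Suc 0)) x)" for x
    note [measurable] = prod_jet_measurable[of T, OF T]
    have [measurable]: "p \<in> borel_measurable borel" "q \<in> borel_measurable borel"
      unfolding p_def q_def by measurable
    obtain R where R: "\<And>\<nu> x. R < norm x \<Longrightarrow> prod_jet T \<nu> x = 0"
      using prod_jet_support[of T] T by blast
    then have Rpq: "p x = 0" "q x = 0" if "R < norm x" for x using that by (auto simp: p_def q_def)
    obtain Bp where Bp: "\<And>x. \<bar>p x\<bar> \<le> Bp"
      using prod_jet_bounded[of T "\<lambda>_. 0"] T unfolding p_def by blast
    have "\<forall>i. \<exists>B. \<forall>x. \<bar>prod_jet T ((\<lambda>_. 0)(i := Suc 0)) x\<bar> \<le> B"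
      using prod_jet_bounded[of T] T by blast
    then obtain B where "\<And>i x. \<bar>prod_jet T ((\<lambda>_. 0)(i := Suc 0)) x\<bar> \<le> B i" by metis
    then have Bq: "\<bar>q x\<bar> \<le> (\<Sum>i\<in>UNIV. \<bar>h $ i\<bar> * B i)" for x
      unfolding q_def by (intro order_trans[OF sum_abs] sum_mono) (auto simp: abs_mult intro!: mult_left_mono)
    \<comment> \<open>Translating all factors of the test gives the weak identity at the shifted
      point.\<close>
    have weak_t: "(LINT x|lborel. u x * q (x - t *\<^sub>R h)) = - (LINT x|lborel. v x * p (x - t *\<^sub>R h))" for t
    proof -
      define T' where "T' i n s = T i n (s - t * h $ i)" for i n s
      have "bump_tower (T' i)" for i unfolding T'_def by (rule bump_tower_translate[OF T])
      moreover have "prod_jet T' \<nu> x = prod_jet T \<nu> (x - t *\<^sub>R h)" for \<nu> x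
        by (simp add: prod_jet_def T'_def)
      ultimately show ?thesis using weak[of T'] by (simp add: p_def q_def)
    qed
    have ftc: "(LINT t|lborel. indicator {0..1} t * q (x - t *\<^sub>R h)) = p x - p (x - h)" for x
    proof -
      have "((\<lambda>t. - p (x - t *\<^sub>R h)) has_real_derivative q (x - t *\<^sub>R h)) (at t)" for t
        using DERIV_minus[OF prod_jet_has_derivative_along[of T x h t, OF T]] by (simp add: p_def q_def)
      moreover have "isCont (\<lambda>t. q (x - t *\<^sub>R h)) t" for t
      proof -
        have "continuous_on UNIV q"
          unfolding q_def using T by (intro continuous_intros prod_jet_continuous) (auto simp: bump_tower_def)
        then have "continuous_on UNIV (\<lambda>t. q (x - t *\<^sub>R h))"
          by (rule continuous_on_compose2) (auto intro!: continuous_intros)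
        then show ?thesis by (simp add: continuous_on_eq_continuous_at)
      qed
      ultimately have "(LINT t|lborel. q (x - t *\<^sub>R h) * indicator {0..1} t) = - p (x - 1 *\<^sub>R h) - - p (x - 0 *\<^sub>R h)"
        by (intro integral_FTC_Icc_real) auto
      then show ?thesis by (simp add: mult.commute)
    qed
    have "(LINT x|lborel. u x * (p x - p (x - h)))
        = (LINT x|lborel. LINT t|lborel. indicator {0..1} t * (u x * q (x - t *\<^sub>R h)))"
      by (simp add: ftc[symmetric] ac_simps)
    also have "\<dots> = (LINT t|lborel. LINT x|lborel. indicator {0..1} t * (u x * q (x - t *\<^sub>R h)))"
      using integrable_segment(1)[where w = u and p = q and h = h, OF _ _ u Bq Rpq(2)] by (intro lborel_pair.Fubini_integral) auto
    also have "\<dots> = - (LINT t|lborel. indicator {0..1} t * (LINT x|lborel. v x * p (x - t *\<^sub>R h)))"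
      by (simp add: weak_t)
    also have "(LINT t|lborel. indicator {0..1} t * (LINT x|lborel. v x * p (x - t *\<^sub>R h)))
        = (LINT t|lborel. LINT x|lborel. indicator {0..1} t * (v (x + t *\<^sub>R h) * p x))"
    proof (intro Bochner_Integration.integral_cong refl)
      fix t :: real
      show "indicator {0..1} t * (LINT x|lborel. v x * p (x - t *\<^sub>R h))
          = (LINT x|lborel. indicator {0..1} t * (v (x + t *\<^sub>R h) * p x))"
        using lborel_integral_translate[of "\<lambda>x. v x * p (x - t *\<^sub>R h)" "t *\<^sub>R h"] by simp
    qed
    also have "\<dots> = (LINT x|lborel. LINT t|lborel. indicator {0..1} t * (v (x + t *\<^sub>R h) * p x))"
      using integrable_segment(2)[where w = v and p = p and h = h, OF _ _ v Bp Rpq(1)] by (intro lborel_pair.Fubini_integral[symmetric]) auto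
    also have "\<dots> = (LINT x|lborel. V x * p x)"
      unfolding V_def by (simp add: mult.assoc[symmetric])
    finally have 1: "(LINT x|lborel. u x * (p x - p (x - h))) = - (LINT x|lborel. V x * p x)" .
    have int: "integrable lborel (\<lambda>x. u x * p x)" "integrable lborel (\<lambda>x. V x * p x)"
        "integrable lborel (\<lambda>x. u (x + h) * p x)"
      unfolding p_def by (intro integrable_mult_prod_jet T u V uh)+
    have int': "integrable lborel (\<lambda>x. u x * p (x - h))"
      using lborel_integrable_translate[OF int(3), of "- h"] by simp
    have "(LINT x|lborel. u (x + h) * p x) = (LINT x|lborel. u x * p (x - h))"
      using lborel_integral_translate[of "\<lambda>x. u x * p (x - h)" h] by simp
    moreover have "(LINT x|lborel. u x * (p x - p (x - h))) = (LINT x|lborel. u x * p x) - (LINT x|lborel. u x * p (x - h))"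
      using int int' by (simp add: right_diff_distrib)
    moreover have "(LINT x|lborel. (u (x + h) - u x - V x) * p x)
        = (LINT x|lborel. u (x + h) * p x) - (LINT x|lborel. u x * p x) - (LINT x|lborel. V x * p x)"
      using int by (simp add: left_diff_distrib)
    ultimately show "(LINT x|lborel. (u (x + h) - u x - V x) * prod_jet T (\<lambda>_. 0) x) = 0"
      using 1 by (simp add: p_def)
  qed
  then show ?thesis by (simp add: V_def)
qed

lemma weak_derivative_segment_le:
  fixes u v :: "real ^ 'n::finite \<Rightarrow> real"
  assumes "u \<in> borel_measurable borel" "v \<in> borel_measurable borel"
    and "\<And>R. set_integrable lborel (cball 0 R) u"
    and "\<And>R. set_integrable lborel (cball 0 R) v"
    and "\<And>T. (\<And>i. bump_tower (T i)) \<Longrightarrow>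
      (LINT x|lborel. u x * (\<Sum>i\<in>UNIV. h $ i * prod_jet T ((\<lambda>_. 0)(i := Suc 0)) x))
      = - (LINT x|lborel. v x * prod_jet T (\<lambda>_. 0) x)"
  shows "AE x in lborel. ennreal \<bar>u x\<bar> \<le>
    ennreal \<bar>u (x + h)\<bar> + (\<integral>\<^sup>+t. ennreal \<bar>v (x + t *\<^sub>R h)\<bar> * indicator {0..1} t \<partial>lborel)"
proof -
  have "AE x in lborel. u (x + h) - u x = (LINT t|lborel. indicator {0..1} t * v (x + t *\<^sub>R h))"
    by (rule weak_derivative_segment) (use assms in auto)
  then show ?thesis
  proof eventually_elim
    case (elim x)
    let ?V = "LINT t|lborel. indicator {0..1} t * v (x + t *\<^sub>R h)"
    have "ennreal \<bar>u x\<bar> \<le> ennreal (\<bar>u (x + h)\<bar> + \<bar>?V\<bar>)" using elim by (intro ennreal_leI) linarith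
    also have "\<dots> = ennreal \<bar>u (x + h)\<bar> + ennreal \<bar>?V\<bar>" by simp
    \<comment> \<open>If \<open>v\<close> is not integrable along the segment, the integral
      \<open>?V\<close> is \<open>0\<close> by convention and the bound is trivial.\<close>
    also have "ennreal \<bar>?V\<bar> \<le> (\<integral>\<^sup>+t. ennreal \<bar>indicator {0..1} t * v (x + t *\<^sub>R h)\<bar> \<partial>lborel)"
      using integral_norm_bound_ennreal[of lborel "\<lambda>t. indicator {0..1} t * v (x + t *\<^sub>R h)"]
      by (cases "integrable lborel (\<lambda>t. indicator {0..1} t * v (x + t *\<^sub>R h))")
         (auto simp: not_integrable_integral_eq)
    also have "\<dots> = (\<integral>\<^sup>+t. ennreal \<bar>v (x + t *\<^sub>R h)\<bar> * indicator {0..1} t \<partial>lborel)"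
      by (intro nn_integral_cong) (auto simp: indicator_def)
    finally show ?case by (simp add: add_left_mono)
  qed
qed

section \<open>Gaussian moments\<close>

definition gauss :: "'a::real_inner \<Rightarrow> real" where
  "gauss x = exp (- (norm x)\<^sup>2 / 2)"

lemma gauss_pos: "gauss x > 0"
  by (simp add: gauss_def)

lemma gauss_measurable [measurable]:
  "(gauss :: 'a::{real_inner, second_countable_topology} \<Rightarrow> real) \<in> borel_measurable borel"
  unfolding gauss_def[abs_def] by measurable

lemma borel_measurable_vec_nth [measurable (raw)]:
  fixes f :: "'a \<Rightarrow> real ^ 'n::finite"
  assumes "f \<in> borel_measurable M" shows "(\<lambda>x. f x $ i) \<in> borel_measurable M"
proof (rule measurable_compose[OF assms])
  show "(\<lambda>x :: real ^ 'n. x $ i) \<in> borel_measurable borel"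
    by (intro borel_measurable_continuous_onI continuous_intros)
qed

lemma gauss_shift: "gauss x = gauss (x - h) * exp ((norm h)\<^sup>2 / 2 - x \<bullet> h)"
proof -
  have "(norm (x - h))\<^sup>2 = (norm x)\<^sup>2 - 2 * (x \<bullet> h) + (norm h)\<^sup>2"
    by (simp add: power2_norm_eq_inner algebra_simps inner_commute)
  then show ?thesis by (simp add: gauss_def exp_add[symmetric] field_simps)
qed

lemma ennreal_square_add_le: "(a + b)\<^sup>2 \<le> 2 * a\<^sup>2 + 2 * (b :: ennreal)\<^sup>2"
proof (cases a; cases b)
  fix r s :: real assume *: "a = ennreal r" "0 \<le> r" "b = ennreal s" "0 \<le> s"
  have "(r + s)\<^sup>2 \<le> 2 * r\<^sup>2 + 2 * s\<^sup>2" using sum_squares_bound[of r s] by (simp add: power2_eq_square algebra_simps)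
  then have "ennreal ((r + s)\<^sup>2) \<le> ennreal (2 * r\<^sup>2 + 2 * s\<^sup>2)" by (rule ennreal_leI)
  also have "ennreal (2 * r\<^sup>2 + 2 * s\<^sup>2) = 2 * ennreal (r\<^sup>2) + 2 * ennreal (s\<^sup>2)" by (simp add: ennreal_mult')
  finally show ?thesis using * by (simp add: ennreal_power ennreal_plus[symmetric] del: ennreal_plus)
qed (auto simp: ennreal_mult_top)

lemma power_le_fact_exp:
  fixes y :: real assumes "y \<ge> 0" shows "y ^ n \<le> fact n * exp y"
proof -
  have "y ^ n /\<^sub>R fact n \<le> (\<Sum>k. y ^ k /\<^sub>R fact k)"
    using sum_le_suminf[OF summable_exp_generic[of y], of "{n}"] assms by simp
  then show ?thesis by (simp add: exp_def field_simps)
qed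

text \<open>The integral is at most the smaller of \<open>1\<close> and \<open>2 / s\<close>. The
  two bounds meet at \<open>s = 2\<close>, where both give the constant \<open>3\<close>.\<close>

lemma exp_kernel_bound:
  fixes s :: real assumes "s \<ge> 0"
  shows "ennreal (1 + s) * (\<integral>\<^sup>+t. ennreal (exp (- (s * t / 2))) * indicator {0..1} t \<partial>lborel) \<le> 3" (is "_ * ?I \<le> _")
proof (cases "s \<le> 2")
  case True
  have "?I \<le> (\<integral>\<^sup>+t. indicator {0..1::real} t \<partial>lborel)"
    using assms by (intro nn_integral_mono) (auto simp: indicator_def)
  then have "?I \<le> 1" by simp
  then have "ennreal (1 + s) * ?I \<le> ennreal (1 + s) * 1" by (rule mult_left_mono) simp
  also have "\<dots> \<le> ennreal 3" using True by (simp only: mult_1_right) (intro ennreal_leI, simp)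
  finally show ?thesis by simp
next
  case False
  have "?I = ennreal (- (2 / s) * exp (- (s * 1 / 2)) - (- (2 / s) * exp (- (s * 0 / 2))))"
    using False by (intro nn_integral_FTC_Icc) (auto intro!: derivative_eq_intros)
  also have "\<dots> \<le> ennreal (2 / s)" using False by (intro ennreal_leI) (auto simp: field_simps)
  finally have "ennreal (1 + s) * ?I \<le> ennreal (1 + s) * ennreal (2 / s)" by (rule mult_left_mono) simp
  also have "\<dots> = ennreal ((1 + s) * (2 / s))" using False by (intro ennreal_mult[symmetric]) auto
  also have "\<dots> \<le> ennreal 3" using False by (intro ennreal_leI) (auto simp: field_simps)
  finally show ?thesis by simp
qed

text \<open>The first summand belongs to the shifted values of \<open>u\<close>: the square of a sum
  costs \<open>2\<close>, \<open>(1 + s) ^ (2 * m + 2) * exp (- s)\<close> is at most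
  \<open>fact (2 * m + 2) * exp 1\<close>, and a unit shift of the Gaussian costs
  \<open>exp (1 / 2)\<close>. In the second, \<open>18\<close> is that \<open>2\<close> times two
  uses of the bound \<open>3\<close> of \<open>exp_kernel_bound\<close>, \<open>exp 1\<close> is the
  product of two losses \<open>exp (1 / 2)\<close>, and the power of \<open>2\<close> compares the
  weights at two points at distance at most \<open>1\<close>.\<close>

definition moment_const :: "nat \<Rightarrow> real" where
  "moment_const m = 2 * (fact (2 * m + 2) * exp 1 * exp (1 / 2)) + 18 * exp 1 * 2 ^ (2 * m + 1)"

lemma moment_const_nonneg: "0 \<le> moment_const m"
  by (simp add: moment_const_def)

text \<open>The derivative term after Cauchy-Schwarz, up to constants. One of the
  \<open>2 * m + 2\<close> powers is already spent on the factor of Cauchy-Schwarz that does not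
  contain \<open>v\<close>. The Gaussian shift gains \<open>exp (- s t)\<close> with
  \<open>s = \<sigma> * x $ i\<close>, the other factor costs \<open>exp (s t / 2)\<close>, and half
  of the exponent remains.\<close>

definition moment_kernel ::
  "(real ^ 'n::finite \<Rightarrow> real) \<Rightarrow> real \<Rightarrow> 'n \<Rightarrow> nat \<Rightarrow> real ^ 'n \<Rightarrow> real \<Rightarrow> real" where
  "moment_kernel v \<sigma> i m x t = (1 + \<sigma> * x $ i) ^ (2 * m + 1) * exp (- (\<sigma> * x $ i * t / 2))
     * ((v (x - (t * \<sigma>) *\<^sub>R axis i 1))\<^sup>2 * gauss (x - (t * \<sigma>) *\<^sub>R axis i 1))"

lemma moment_kernel_measurable [measurable (raw)]:
  fixes v :: "real ^ 'n::finite \<Rightarrow> real"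
  assumes [measurable]: "v \<in> borel_measurable borel" "f \<in> borel_measurable M" "g \<in> borel_measurable M"
  shows "(\<lambda>z. moment_kernel v \<sigma> i m (f z) (g z)) \<in> borel_measurable M"
  unfolding moment_kernel_def by measurable

text \<open>A unit step towards the hyperplane \<open>x $ i = 0\<close> from a point at distance \<open>s\<close> gains a factor
  \<open>exp (- s)\<close>. Cauchy-Schwarz along the step is applied with the weight \<open>exp (- s * t / 2)\<close>, whose
  integral is \<open>O (1 / (1 + s))\<close>: this is what makes the derivative cost two powers of \<open>s\<close> less.\<close>

lemma gaussian_moment_half:
  fixes u v :: "real ^ 'n::finite \<Rightarrow> real"
  assumes [measurable]: "u \<in> borel_measurable borel" "v \<in> borel_measurable borel"
    and \<sigma>: "\<sigma> = 1 \<or> \<sigma> = - 1"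
    and seg: "AE x in lborel. ennreal \<bar>u x\<bar> \<le> ennreal \<bar>u (x - \<sigma> *\<^sub>R axis i 1)\<bar>
       + (\<integral>\<^sup>+t. ennreal \<bar>v (x - (t * \<sigma>) *\<^sub>R axis i 1)\<bar> * indicator {0..1} t \<partial>lborel)"
  shows "(\<integral>\<^sup>+x. ennreal ((1 + \<bar>x $ i\<bar>) ^ (2 * m + 2) * (u x)\<^sup>2 * gauss x) * indicator {x. 0 \<le> \<sigma> * x $ i} x \<partial>lborel)
    \<le> ennreal (moment_const m) *
       (\<integral>\<^sup>+x. ennreal ((1 + \<bar>x $ i\<bar>) ^ (2 * m) * ((u x)\<^sup>2 + (v x)\<^sup>2) * gauss x) \<partial>lborel)"
proof -
  let ?e = "\<lambda>t. (t * \<sigma>) *\<^sub>R axis i 1 :: real ^ 'n"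
  define c where "c = fact (2 * m + 2) * exp 1 * exp (1 / 2 :: real)"
  define U where "U x = ennreal ((u x)\<^sup>2 * gauss x)" for x
  let ?k = "moment_kernel v \<sigma> i m"
  define H where "H = {x :: real ^ 'n. 0 \<le> \<sigma> * x $ i}"
  have [measurable]: "H \<in> sets borel" unfolding H_def by measurable
  have [measurable]: "U \<in> borel_measurable borel" unfolding U_def by measurable
  have \<sigma>2: "\<sigma> * \<sigma> = 1" "\<bar>\<sigma>\<bar> = 1" using \<sigma> by auto
  have ne: "(norm (?e t))\<^sup>2 = t\<^sup>2" "x \<bullet> ?e t = t * (\<sigma> * x $ i)" for t x
    using \<sigma>2 by (auto simp: power2_norm_eq_inner inner_axis power2_eq_square norm_mult abs_mult)
  have pw: "AE x in lborel. ennreal ((1 + \<bar>x $ i\<bar>) ^ (2 * m + 2) * (u x)\<^sup>2 * gauss x) * indicator H x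
     \<le> ennreal (2 * c) * U (x - ?e 1)
       + ennreal (6 * exp (1 / 2)) * (\<integral>\<^sup>+t. ennreal (?k x t) * indicator {0..1} t * indicator H x \<partial>lborel)"
    using seg
  proof eventually_elim
    case (elim x)
    show ?case
    proof (cases "x \<in> H")
      case True
      define s where "s = \<sigma> * x $ i"
      have s: "s \<ge> 0" "\<bar>x $ i\<bar> = s" using True \<sigma> by (auto simp: H_def s_def)
      define A where "A = ennreal \<bar>u (x - ?e 1)\<bar>"
      define I where "I = (\<integral>\<^sup>+t. ennreal \<bar>v (x - ?e t)\<bar> * indicator {0..1} t \<partial>lborel)"
      define J where "J = (\<integral>\<^sup>+t. ennreal (exp (s * t / 2) * (v (x - ?e t))\<^sup>2) * indicator {0..1} t \<partial>lborel)"
      have "I = (\<integral>\<^sup>+t. (ennreal (exp (- (s * t / 4))) * indicator {0..1} t)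
          * (ennreal (exp (s * t / 4) * \<bar>v (x - ?e t)\<bar>) * indicator {0..1} t) \<partial>lborel)"
        unfolding I_def
        by (intro nn_integral_cong) (auto simp: indicator_def ennreal_mult[symmetric] exp_minus)
      then have "I\<^sup>2 \<le> (\<integral>\<^sup>+t. (ennreal (exp (- (s * t / 4))) * indicator {0..1} t)\<^sup>2 \<partial>lborel)
          * (\<integral>\<^sup>+t. (ennreal (exp (s * t / 4) * \<bar>v (x - ?e t)\<bar>) * indicator {0..1} t)\<^sup>2 \<partial>lborel)"
        by (simp only:) (rule Cauchy_Schwarz_nn_integral; measurable)
      also have "(\<integral>\<^sup>+t. (ennreal (exp (- (s * t / 4))) * indicator {0..1} t)\<^sup>2 \<partial>lborel)
         = (\<integral>\<^sup>+t. ennreal (exp (- (s * t / 2))) * indicator {0..1} t \<partial>lborel)"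
        by (intro nn_integral_cong) (auto simp: indicator_def ennreal_power exp_double[symmetric])
      also have "(\<integral>\<^sup>+t. (ennreal (exp (s * t / 4) * \<bar>v (x - ?e t)\<bar>) * indicator {0..1} t)\<^sup>2 \<partial>lborel) = J"
        unfolding J_def
        by (intro nn_integral_cong) (auto simp: indicator_def ennreal_power power_mult_distrib exp_double[symmetric])
      finally have I2: "I\<^sup>2 \<le> (\<integral>\<^sup>+t. ennreal (exp (- (s * t / 2))) * indicator {0..1} t \<partial>lborel) * J" .
      have "ennreal ((u x)\<^sup>2) = (ennreal \<bar>u x\<bar>)\<^sup>2" by (simp add: ennreal_power)
      also have "\<dots> \<le> (A + I)\<^sup>2" using elim by (intro power_mono) (auto simp: A_def I_def)
      also have "\<dots> \<le> 2 * A\<^sup>2 + 2 * I\<^sup>2" by (rule ennreal_square_add_le)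
      finally have u2: "ennreal ((u x)\<^sup>2) \<le> 2 * A\<^sup>2 + 2 * I\<^sup>2" .
      let ?P = "(1 + s) ^ (2 * m + 2) * gauss x"
      have "ennreal ?P * A\<^sup>2 = ennreal ((1 + s) ^ (2 * m + 2) * (gauss x * (u (x - ?e 1))\<^sup>2))"
        using s gauss_pos[of x] by (simp add: A_def ennreal_power ennreal_mult[symmetric] mult.assoc)
      also have "\<dots> \<le> ennreal (c * ((u (x - ?e 1))\<^sup>2 * gauss (x - ?e 1)))"
      proof (rule ennreal_leI)
        \<comment> \<open>The gain \<open>exp (- s)\<close> of a full unit step swallows the entire
          weight, so this term retains no moment at all.\<close>
        have "(1 + s) ^ (2 * m + 2) * exp (1 / 2 - s) \<le> (fact (2 * m + 2) * exp (1 + s)) * exp (1 / 2 - s)"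
          using s by (intro mult_right_mono power_le_fact_exp) auto
        also have "\<dots> = c" by (simp add: c_def exp_add exp_diff)
        finally have "(1 + s) ^ (2 * m + 2) * exp (1 / 2 - s) * (gauss (x - ?e 1) * (u (x - ?e 1))\<^sup>2)
            \<le> c * (gauss (x - ?e 1) * (u (x - ?e 1))\<^sup>2)"
          using gauss_pos[of "x - ?e 1"] by (intro mult_right_mono) auto
        moreover have "gauss x = gauss (x - ?e 1) * exp (1 / 2 - s)"
          using gauss_shift[of x "?e 1"] unfolding ne by (simp add: s_def)
        ultimately show "(1 + s) ^ (2 * m + 2) * (gauss x * (u (x - ?e 1))\<^sup>2) \<le> c * ((u (x - ?e 1))\<^sup>2 * gauss (x - ?e 1))"
          by (simp add: ac_simps)
      qed
      also have "\<dots> = ennreal c * U (x - ?e 1)" unfolding U_def using gauss_pos[of "x - ?e 1"]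
        by (subst ennreal_mult) (auto simp: c_def)
      finally have first: "ennreal ?P * A\<^sup>2 \<le> ennreal c * U (x - ?e 1)" .
      have "ennreal ?P * I\<^sup>2 \<le> ennreal ?P * ((\<integral>\<^sup>+t. ennreal (exp (- (s * t / 2))) * indicator {0..1} t \<partial>lborel) * J)"
        by (intro mult_left_mono I2) simp
      also have "\<dots> = (ennreal (1 + s) * (\<integral>\<^sup>+t. ennreal (exp (- (s * t / 2))) * indicator {0..1} t \<partial>lborel))
           * (ennreal ((1 + s) ^ (2 * m + 1) * gauss x) * J)"
      proof -
        have "ennreal ?P = ennreal (1 + s) * ennreal ((1 + s) ^ (2 * m + 1) * gauss x)"
          using s gauss_pos[of x] by (subst ennreal_mult[symmetric]) auto
        then show ?thesis by (simp only: ac_simps)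
      qed
      also have "\<dots> \<le> 3 * (ennreal ((1 + s) ^ (2 * m + 1) * gauss x) * J)"
        by (intro mult_right_mono exp_kernel_bound s) simp
      also have "ennreal ((1 + s) ^ (2 * m + 1) * gauss x) * J
          = (\<integral>\<^sup>+t. ennreal ((1 + s) ^ (2 * m + 1) * gauss x) * (ennreal (exp (s * t / 2) * (v (x - ?e t))\<^sup>2) * indicator {0..1} t) \<partial>lborel)"
        unfolding J_def by (rule nn_integral_cmult[symmetric]) measurable
      also have "\<dots> \<le> (\<integral>\<^sup>+t. ennreal (exp (1/2)) * (ennreal (?k x t) * indicator {0..1} t * indicator H x) \<partial>lborel)"
      proof (rule nn_integral_mono, cases)
        fix t :: real assume t: "t \<in> {0..1}"
        have "t\<^sup>2 \<le> 1" using t by (auto simp: power_le_one)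
        then have "exp (t\<^sup>2 / 2 - t * s) * exp (s * t / 2) \<le> exp (1 / 2) * exp (- (s * t / 2))"
          by (simp add: exp_add[symmetric] field_simps)
        moreover have "gauss x = gauss (x - ?e t) * exp (t\<^sup>2 / 2 - t * s)"
          using gauss_shift[of x "?e t"] unfolding ne by (simp add: s_def)
        ultimately have "gauss x * exp (s * t / 2) \<le> exp (1 / 2) * exp (- (s * t / 2)) * gauss (x - ?e t)"
          using gauss_pos[of "x - ?e t"] by (simp add: mult_left_mono mult.assoc mult.left_commute)
        then have "(gauss x * exp (s * t / 2)) * ((1 + s) ^ (2 * m + 1) * (v (x - ?e t))\<^sup>2)
           \<le> (exp (1 / 2) * exp (- (s * t / 2)) * gauss (x - ?e t)) * ((1 + s) ^ (2 * m + 1) * (v (x - ?e t))\<^sup>2)"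
          using s by (intro mult_right_mono) auto
        also have "\<dots> = exp (1 / 2) * ?k x t" by (simp add: moment_kernel_def s_def ac_simps)
        finally have "ennreal ((gauss x * exp (s * t / 2)) * ((1 + s) ^ (2 * m + 1) * (v (x - ?e t))\<^sup>2)) \<le> ennreal (exp (1/2) * ?k x t)"
          by (rule ennreal_leI)
        then show "ennreal ((1 + s) ^ (2 * m + 1) * gauss x) * (ennreal (exp (s * t / 2) * (v (x - ?e t))\<^sup>2) * indicator {0..1} t)
          \<le> ennreal (exp (1/2)) * (ennreal (?k x t) * indicator {0..1} t * indicator H x)"
          using t True s gauss_pos[of x] ennreal_mult''[of "exp (1/2)" "?k x t"]
          by (simp add: ennreal_mult'[symmetric] ac_simps)
      qed simp
      also have "\<dots> = ennreal (exp (1/2)) * (\<integral>\<^sup>+t. ennreal (?k x t) * indicator {0..1} t * indicator H x \<partial>lborel)"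
        by (rule nn_integral_cmult) measurable
      finally have second: "ennreal ?P * I\<^sup>2 \<le> 3 * (ennreal (exp (1/2)) * (\<integral>\<^sup>+t. ennreal (?k x t) * indicator {0..1} t * indicator H x \<partial>lborel))"
        by (simp add: mult_left_mono)
      have "ennreal ((1 + \<bar>x $ i\<bar>) ^ (2 * m + 2) * (u x)\<^sup>2 * gauss x) = ennreal ?P * ennreal ((u x)\<^sup>2)"
        using s gauss_pos[of x] by (simp add: ennreal_mult[symmetric] ac_simps)
      also have "\<dots> \<le> ennreal ?P * (2 * A\<^sup>2 + 2 * I\<^sup>2)" by (intro mult_left_mono u2) simp
      also have "\<dots> = 2 * (ennreal ?P * A\<^sup>2) + 2 * (ennreal ?P * I\<^sup>2)" by (simp only: distrib_left mult.left_commute)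
      also have "\<dots> \<le> 2 * (ennreal c * U (x - ?e 1))
         + 2 * (3 * (ennreal (exp (1/2)) * (\<integral>\<^sup>+t. ennreal (?k x t) * indicator {0..1} t * indicator H x \<partial>lborel)))"
        by (intro add_mono mult_left_mono first second) simp_all
      also have "\<dots> = ennreal (2 * c) * U (x - ?e 1)
         + ennreal (6 * exp (1/2)) * (\<integral>\<^sup>+t. ennreal (?k x t) * indicator {0..1} t * indicator H x \<partial>lborel)"
      proof -
        have "ennreal (2 * c) = 2 * ennreal c" by (simp add: ennreal_mult' c_def)
        moreover have "ennreal (6 * exp (1/2)) = 2 * (3 * ennreal (exp (1/2)))"
          by (simp add: ennreal_mult' mult.assoc[symmetric])
        ultimately show ?thesis by (simp only: mult.assoc)
      qed
      finally show ?thesis using True by simp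
    qed simp
  qed
  let ?Q = "\<integral>\<^sup>+x. ennreal ((1 + \<bar>x $ i\<bar>) ^ (2 * m) * ((u x)\<^sup>2 + (v x)\<^sup>2) * gauss x) \<partial>lborel"
  have "(\<integral>\<^sup>+x. U (x - ?e 1) \<partial>lborel) = (\<integral>\<^sup>+x. U x \<partial>lborel)"
    using nn_integral_lborel_translate[of U "- ?e 1"] by simp
  also have "\<dots> \<le> ?Q"
    unfolding U_def
  proof (intro nn_integral_mono ennreal_leI mult_right_mono)
    fix x :: "real ^ 'n"
    have "1 * (u x)\<^sup>2 \<le> (1 + \<bar>x $ i\<bar>) ^ (2 * m) * ((u x)\<^sup>2 + (v x)\<^sup>2)"
      by (intro mult_mono one_le_power) auto
    then show "(u x)\<^sup>2 \<le> (1 + \<bar>x $ i\<bar>) ^ (2 * m) * ((u x)\<^sup>2 + (v x)\<^sup>2)" by simp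
  qed (use gauss_pos less_imp_le in blast)
  finally have U_le: "(\<integral>\<^sup>+x. U (x - ?e 1) \<partial>lborel) \<le> ?Q" .
  have "(\<integral>\<^sup>+x. \<integral>\<^sup>+t. ennreal (?k x t) * indicator {0..1} t * indicator H x \<partial>lborel \<partial>lborel)
     = (\<integral>\<^sup>+t. \<integral>\<^sup>+x. ennreal (?k x t) * indicator {0..1} t * indicator H x \<partial>lborel \<partial>lborel)"
    by (rule lborel_pair.Fubini') measurable
  also have "\<dots> \<le> (\<integral>\<^sup>+t. \<integral>\<^sup>+x. ennreal (2 ^ (2 * m + 1) * exp (1/2) * (1 + \<bar>x $ i\<bar>) ^ (2 * m) * ((v x)\<^sup>2 * gauss x))
        * (ennreal (1 + \<bar>x $ i\<bar>) * (ennreal (exp (- (\<bar>x $ i\<bar> * t / 2))) * indicator {0..1} t)) \<partial>lborel \<partial>lborel)"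
  proof (rule nn_integral_mono)
    fix t :: real
    \<comment> \<open>Translating back puts \<open>v\<close> at \<open>x\<close>. The weight is then
      evaluated at \<open>s + t\<close> and has to be compared with its value at
      \<open>|s|\<close>.\<close>
    have "(\<integral>\<^sup>+x. ennreal (?k x t) * indicator {0..1} t * indicator H x \<partial>lborel)
       = (\<integral>\<^sup>+x. ennreal (?k (x + ?e t) t) * indicator {0..1} t * indicator H (x + ?e t) \<partial>lborel)"
      by (rule nn_integral_lborel_translate[symmetric]) measurable
    also have "\<dots> \<le> (\<integral>\<^sup>+x. ennreal (2 ^ (2 * m + 1) * exp (1/2) * (1 + \<bar>x $ i\<bar>) ^ (2 * m) * ((v x)\<^sup>2 * gauss x))
        * (ennreal (1 + \<bar>x $ i\<bar>) * (ennreal (exp (- (\<bar>x $ i\<bar> * t / 2))) * indicator {0..1} t)) \<partial>lborel)"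
    proof (rule nn_integral_mono)
      fix x :: "real ^ 'n"
      define s where "s = \<sigma> * x $ i"
      have eq: "\<sigma> * (x + ?e t) $ i = s + t" using \<sigma>2 by (simp add: s_def axis_def algebra_simps)
      show "ennreal (?k (x + ?e t) t) * indicator {0..1} t * indicator H (x + ?e t)
         \<le> ennreal (2 ^ (2 * m + 1) * exp (1/2) * (1 + \<bar>x $ i\<bar>) ^ (2 * m) * ((v x)\<^sup>2 * gauss x))
        * (ennreal (1 + \<bar>x $ i\<bar>) * (ennreal (exp (- (\<bar>x $ i\<bar> * t / 2))) * indicator {0..1} t))"
      proof (cases "t \<in> {0..1} \<and> 0 \<le> s + t")
        case True
        have xs: "\<bar>x $ i\<bar> = \<bar>s\<bar>" using \<sigma>2 by (simp add: s_def abs_mult)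
        have power_eq: "(2 * (1 + \<bar>s\<bar>)) ^ (2 * m + 1) = 2 ^ (2 * m + 1) * (1 + \<bar>s\<bar>) ^ (2 * m) * (1 + \<bar>s\<bar>)"
          by (simp only: power_mult_distrib power_add power_one_right mult.assoc)
        have "(1 + (s + t)) ^ (2 * m + 1) \<le> (2 * (1 + \<bar>s\<bar>)) ^ (2 * m + 1)"
          using True by (intro power_mono) auto
        moreover have "exp (- ((s + t) * t / 2)) \<le> exp (1/2) * exp (- (\<bar>s\<bar> * t / 2))"
        proof -
          \<comment> \<open>For negative \<open>s\<close> the condition \<open>0 \<le> s + t\<close>
            forces \<open>|s| \<le> t \<le> 1\<close>, so at most \<open>1\<close> is lost.\<close>
          have "\<bar>s\<bar> * t \<le> (s + t) * t + 1"
          proof (cases "s \<ge> 0")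
            case False
            have "\<bar>s\<bar> * t \<le> 1 * 1" using True False by (intro mult_mono) auto
            moreover have "0 \<le> (s + t) * t" using True by auto
            ultimately show ?thesis by linarith
          qed (use True in \<open>auto simp: algebra_simps intro: add_nonneg_nonneg\<close>)
          then show ?thesis by (simp add: exp_add[symmetric] field_simps)
        qed
        ultimately have "(1 + (s + t)) ^ (2 * m + 1) * exp (- ((s + t) * t / 2)) * ((v x)\<^sup>2 * gauss x)
           \<le> (2 * (1 + \<bar>s\<bar>)) ^ (2 * m + 1) * (exp (1/2) * exp (- (\<bar>s\<bar> * t / 2))) * ((v x)\<^sup>2 * gauss x)"
          using True gauss_pos[of x] by (intro mult_right_mono mult_mono) auto
        then have "?k (x + ?e t) t \<le> (2 ^ (2 * m + 1) * exp (1/2) * (1 + \<bar>x $ i\<bar>) ^ (2 * m) * ((v x)\<^sup>2 * gauss x))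
             * ((1 + \<bar>x $ i\<bar>) * exp (- (\<bar>x $ i\<bar> * t / 2)))"
          unfolding moment_kernel_def eq xs power_eq by (simp only: add_diff_cancel_right' ac_simps)
        then have "ennreal (?k (x + ?e t) t) \<le> ennreal ((2 ^ (2 * m + 1) * exp (1/2) * (1 + \<bar>x $ i\<bar>) ^ (2 * m) * ((v x)\<^sup>2 * gauss x))
             * ((1 + \<bar>x $ i\<bar>) * exp (- (\<bar>x $ i\<bar> * t / 2))))" by (rule ennreal_leI)
        also have "\<dots> = ennreal (2 ^ (2 * m + 1) * exp (1/2) * (1 + \<bar>x $ i\<bar>) ^ (2 * m) * ((v x)\<^sup>2 * gauss x))
           * (ennreal (1 + \<bar>x $ i\<bar>) * ennreal (exp (- (\<bar>x $ i\<bar> * t / 2))))"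
          using gauss_pos[of x] by (simp add: ennreal_mult)
        finally show ?thesis using True by (simp add: indicator_def)
      next
        case False
        then have "indicator {0..1} t * indicator H (x + ?e t) = (0::ennreal)"
          using eq by (auto simp: H_def indicator_def)
        then have "ennreal (?k (x + ?e t) t) * indicator {0..1} t * indicator H (x + ?e t) = 0"
          by (simp add: mult.assoc)
        then show ?thesis by (simp only: zero_le)
      qed
    qed
    finally show "(\<integral>\<^sup>+x. ennreal (?k x t) * indicator {0..1} t * indicator H x \<partial>lborel) \<le> \<dots>" .
  qed
  also have "\<dots> = (\<integral>\<^sup>+x. \<integral>\<^sup>+t. ennreal (2 ^ (2 * m + 1) * exp (1/2) * (1 + \<bar>x $ i\<bar>) ^ (2 * m) * ((v x)\<^sup>2 * gauss x))
        * (ennreal (1 + \<bar>x $ i\<bar>) * (ennreal (exp (- (\<bar>x $ i\<bar> * t / 2))) * indicator {0..1} t)) \<partial>lborel \<partial>lborel)"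
    by (rule lborel_pair.Fubini') measurable
  also have "\<dots> = (\<integral>\<^sup>+x. ennreal (2 ^ (2 * m + 1) * exp (1/2) * (1 + \<bar>x $ i\<bar>) ^ (2 * m) * ((v x)\<^sup>2 * gauss x))
        * (ennreal (1 + \<bar>x $ i\<bar>) * (\<integral>\<^sup>+t. ennreal (exp (- (\<bar>x $ i\<bar> * t / 2))) * indicator {0..1} t \<partial>lborel)) \<partial>lborel)"
    by (simp add: nn_integral_cmult)
  \<comment> \<open>With \<open>x\<close> fixed and \<open>t\<close> integrated, the kernel bound
    applies again and spends the second power of \<open>1 + \<bar>x $ i\<bar>\<close>.\<close>
  also have "\<dots> \<le> (\<integral>\<^sup>+x. ennreal (2 ^ (2 * m + 1) * exp (1/2) * (1 + \<bar>x $ i\<bar>) ^ (2 * m) * ((v x)\<^sup>2 * gauss x)) * 3 \<partial>lborel)"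
    by (intro nn_integral_mono mult_left_mono exp_kernel_bound) auto
  also have "\<dots> \<le> (\<integral>\<^sup>+x. ennreal (3 * (2 ^ (2 * m + 1) * exp (1/2))) * ennreal ((1 + \<bar>x $ i\<bar>) ^ (2 * m) * ((u x)\<^sup>2 + (v x)\<^sup>2) * gauss x) \<partial>lborel)"
  proof (rule nn_integral_mono)
    fix x :: "real ^ 'n"
    have "ennreal (2 ^ (2 * m + 1) * exp (1/2) * (1 + \<bar>x $ i\<bar>) ^ (2 * m) * ((v x)\<^sup>2 * gauss x)) * 3
      = ennreal (2 ^ (2 * m + 1) * exp (1/2) * (1 + \<bar>x $ i\<bar>) ^ (2 * m) * ((v x)\<^sup>2 * gauss x) * 3)"
      by (subst ennreal_mult''[where b = 3]) simp_all
    also have "\<dots> \<le> ennreal (3 * (2 ^ (2 * m + 1) * exp (1/2)) * ((1 + \<bar>x $ i\<bar>) ^ (2 * m) * ((u x)\<^sup>2 + (v x)\<^sup>2) * gauss x))"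
    proof (rule ennreal_leI)
      have "3 * (2 ^ (2 * m + 1) * exp (1/2)) * ((1 + \<bar>x $ i\<bar>) ^ (2 * m) * (v x)\<^sup>2 * gauss x)
        \<le> 3 * (2 ^ (2 * m + 1) * exp (1/2)) * ((1 + \<bar>x $ i\<bar>) ^ (2 * m) * ((u x)\<^sup>2 + (v x)\<^sup>2) * gauss x)"
        using gauss_pos[of x] by (intro mult_left_mono mult_right_mono) auto
      then show "2 ^ (2 * m + 1) * exp (1/2) * (1 + \<bar>x $ i\<bar>) ^ (2 * m) * ((v x)\<^sup>2 * gauss x) * 3
        \<le> 3 * (2 ^ (2 * m + 1) * exp (1/2)) * ((1 + \<bar>x $ i\<bar>) ^ (2 * m) * ((u x)\<^sup>2 + (v x)\<^sup>2) * gauss x)"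
        by (simp only: ac_simps)
    qed
    also have "\<dots> = ennreal (3 * (2 ^ (2 * m + 1) * exp (1/2))) * ennreal ((1 + \<bar>x $ i\<bar>) ^ (2 * m) * ((u x)\<^sup>2 + (v x)\<^sup>2) * gauss x)"
      by (rule ennreal_mult') simp
    finally show "ennreal (2 ^ (2 * m + 1) * exp (1/2) * (1 + \<bar>x $ i\<bar>) ^ (2 * m) * ((v x)\<^sup>2 * gauss x)) * 3 \<le> \<dots>" .
  qed
  also have "\<dots> = ennreal (3 * (2 ^ (2 * m + 1) * exp (1/2))) * ?Q"
    by (rule nn_integral_cmult) measurable
  finally have K_le: "(\<integral>\<^sup>+x. \<integral>\<^sup>+t. ennreal (?k x t) * indicator {0..1} t * indicator H x \<partial>lborel \<partial>lborel)
     \<le> ennreal (3 * (2 ^ (2 * m + 1) * exp (1/2))) * ?Q" .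
  have "(\<integral>\<^sup>+x. ennreal ((1 + \<bar>x $ i\<bar>) ^ (2 * m + 2) * (u x)\<^sup>2 * gauss x) * indicator H x \<partial>lborel)
    \<le> (\<integral>\<^sup>+x. ennreal (2 * c) * U (x - ?e 1)
       + ennreal (6 * exp (1 / 2)) * (\<integral>\<^sup>+t. ennreal (?k x t) * indicator {0..1} t * indicator H x \<partial>lborel) \<partial>lborel)"
    by (rule nn_integral_mono_AE[OF pw])
  also have "\<dots> = ennreal (2 * c) * (\<integral>\<^sup>+x. U (x - ?e 1) \<partial>lborel)
     + ennreal (6 * exp (1 / 2)) * (\<integral>\<^sup>+x. \<integral>\<^sup>+t. ennreal (?k x t) * indicator {0..1} t * indicator H x \<partial>lborel \<partial>lborel)"
    by (simp add: nn_integral_add nn_integral_cmult)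
  also have "\<dots> \<le> ennreal (2 * c) * ?Q + ennreal (6 * exp (1 / 2)) * (ennreal (3 * (2 ^ (2 * m + 1) * exp (1/2))) * ?Q)"
    by (intro add_mono mult_left_mono U_le K_le) simp_all
  also have "\<dots> = (ennreal (2 * c) + ennreal (6 * exp (1 / 2)) * ennreal (3 * (2 ^ (2 * m + 1) * exp (1/2)))) * ?Q"
    by (simp only: distrib_right mult.assoc)
  also have "ennreal (2 * c) + ennreal (6 * exp (1 / 2)) * ennreal (3 * (2 ^ (2 * m + 1) * exp (1/2))) = ennreal (moment_const m)"
  proof -
    have "exp (1/2) * exp (1/2) = exp (1::real)" by (simp add: exp_add[symmetric])
    then have "2 * c + (6 * exp (1 / 2)) * (3 * (2 ^ (2 * m + 1) * exp (1/2))) = moment_const m"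
      by (simp add: moment_const_def c_def)
    moreover have "c \<ge> 0" by (simp add: c_def)
    ultimately show ?thesis
      by (subst ennreal_mult[symmetric], simp, simp, subst ennreal_plus[symmetric]) auto
  qed
  finally show ?thesis unfolding H_def .
qed

text \<open>The half-spaces on the two sides of \<open>x $ i = 0\<close> need steps in opposite
  directions, always towards the hyperplane; adding them gives the factor \<open>2\<close>.\<close>

lemma gaussian_moment_step:
  fixes u v :: "real ^ 'n::finite \<Rightarrow> real"
  assumes [measurable]: "u \<in> borel_measurable borel" "v \<in> borel_measurable borel"
    and u: "\<And>R. set_integrable lborel (cball 0 R) u"
    and v: "\<And>R. set_integrable lborel (cball 0 R) v"
    and weak: "\<And>T. (\<And>i. bump_tower (T i)) \<Longrightarrow>
      (LINT x|lborel. u x * prod_jet T ((\<lambda>_. 0)(i := Suc 0)) x) = - (LINT x|lborel. v x * prod_jet T (\<lambda>_. 0) x)"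
  shows "(\<integral>\<^sup>+x. ennreal ((1 + \<bar>x $ i\<bar>) ^ (2 * m + 2) * (u x)\<^sup>2 * gauss x) \<partial>lborel)
    \<le> ennreal (2 * moment_const m) *
       (\<integral>\<^sup>+x. ennreal ((1 + \<bar>x $ i\<bar>) ^ (2 * m) * ((u x)\<^sup>2 + (v x)\<^sup>2) * gauss x) \<partial>lborel)" (is "_ \<le> _ * ?Q")
proof -
  let ?q = "\<lambda>x. ennreal ((1 + \<bar>x $ i\<bar>) ^ (2 * m + 2) * (u x)\<^sup>2 * gauss x)"
  have half: "(\<integral>\<^sup>+x. ?q x * indicator {x. 0 \<le> \<sigma> * x $ i} x \<partial>lborel) \<le> ennreal (moment_const m) * ?Q"
    if \<sigma>: "\<sigma> = 1 \<or> \<sigma> = - 1" for \<sigma> :: real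
  proof (rule gaussian_moment_half[OF _ _ \<sigma>])
    have "AE x in lborel. ennreal \<bar>u x\<bar> \<le> ennreal \<bar>u (x + - \<sigma> *\<^sub>R axis i 1)\<bar>
       + (\<integral>\<^sup>+t. ennreal \<bar>- \<sigma> * v (x + t *\<^sub>R (- \<sigma> *\<^sub>R axis i 1))\<bar> * indicator {0..1} t \<partial>lborel)"
    proof (rule weak_derivative_segment_le)
      show "set_integrable lborel (cball 0 R) (\<lambda>x. - \<sigma> * v x)" for R
        using v[of R] by (intro set_integrable_mult_right) auto
      fix T :: "'n \<Rightarrow> nat \<Rightarrow> real \<Rightarrow> real" assume T: "\<And>i. bump_tower (T i)"
      have "(\<Sum>j\<in>UNIV. (- \<sigma> *\<^sub>R axis i 1) $ j * prod_jet T ((\<lambda>_. 0)(j := Suc 0)) x)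
          = - \<sigma> * prod_jet T ((\<lambda>_. 0)(i := Suc 0)) x" for x
        by (subst sum.remove[of _ i]) (auto simp: axis_def intro!: sum.neutral)
      then show "(LINT x|lborel. u x * (\<Sum>j\<in>UNIV. (- \<sigma> *\<^sub>R axis i 1) $ j * prod_jet T ((\<lambda>_. 0)(j := Suc 0)) x))
        = - (LINT x|lborel. - \<sigma> * v x * prod_jet T (\<lambda>_. 0) x)"
        using weak[OF T] by (simp add: mult.left_commute mult.assoc)
    qed (use u in auto)
    then show "AE x in lborel. ennreal \<bar>u x\<bar> \<le> ennreal \<bar>u (x - \<sigma> *\<^sub>R axis i 1)\<bar>
       + (\<integral>\<^sup>+t. ennreal \<bar>v (x - (t * \<sigma>) *\<^sub>R axis i 1)\<bar> * indicator {0..1} t \<partial>lborel)"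
      using \<sigma> by (auto simp: abs_mult)
  qed measurable
  have "(\<integral>\<^sup>+x. ?q x \<partial>lborel) \<le> (\<integral>\<^sup>+x. ?q x * indicator {x. 0 \<le> 1 * x $ i} x + ?q x * indicator {x. 0 \<le> - 1 * x $ i} x \<partial>lborel)"
    by (intro nn_integral_mono) (auto simp: indicator_def)
  also have "\<dots> = (\<integral>\<^sup>+x. ?q x * indicator {x. 0 \<le> 1 * x $ i} x \<partial>lborel) + (\<integral>\<^sup>+x. ?q x * indicator {x. 0 \<le> - 1 * x $ i} x \<partial>lborel)"
    by (rule nn_integral_add) measurable
  also have "\<dots> \<le> ennreal (moment_const m) * ?Q + ennreal (moment_const m) * ?Q"
    by (intro add_mono half) auto
  also have "\<dots> = ennreal (2 * moment_const m) * ?Q"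
    using moment_const_nonneg[of m] by (simp only: mult_2 ennreal_plus distrib_right)
  finally show ?thesis .
qed

text \<open>In the application \<open>F j\<close> is the \<open>j\<close>-th derivative in direction
  \<open>i\<close>. One step reduces the moment of order \<open>2 * m + 2\<close> of
  \<open>F j\<close> to those of order \<open>2 * m\<close> of \<open>F j\<close> and
  \<open>F (Suc j)\<close>. Both are bounded by the same longer sum; this doubling and the
  \<open>2\<close> of \<open>gaussian_moment_step\<close> make the \<open>4\<close>.\<close>

lemma gaussian_moments:
  fixes F :: "nat \<Rightarrow> real ^ 'n::finite \<Rightarrow> real"
  assumes meas [measurable]: "\<And>j. F j \<in> borel_measurable borel"
    and F: "\<And>j R. j \<le> k \<Longrightarrow> set_integrable lborel (cball 0 R) (F j)"
    and weak: "\<And>T j. (\<And>i. bump_tower (T i)) \<Longrightarrow> j < k \<Longrightarrow>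
      (LINT x|lborel. F j x * prod_jet T ((\<lambda>_. 0)(i := Suc 0)) x)
      = - (LINT x|lborel. F (Suc j) x * prod_jet T (\<lambda>_. 0) x)"
    and "j + m \<le> k"
  shows "(\<integral>\<^sup>+x. ennreal ((1 + \<bar>x $ i\<bar>) ^ (2 * m) * (F j x)\<^sup>2 * gauss x) \<partial>lborel)
    \<le> ennreal (\<Prod>l<m. 4 * moment_const l) * (\<Sum>l\<le>m. \<integral>\<^sup>+x. ennreal ((F (j + l) x)\<^sup>2 * gauss x) \<partial>lborel)"
  using \<open>j + m \<le> k\<close>
proof (induction m arbitrary: j)
  case 0
  then show ?case by simp
next
  case (Suc m)
  let ?I = "\<lambda>l. \<integral>\<^sup>+x. ennreal ((F l x)\<^sup>2 * gauss x) \<partial>lborel"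
  let ?C = "\<Prod>l<m. 4 * moment_const l"
  have C: "?C \<ge> 0" by (intro prod_nonneg) (simp add: moment_const_nonneg)
  have "(\<integral>\<^sup>+x. ennreal ((1 + \<bar>x $ i\<bar>) ^ (2 * m + 2) * (F j x)\<^sup>2 * gauss x) \<partial>lborel)
    \<le> ennreal (2 * moment_const m) *
       (\<integral>\<^sup>+x. ennreal ((1 + \<bar>x $ i\<bar>) ^ (2 * m) * ((F j x)\<^sup>2 + (F (Suc j) x)\<^sup>2) * gauss x) \<partial>lborel)"
    by (rule gaussian_moment_step) (use Suc.prems F weak in auto)
  also have "(\<integral>\<^sup>+x. ennreal ((1 + \<bar>x $ i\<bar>) ^ (2 * m) * ((F j x)\<^sup>2 + (F (Suc j) x)\<^sup>2) * gauss x) \<partial>lborel)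
     = (\<integral>\<^sup>+x. ennreal ((1 + \<bar>x $ i\<bar>) ^ (2 * m) * (F j x)\<^sup>2 * gauss x)
           + ennreal ((1 + \<bar>x $ i\<bar>) ^ (2 * m) * (F (Suc j) x)\<^sup>2 * gauss x) \<partial>lborel)"
  proof (intro nn_integral_cong)
    fix x :: "real ^ 'n"
    have "(1 + \<bar>x $ i\<bar>) ^ (2 * m) * ((F j x)\<^sup>2 + (F (Suc j) x)\<^sup>2) * gauss x
      = (1 + \<bar>x $ i\<bar>) ^ (2 * m) * (F j x)\<^sup>2 * gauss x + (1 + \<bar>x $ i\<bar>) ^ (2 * m) * (F (Suc j) x)\<^sup>2 * gauss x"
      by (simp add: algebra_simps)
    then show "ennreal ((1 + \<bar>x $ i\<bar>) ^ (2 * m) * ((F j x)\<^sup>2 + (F (Suc j) x)\<^sup>2) * gauss x)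
      = ennreal ((1 + \<bar>x $ i\<bar>) ^ (2 * m) * (F j x)\<^sup>2 * gauss x)
        + ennreal ((1 + \<bar>x $ i\<bar>) ^ (2 * m) * (F (Suc j) x)\<^sup>2 * gauss x)"
      using gauss_pos[of x] by (simp only:) (intro ennreal_plus mult_nonneg_nonneg; simp)
  qed
  also have "\<dots> = (\<integral>\<^sup>+x. ennreal ((1 + \<bar>x $ i\<bar>) ^ (2 * m) * (F j x)\<^sup>2 * gauss x) \<partial>lborel)
           + (\<integral>\<^sup>+x. ennreal ((1 + \<bar>x $ i\<bar>) ^ (2 * m) * (F (Suc j) x)\<^sup>2 * gauss x) \<partial>lborel)"
    by (rule nn_integral_add) measurable
  also have "\<dots> \<le> ennreal ?C * (\<Sum>l\<le>m. ?I (j + l)) + ennreal ?C * (\<Sum>l\<le>m. ?I (Suc j + l))"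
    using Suc.prems by (intro add_mono Suc.IH) auto
  also have "\<dots> \<le> ennreal ?C * (\<Sum>l\<le>Suc m. ?I (j + l)) + ennreal ?C * (\<Sum>l\<le>Suc m. ?I (j + l))"
  proof (intro add_mono mult_left_mono)
    show "(\<Sum>l\<le>m. ?I (j + l)) \<le> (\<Sum>l\<le>Suc m. ?I (j + l))" by simp
    have "(\<Sum>l\<le>m. ?I (Suc j + l)) = (\<Sum>l\<in>{Suc 0..Suc m}. ?I (j + l))"
      by (subst sum.shift_bounds_cl_Suc_ivl) (simp add: atLeast0AtMost)
    also have "\<dots> \<le> (\<Sum>l\<le>Suc m. ?I (j + l))" by (intro sum_mono2) auto
    finally show "(\<Sum>l\<le>m. ?I (Suc j + l)) \<le> (\<Sum>l\<le>Suc m. ?I (j + l))" .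
  qed simp_all
  also have "\<dots> = ennreal (2 * ?C) * (\<Sum>l\<le>Suc m. ?I (j + l))"
    using C by (simp only: mult_2 ennreal_plus distrib_right)
  finally have "(\<integral>\<^sup>+x. ennreal ((1 + \<bar>x $ i\<bar>) ^ (2 * m + 2) * (F j x)\<^sup>2 * gauss x) \<partial>lborel)
      \<le> ennreal (2 * moment_const m) * (ennreal (2 * ?C) * (\<Sum>l\<le>Suc m. ?I (j + l)))"
    by (simp add: mult_left_mono)
  also have "\<dots> = ennreal (\<Prod>l<Suc m. 4 * moment_const l) * (\<Sum>l\<le>Suc m. ?I (j + l))"
  proof -
    have "ennreal (2 * moment_const m) * ennreal (2 * ?C) = ennreal ((2 * moment_const m) * (2 * ?C))"
      using C moment_const_nonneg[of m] by (intro ennreal_mult[symmetric]) auto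
    also have "(2 * moment_const m) * (2 * ?C) = (\<Prod>l<Suc m. 4 * moment_const l)" by simp
    finally show ?thesis by (simp only: mult.assoc[symmetric])
  qed
  finally show ?case by simp
qed

section \<open>Superlevel sets\<close>

lemma nn_integral_lborel_reflect:
  fixes f :: "'a::euclidean_space \<Rightarrow> ennreal"
  assumes [measurable]: "f \<in> borel_measurable borel"
  shows "(\<integral>\<^sup>+h. f (x - h) \<partial>lborel) = (\<integral>\<^sup>+h. f h \<partial>lborel)"
proof -
  have "(\<integral>\<^sup>+h. f h \<partial>lborel) = (\<integral>\<^sup>+h. f h \<partial>distr lborel borel (\<lambda>h. x + (- 1) *\<^sub>R h))"
    by (subst lborel_affine[of "- 1" x]) (auto simp: nn_integral_density)
  also have "\<dots> = (\<integral>\<^sup>+h. f (x - h) \<partial>lborel)" by (subst nn_integral_distr) auto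
  finally show ?thesis ..
qed

text \<open>On an orthant, shifting inwards does not decrease the Gaussian by more than a constant factor;
  this is why the cube of shifts depends on the orthant.\<close>

definition orthant :: "'n::finite set \<Rightarrow> (real ^ 'n) set" where
  "orthant S = {x. \<forall>i. if i \<in> S then x $ i \<le> 0 else 0 \<le> x $ i}"

definition orthant_cube :: "'n::finite set \<Rightarrow> real \<Rightarrow> (real ^ 'n) set" where
  "orthant_cube S r = cbox (\<chi> i. if i \<in> S then - r else 0) (\<chi> i. if i \<in> S then 0 else r)"

lemma orthant_measurable [measurable]: "orthant S \<in> sets borel"
  unfolding orthant_def by measurable

lemma orthant_cube_measurable [measurable]: "orthant_cube S r \<in> sets borel"
  unfolding orthant_cube_def by measurable

lemma emeasure_orthant_cube:
  assumes "0 \<le> r"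
  shows "emeasure lborel (orthant_cube (S :: 'n::finite set) r) = ennreal (r ^ CARD('n))"
proof -
  let ?l = "(\<chi> i. if i \<in> S then - r else 0) :: real ^ 'n" and ?u = "(\<chi> i. if i \<in> S then 0 else r) :: real ^ 'n"
  have *: "(?u - ?l) \<bullet> b = r \<and> ?l \<bullet> b \<le> ?u \<bullet> b" if "b \<in> Basis" for b :: "real ^ 'n"
  proof -
    from that obtain i where "b = axis i 1" by (auto simp: Basis_vec_def)
    then show ?thesis using assms by (simp add: inner_axis)
  qed
  then have "emeasure lborel (orthant_cube S r) = ennreal (\<Prod>b\<in>Basis. (?u - ?l) \<bullet> b)"
    unfolding orthant_cube_def by (intro emeasure_lborel_cbox) blast
  also have "(\<Prod>b\<in>Basis. (?u - ?l) \<bullet> b) = (\<Prod>b\<in>(Basis :: (real ^ 'n) set). r)"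
    using * by (intro prod.cong) auto
  finally show ?thesis by simp
qed

lemma orthant_cube_inner:
  "x \<in> orthant S \<Longrightarrow> h \<in> orthant_cube S r \<Longrightarrow> 0 \<le> x \<bullet> h"
  unfolding inner_vec_def orthant_def orthant_cube_def mem_box_cart
  by (intro sum_nonneg) (auto simp: zero_le_mult_iff split: if_splits)

lemma norm_vec_square: "(norm (h :: real ^ 'n::finite))\<^sup>2 = (\<Sum>i\<in>UNIV. (h $ i)\<^sup>2)"
  unfolding power2_norm_eq_inner by (simp add: inner_vec_def power2_eq_square)

lemma orthant_cube_norm:
  fixes h :: "real ^ 'n::finite"
  assumes "h \<in> orthant_cube S r" shows "(norm h)\<^sup>2 \<le> real CARD('n) * r\<^sup>2"
proof -
  have "(h $ i)\<^sup>2 \<le> r\<^sup>2" for i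
  proof -
    have "\<bar>h $ i\<bar> \<le> \<bar>r\<bar>"
      using assms[unfolded orthant_cube_def mem_box_cart, rule_format, of i] by (auto split: if_splits)
    then show ?thesis by (rule abs_le_square_iff[THEN iffD1])
  qed
  then have "(\<Sum>i\<in>UNIV. (h $ i)\<^sup>2) \<le> (\<Sum>i\<in>(UNIV :: 'n set). r\<^sup>2)" by (rule sum_mono)
  then show ?thesis by (simp add: norm_vec_square)
qed

text \<open>In \<open>gauss_shift\<close> the linear term has the favourable sign because
  \<open>x\<close> and \<open>h\<close> lie in the same orthant, and the quadratic term is at most
  half the dimension because \<open>r \<le> 1\<close>.\<close>

lemma gauss_segment_le:
  fixes x h :: "real ^ 'n::finite"
  assumes "x \<in> orthant S" "h \<in> orthant_cube S r" "0 < r" "r \<le> 1" "t \<in> {0..1}"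
  shows "gauss x \<le> exp (real CARD('n) / 2) * gauss (x - t *\<^sub>R h)"
proof -
  have "(norm (t *\<^sub>R h))\<^sup>2 / 2 - x \<bullet> (t *\<^sub>R h) \<le> real CARD('n) / 2"
  proof -
    have "(norm (t *\<^sub>R h))\<^sup>2 = t\<^sup>2 * (norm h)\<^sup>2" by (simp add: power_mult_distrib)
    also have "\<dots> \<le> 1 * (real CARD('n) * r\<^sup>2)"
      using assms orthant_cube_norm[OF assms(2)] by (intro mult_mono) (auto simp: power_le_one)
    also have "\<dots> \<le> real CARD('n)" using assms by (simp add: power_le_one mult_left_le)
    finally have "(norm (t *\<^sub>R h))\<^sup>2 \<le> real CARD('n)" .
    moreover have "0 \<le> x \<bullet> (t *\<^sub>R h)" using orthant_cube_inner[OF assms(1,2)] assms by simp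
    ultimately show ?thesis by linarith
  qed
  then have "exp ((norm (t *\<^sub>R h))\<^sup>2 / 2 - x \<bullet> (t *\<^sub>R h)) \<le> exp (real CARD('n) / 2)" by simp
  then show ?thesis
    using gauss_pos[of "x - t *\<^sub>R h"] by (subst gauss_shift[of x "t *\<^sub>R h"]) (simp add: mult.commute)
qed

text \<open>For a single shift \<open>h\<close>, squaring the segment bound costs \<open>2\<close>
  and moving the Gaussian weight along the segment costs the exponential. Cauchy-Schwarz is used
  over the coordinates, where the size of \<open>h\<close> supplies \<open>r\<^sup>2\<close>, and
  along the segment. The restriction to \<open>E\<close> is kept only in the first term, where the
  size of \<open>E\<close> will matter; in the gradient term translation invariance then removes the
  shift.\<close>

lemma gaussian_tail_shift:
  fixes f :: "real ^ 'n::finite \<Rightarrow> real" and v :: "'n \<Rightarrow> real ^ 'n \<Rightarrow> real"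
  assumes [measurable]: "f \<in> borel_measurable borel" "\<And>i. v i \<in> borel_measurable borel"
    and f: "\<And>R. set_integrable lborel (cball 0 R) f"
    and v: "\<And>i R. set_integrable lborel (cball 0 R) (v i)"
    and weak: "\<And>T i. (\<And>i. bump_tower (T i)) \<Longrightarrow>
      (LINT x|lborel. f x * prod_jet T ((\<lambda>_. 0)(i := Suc 0)) x) = - (LINT x|lborel. v i x * prod_jet T (\<lambda>_. 0) x)"
    and h: "h \<in> orthant_cube S r" and r: "0 < r" "r \<le> 1"
    and [measurable]: "E \<in> sets borel" and E: "E \<subseteq> orthant S"
  shows "(\<integral>\<^sup>+x. ennreal ((f x)\<^sup>2 * gauss x) * indicator E x \<partial>lborel)
    \<le> ennreal (2 * exp (real CARD('n) / 2)) *
       ((\<integral>\<^sup>+x. ennreal ((f (x - h))\<^sup>2 * gauss (x - h)) * indicator E x \<partial>lborel)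
        + ennreal (real CARD('n) * r\<^sup>2) * (\<integral>\<^sup>+x. ennreal ((\<Sum>i\<in>UNIV. (v i x)\<^sup>2) * gauss x) \<partial>lborel))"
proof -
  define w where "w x = (\<Sum>i\<in>UNIV. h $ i * v i x)" for x
  have [measurable]: "w \<in> borel_measurable borel" unfolding w_def by measurable
  define q where "q x = (\<Sum>i\<in>UNIV. (v i x)\<^sup>2) * gauss x" for x
  have [measurable]: "q \<in> borel_measurable borel" unfolding q_def by measurable
  let ?e = "exp (real CARD('n) / 2)"
  let ?d = "real CARD('n) * r\<^sup>2"
  have w2: "(w x)\<^sup>2 * gauss x \<le> ?d * q x" for x
  proof -
    have "(w x)\<^sup>2 \<le> (\<Sum>i\<in>UNIV. (h $ i)\<^sup>2) * (\<Sum>i\<in>UNIV. (v i x)\<^sup>2)"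
      unfolding w_def by (rule Cauchy_Schwarz_ineq_sum)
    also have "(\<Sum>i\<in>UNIV. (h $ i)\<^sup>2) \<le> ?d"
      using orthant_cube_norm[OF h] by (simp add: norm_vec_square)
    finally have "(w x)\<^sup>2 \<le> ?d * (\<Sum>i\<in>UNIV. (v i x)\<^sup>2)" by (simp add: mult_right_mono sum_nonneg)
    then show ?thesis unfolding q_def using gauss_pos[of x] by (simp add: mult_right_mono mult.assoc[symmetric])
  qed
  have "AE x in lborel. ennreal \<bar>f x\<bar> \<le> ennreal \<bar>f (x + - h)\<bar>
       + (\<integral>\<^sup>+t. ennreal \<bar>- w (x + t *\<^sub>R - h)\<bar> * indicator {0..1} t \<partial>lborel)"
  proof (rule weak_derivative_segment_le)
    show "set_integrable lborel (cball 0 R) (\<lambda>x. - w x)" for R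
      unfolding w_def using v
      by (simp add: sum_negf[symmetric] set_integrable_def sum_distrib_left mult.left_commute)
    fix T :: "'n \<Rightarrow> nat \<Rightarrow> real \<Rightarrow> real" assume T: "\<And>i. bump_tower (T i)"
    have "(LINT x|lborel. f x * (\<Sum>i\<in>UNIV. (- h) $ i * prod_jet T ((\<lambda>_. 0)(i := Suc 0)) x))
      = (\<Sum>i\<in>UNIV. - h $ i * (LINT x|lborel. f x * prod_jet T ((\<lambda>_. 0)(i := Suc 0)) x))"
      using integrable_mult_prod_jet[of T f, OF T f]
      by (simp add: sum_distrib_left mult.left_commute[of "f _"])
    also have "\<dots> = (\<Sum>i\<in>UNIV. h $ i * (LINT x|lborel. v i x * prod_jet T (\<lambda>_. 0) x))"
      by (simp add: weak[OF T])
    also have "\<dots> = - (LINT x|lborel. - w x * prod_jet T (\<lambda>_. 0) x)"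
      using integrable_mult_prod_jet[of T "v _", OF T v]
      by (simp add: w_def sum_distrib_right mult.assoc)
    finally show "(LINT x|lborel. f x * (\<Sum>i\<in>UNIV. (- h) $ i * prod_jet T ((\<lambda>_. 0)(i := Suc 0)) x))
      = - (LINT x|lborel. - w x * prod_jet T (\<lambda>_. 0) x)" .
  qed (use f in auto)
  then have pw: "AE x in lborel. ennreal ((f x)\<^sup>2 * gauss x) * indicator E x \<le>
      ennreal (2 * ?e) * (ennreal ((f (x - h))\<^sup>2 * gauss (x - h)) * indicator E x
         + (\<integral>\<^sup>+t. ennreal ?d * (ennreal (q (x - t *\<^sub>R h)) * indicator {0..1} t) \<partial>lborel))"
  proof eventually_elim
    case (elim x)
    show ?case
    proof (cases "x \<in> E")
      case True
      then have x: "x \<in> orthant S" using E by auto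
      define I where "I = (\<integral>\<^sup>+t. ennreal \<bar>w (x - t *\<^sub>R h)\<bar> * indicator {0..1} t \<partial>lborel)"
      have "I = (\<integral>\<^sup>+t. (ennreal \<bar>w (x - t *\<^sub>R h)\<bar> * indicator {0..1} t) * indicator {0..1} t \<partial>lborel)"
        unfolding I_def by (intro nn_integral_cong) (auto simp: indicator_def)
      then have "I\<^sup>2 \<le> (\<integral>\<^sup>+t. (ennreal \<bar>w (x - t *\<^sub>R h)\<bar> * indicator {0..1} t)\<^sup>2 \<partial>lborel) * (\<integral>\<^sup>+t. (indicator {0..1::real} t)\<^sup>2 \<partial>lborel)"
        by (simp only:) (rule Cauchy_Schwarz_nn_integral; measurable)
      also have "(\<integral>\<^sup>+t. (indicator {0..1::real} t :: ennreal)\<^sup>2 \<partial>lborel) = (\<integral>\<^sup>+t. indicator {0..1::real} t \<partial>lborel)"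
        by (intro nn_integral_cong) (auto simp: indicator_def)
      also have "\<dots> = 1" by simp
      also have "(\<integral>\<^sup>+t. (ennreal \<bar>w (x - t *\<^sub>R h)\<bar> * indicator {0..1} t)\<^sup>2 \<partial>lborel) = (\<integral>\<^sup>+t. ennreal ((w (x - t *\<^sub>R h))\<^sup>2) * indicator {0..1} t \<partial>lborel)"
        by (intro nn_integral_cong) (auto simp: indicator_def ennreal_power)
      finally have "ennreal (gauss x) * I\<^sup>2 \<le> ennreal (gauss x) * (\<integral>\<^sup>+t. ennreal ((w (x - t *\<^sub>R h))\<^sup>2) * indicator {0..1} t \<partial>lborel)"
        by (simp add: mult_left_mono)
      also have "\<dots> = (\<integral>\<^sup>+t. ennreal (gauss x) * (ennreal ((w (x - t *\<^sub>R h))\<^sup>2) * indicator {0..1} t) \<partial>lborel)"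
        by (rule nn_integral_cmult[symmetric]) measurable
      also have "\<dots> \<le> (\<integral>\<^sup>+t. ennreal ?e * (ennreal ?d * (ennreal (q (x - t *\<^sub>R h)) * indicator {0..1} t)) \<partial>lborel)"
      proof (rule nn_integral_mono, cases)
        fix t :: real assume t: "t \<in> {0..1}"
        have q0: "q (x - t *\<^sub>R h) \<ge> 0" unfolding q_def
          by (intro mult_nonneg_nonneg sum_nonneg less_imp_le[OF gauss_pos]) simp
        have "gauss x * (w (x - t *\<^sub>R h))\<^sup>2 \<le> ?e * gauss (x - t *\<^sub>R h) * (w (x - t *\<^sub>R h))\<^sup>2"
          by (intro mult_right_mono gauss_segment_le[OF x h r t]) auto
        also have "\<dots> \<le> ?e * (?d * q (x - t *\<^sub>R h))"
          using w2[of "x - t *\<^sub>R h"] by (simp add: mult.assoc mult.commute)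
        finally have "ennreal (gauss x * (w (x - t *\<^sub>R h))\<^sup>2) \<le> ennreal (?e * (?d * q (x - t *\<^sub>R h)))"
          by (rule ennreal_leI)
        then show "ennreal (gauss x) * (ennreal ((w (x - t *\<^sub>R h))\<^sup>2) * indicator {0..1} t)
          \<le> ennreal ?e * (ennreal ?d * (ennreal (q (x - t *\<^sub>R h)) * indicator {0..1} t))"
          using t q0 gauss_pos[of x] by (simp add: ennreal_mult)
      qed simp
      also have "\<dots> = ennreal ?e * (\<integral>\<^sup>+t. ennreal ?d * (ennreal (q (x - t *\<^sub>R h)) * indicator {0..1} t) \<partial>lborel)"
        by (rule nn_integral_cmult) measurable
      finally have 2: "ennreal (gauss x) * I\<^sup>2 \<le> ennreal ?e * (\<integral>\<^sup>+t. ennreal ?d * (ennreal (q (x - t *\<^sub>R h)) * indicator {0..1} t) \<partial>lborel)" .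
      have "gauss x * (f (x - h))\<^sup>2 \<le> ?e * gauss (x - h) * (f (x - h))\<^sup>2"
        using gauss_segment_le[OF x h r, of 1] by (intro mult_right_mono) auto
      then have "ennreal (gauss x * (f (x - h))\<^sup>2) \<le> ennreal (?e * ((f (x - h))\<^sup>2 * gauss (x - h)))"
        by (intro ennreal_leI) (simp add: ac_simps)
      then have 1: "ennreal (gauss x) * (ennreal \<bar>f (x - h)\<bar>)\<^sup>2 \<le> ennreal ?e * ennreal ((f (x - h))\<^sup>2 * gauss (x - h))"
        using gauss_pos[of x] gauss_pos[of "x - h"] by (simp add: ennreal_power ennreal_mult)
      have "ennreal ((f x)\<^sup>2) = (ennreal \<bar>f x\<bar>)\<^sup>2" by (simp add: ennreal_power)
      also have "\<dots> \<le> (ennreal \<bar>f (x - h)\<bar> + I)\<^sup>2" using elim by (intro power_mono) (auto simp: I_def)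
      also have "\<dots> \<le> 2 * (ennreal \<bar>f (x - h)\<bar>)\<^sup>2 + 2 * I\<^sup>2" by (rule ennreal_square_add_le)
      finally have "ennreal (gauss x) * ennreal ((f x)\<^sup>2) \<le> ennreal (gauss x) * (2 * (ennreal \<bar>f (x - h)\<bar>)\<^sup>2 + 2 * I\<^sup>2)"
        by (rule mult_left_mono) simp
      also have "\<dots> = 2 * (ennreal (gauss x) * (ennreal \<bar>f (x - h)\<bar>)\<^sup>2) + 2 * (ennreal (gauss x) * I\<^sup>2)"
        by (simp only: distrib_left mult.left_commute)
      also have "\<dots> \<le> 2 * (ennreal ?e * ennreal ((f (x - h))\<^sup>2 * gauss (x - h)))
          + 2 * (ennreal ?e * (\<integral>\<^sup>+t. ennreal ?d * (ennreal (q (x - t *\<^sub>R h)) * indicator {0..1} t) \<partial>lborel))"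
        by (intro add_mono mult_left_mono 1 2) simp_all
      also have "\<dots> = 2 * ennreal ?e * (ennreal ((f (x - h))\<^sup>2 * gauss (x - h))
         + (\<integral>\<^sup>+t. ennreal ?d * (ennreal (q (x - t *\<^sub>R h)) * indicator {0..1} t) \<partial>lborel))"
        by (simp only: distrib_left mult.assoc)
      also have "2 * ennreal ?e = ennreal (2 * ?e)" by (simp add: ennreal_mult')
      finally show ?thesis using True gauss_pos[of x] by (simp add: ennreal_mult mult.commute)
    qed simp
  qed
  have "(\<integral>\<^sup>+x. \<integral>\<^sup>+t. ennreal ?d * (ennreal (q (x - t *\<^sub>R h)) * indicator {0..1} t) \<partial>lborel \<partial>lborel)
     = (\<integral>\<^sup>+t. \<integral>\<^sup>+x. ennreal ?d * (ennreal (q (x - t *\<^sub>R h)) * indicator {0..1} t) \<partial>lborel \<partial>lborel)"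
    by (rule lborel_pair.Fubini') measurable
  also have "\<dots> = (\<integral>\<^sup>+t. ennreal ?d * ((\<integral>\<^sup>+x. ennreal (q x) \<partial>lborel) * indicator {0..1::real} t) \<partial>lborel)"
  proof (rule nn_integral_cong)
    fix t :: real
    show "(\<integral>\<^sup>+x. ennreal ?d * (ennreal (q (x - t *\<^sub>R h)) * indicator {0..1} t) \<partial>lborel)
      = ennreal ?d * ((\<integral>\<^sup>+x. ennreal (q x) \<partial>lborel) * indicator {0..1} t)"
      using nn_integral_lborel_translate[of "\<lambda>x. ennreal (q x)" "- (t *\<^sub>R h)"]
      by (simp add: nn_integral_cmult nn_integral_multc)
  qed
  also have "\<dots> = ennreal ?d * (\<integral>\<^sup>+x. ennreal (q x) \<partial>lborel)"
    by (simp add: nn_integral_cmult)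
  finally have Q: "(\<integral>\<^sup>+x. \<integral>\<^sup>+t. ennreal ?d * (ennreal (q (x - t *\<^sub>R h)) * indicator {0..1} t) \<partial>lborel \<partial>lborel)
     = ennreal ?d * (\<integral>\<^sup>+x. ennreal (q x) \<partial>lborel)" .
  have "(\<integral>\<^sup>+x. ennreal ((f x)\<^sup>2 * gauss x) * indicator E x \<partial>lborel) \<le>
     (\<integral>\<^sup>+x. ennreal (2 * ?e) * (ennreal ((f (x - h))\<^sup>2 * gauss (x - h)) * indicator E x
         + (\<integral>\<^sup>+t. ennreal ?d * (ennreal (q (x - t *\<^sub>R h)) * indicator {0..1} t) \<partial>lborel)) \<partial>lborel)"
    by (rule nn_integral_mono_AE[OF pw])
  also have "\<dots> = ennreal (2 * ?e) * ((\<integral>\<^sup>+x. ennreal ((f (x - h))\<^sup>2 * gauss (x - h)) * indicator E x \<partial>lborel)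
     + (\<integral>\<^sup>+x. \<integral>\<^sup>+t. ennreal ?d * (ennreal (q (x - t *\<^sub>R h)) * indicator {0..1} t) \<partial>lborel \<partial>lborel))"
    by (subst nn_integral_cmult, measurable) (subst nn_integral_add; measurable)
  finally show ?thesis unfolding Q by (simp only: q_def)
qed


text \<open>Averaging over the cube of shifts turns the first term of the previous lemma into
  \<open>|E| \<parallel>f\<parallel>\<^sup>2\<close>; on a superlevel set \<open>E\<close> this is absorbed by the left-hand side.\<close>

lemma gaussian_tail_orthant:
  fixes f :: "real ^ 'n::finite \<Rightarrow> real" and v :: "'n \<Rightarrow> real ^ 'n \<Rightarrow> real"
  assumes [measurable]: "f \<in> borel_measurable borel" "\<And>i. v i \<in> borel_measurable borel"
    and f: "\<And>R. set_integrable lborel (cball 0 R) f"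
    and v: "\<And>i R. set_integrable lborel (cball 0 R) (v i)"
    and weak: "\<And>T i. (\<And>i. bump_tower (T i)) \<Longrightarrow>
      (LINT x|lborel. f x * prod_jet T ((\<lambda>_. 0)(i := Suc 0)) x) = - (LINT x|lborel. v i x * prod_jet T (\<lambda>_. 0) x)"
    and M: "(\<integral>\<^sup>+x. ennreal ((f x)\<^sup>2 * gauss x) \<partial>lborel) \<le> ennreal M" "0 < M"
    and r: "0 < r" "r \<le> 1" and L: "4 * exp (real CARD('n) / 2) * M \<le> L * r ^ CARD('n)" "0 < L"
  shows "(\<integral>\<^sup>+x. ennreal ((f x)\<^sup>2 * gauss x) * indicator {x \<in> orthant S. L \<le> (f x)\<^sup>2 * gauss x} x \<partial>lborel)
    \<le> ennreal (4 * exp (real CARD('n) / 2) * real CARD('n) * r\<^sup>2)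
       * (\<integral>\<^sup>+x. ennreal ((\<Sum>i\<in>UNIV. (v i x)\<^sup>2) * gauss x) \<partial>lborel)"
proof -
  define U where "U x = ennreal ((f x)\<^sup>2 * gauss x)" for x
  have [measurable]: "U \<in> borel_measurable borel" unfolding U_def by measurable
  define E where "E = {x \<in> orthant S. L \<le> (f x)\<^sup>2 * gauss x}"
  have [measurable]: "E \<in> sets borel" unfolding E_def by measurable
  define H where "H = orthant_cube S r"
  have [measurable]: "H \<in> sets borel" unfolding H_def by measurable
  define Q where "Q = (\<integral>\<^sup>+x. ennreal ((\<Sum>i\<in>UNIV. (v i x)\<^sup>2) * gauss x) \<partial>lborel)"
  define I where "I = (\<integral>\<^sup>+x. U x * indicator E x \<partial>lborel)"
  let ?e = "exp (real CARD('n) / 2)"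
  let ?d = "real CARD('n) * r\<^sup>2"
  let ?rn = "r ^ CARD('n)"
  have Hm: "emeasure lborel H = ennreal ?rn"
    unfolding H_def using r by (intro emeasure_orthant_cube) simp
  have "I * ennreal ?rn = (\<integral>\<^sup>+h. I * indicator H h \<partial>lborel)"
    by (simp add: nn_integral_cmult Hm)
  also have "\<dots> \<le> (\<integral>\<^sup>+h. ennreal (2 * ?e) * ((\<integral>\<^sup>+x. U (x - h) * indicator E x \<partial>lborel) * indicator H h
        + (ennreal ?d * Q) * indicator H h) \<partial>lborel)"
  proof (rule nn_integral_mono, cases)
    fix h :: "real ^ 'n" assume h: "h \<in> H"
    have "I \<le> ennreal (2 * ?e) * ((\<integral>\<^sup>+x. U (x - h) * indicator E x \<partial>lborel) + ennreal ?d * Q)"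
      unfolding I_def U_def Q_def
      by (rule gaussian_tail_shift) (use f v weak h r in \<open>auto simp: H_def E_def\<close>)
    then show "I * indicator H h \<le> ennreal (2 * ?e) * ((\<integral>\<^sup>+x. U (x - h) * indicator E x \<partial>lborel) * indicator H h
        + (ennreal ?d * Q) * indicator H h)" using h by simp
  qed simp
  also have "\<dots> = ennreal (2 * ?e) * ((\<integral>\<^sup>+h. (\<integral>\<^sup>+x. U (x - h) * indicator E x \<partial>lborel) * indicator H h \<partial>lborel)
     + ennreal ?d * Q * ennreal ?rn)"
    by (subst nn_integral_cmult, measurable) (subst nn_integral_add, measurable, simp add: nn_integral_cmult Hm)
  \<comment> \<open>The cube may be enlarged to the whole space here: after Fubini the integral over
    \<open>h\<close> is the total mass of \<open>U\<close> for each \<open>x\<close>, which leaves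
    only the measure of \<open>E\<close>.\<close>
  also have "(\<integral>\<^sup>+h. (\<integral>\<^sup>+x. U (x - h) * indicator E x \<partial>lborel) * indicator H h \<partial>lborel)
     \<le> (\<integral>\<^sup>+h. (\<integral>\<^sup>+x. U (x - h) * indicator E x \<partial>lborel) \<partial>lborel)"
    by (intro nn_integral_mono) (auto simp: indicator_def)
  also have "\<dots> = (\<integral>\<^sup>+x. (\<integral>\<^sup>+h. U (x - h) * indicator E x \<partial>lborel) \<partial>lborel)"
    by (rule lborel_pair.Fubini') measurable
  also have "\<dots> = (\<integral>\<^sup>+x. (\<integral>\<^sup>+h. U h \<partial>lborel) * indicator E x \<partial>lborel)"
    using nn_integral_lborel_reflect[of U] by (intro nn_integral_cong) (simp add: nn_integral_multc)
  also have "\<dots> = (\<integral>\<^sup>+h. U h \<partial>lborel) * emeasure lborel E"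
    by (simp add: nn_integral_cmult)
  also have "\<dots> \<le> ennreal M * emeasure lborel E"
    using M by (intro mult_right_mono) (auto simp: U_def)
  finally have main: "I * ennreal ?rn \<le> ennreal (2 * ?e) * (ennreal M * emeasure lborel E + ennreal ?d * Q * ennreal ?rn)"
    by (simp add: mult_left_mono add_right_mono)
  have "ennreal L * emeasure lborel E = (\<integral>\<^sup>+x. ennreal L * indicator E x \<partial>lborel)"
    by (simp add: nn_integral_cmult)
  also have "\<dots> \<le> I"
    unfolding I_def U_def by (intro nn_integral_mono) (auto simp: E_def indicator_def intro!: ennreal_leI)
  finally have LE: "ennreal L * emeasure lborel E \<le> I" .
  \<comment> \<open>Finiteness of \<open>I\<close>, and then of the measure of \<open>E\<close>, is
    what permits the subtraction below.\<close>
  have "I \<le> (\<integral>\<^sup>+x. U x \<partial>lborel)" unfolding I_def by (intro nn_integral_mono) (auto simp: indicator_def)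
  also have "\<dots> \<le> ennreal M" using M by (simp add: U_def)
  finally have "I < \<infinity>" by (rule le_less_trans) simp
  then obtain j where j: "I = ennreal j" "0 \<le> j" by (cases I) auto
  have "I \<le> ennreal (4 * ?e * real CARD('n) * r\<^sup>2) * Q"
  proof (cases Q)
    case (real q)
    have "emeasure lborel E \<noteq> \<infinity>"
    proof
      assume "emeasure lborel E = \<infinity>"
      then show False using LE L j by (simp add: ennreal_mult_top top_unique)
    qed
    then obtain m where m: "emeasure lborel E = ennreal m" "0 \<le> m" by (cases "emeasure lborel E") auto
    have Lm: "L * m \<le> j" using LE L j m by (simp add: ennreal_mult[symmetric])
    have "ennreal (j * ?rn) \<le> ennreal (2 * ?e * (M * m + ?d * q * ?rn))"
      using main r M unfolding j m real by (simp add: ennreal_mult[symmetric] ennreal_plus[symmetric] j m real del: ennreal_plus)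
    then have "j * ?rn \<le> 2 * ?e * (M * m + ?d * q * ?rn)"
      using r M j m real by (subst (asm) ennreal_le_iff) auto
    also have "\<dots> = (4 * ?e * M) * m / 2 + 2 * ?e * ?d * q * ?rn" by (simp add: algebra_simps)
    \<comment> \<open>Here the lower bound on \<open>L\<close> enters. Together with the Chebyshev
      bound \<open>Lm\<close> it makes the averaged term at most half of the left side.\<close>
    also have "\<dots> \<le> (L * ?rn) * m / 2 + 2 * ?e * ?d * q * ?rn"
      using L m by (intro add_right_mono divide_right_mono mult_right_mono) auto
    also have "(L * ?rn) * m / 2 \<le> ?rn * j / 2"
      using mult_left_mono[OF Lm, of ?rn] r by (simp add: ac_simps)
    finally have "?rn * j \<le> ?rn * (4 * ?e * ?d * q)" by (simp add: algebra_simps)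
    then have "j \<le> 4 * ?e * ?d * q" using r by (simp add: mult_le_cancel_left)
    then have "ennreal j \<le> ennreal (4 * ?e * real CARD('n) * r\<^sup>2 * q)" by (intro ennreal_leI) (simp add: ac_simps)
    then show ?thesis using j real by (simp add: ennreal_mult)
  next
    case top
    then show ?thesis using r by (simp add: ennreal_mult_top)
  qed
  then show ?thesis by (simp only: I_def U_def E_def Q_def)
qed

text \<open>The orthants cover the space, and \<open>CARD('n set)\<close> counts them. Their
  overlaps on coordinate hyperplanes only enlarge the sum.\<close>

lemma gaussian_tail:
  fixes f :: "real ^ 'n::finite \<Rightarrow> real" and v :: "'n \<Rightarrow> real ^ 'n \<Rightarrow> real"
  assumes [measurable]: "f \<in> borel_measurable borel" "\<And>i. v i \<in> borel_measurable borel"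
    and f: "\<And>R. set_integrable lborel (cball 0 R) f"
    and v: "\<And>i R. set_integrable lborel (cball 0 R) (v i)"
    and weak: "\<And>T i. (\<And>i. bump_tower (T i)) \<Longrightarrow>
      (LINT x|lborel. f x * prod_jet T ((\<lambda>_. 0)(i := Suc 0)) x) = - (LINT x|lborel. v i x * prod_jet T (\<lambda>_. 0) x)"
    and M: "(\<integral>\<^sup>+x. ennreal ((f x)\<^sup>2 * gauss x) \<partial>lborel) \<le> ennreal M" "0 < M"
    and r: "0 < r" "r \<le> 1" and L: "4 * exp (real CARD('n) / 2) * M \<le> L * r ^ CARD('n)" "0 < L"
  shows "(\<integral>\<^sup>+x. ennreal ((f x)\<^sup>2 * gauss x) * indicator {x. L \<le> (f x)\<^sup>2 * gauss x} x \<partial>lborel)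
    \<le> ennreal (real CARD('n set) * (4 * exp (real CARD('n) / 2) * real CARD('n)) * r\<^sup>2)
       * (\<integral>\<^sup>+x. ennreal ((\<Sum>i\<in>UNIV. (v i x)\<^sup>2) * gauss x) \<partial>lborel)" (is "_ \<le> _ * ?Q")
proof -
  let ?U = "\<lambda>x. ennreal ((f x)\<^sup>2 * gauss x)"
  have "(\<integral>\<^sup>+x. ?U x * indicator {x. L \<le> (f x)\<^sup>2 * gauss x} x \<partial>lborel)
     \<le> (\<integral>\<^sup>+x. (\<Sum>S\<in>UNIV. ?U x * indicator {x \<in> orthant S. L \<le> (f x)\<^sup>2 * gauss x} x) \<partial>lborel)"
  proof (rule nn_integral_mono)
    fix x :: "real ^ 'n"
    define S\<^sub>0 where "S\<^sub>0 = {i. x $ i < 0}"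
    have "x \<in> orthant S\<^sub>0" by (auto simp: orthant_def S\<^sub>0_def)
    then have "?U x * indicator {x. L \<le> (f x)\<^sup>2 * gauss x} x
      = ?U x * indicator {x \<in> orthant S\<^sub>0. L \<le> (f x)\<^sup>2 * gauss x} x" by (simp add: indicator_def)
    also have "\<dots> \<le> (\<Sum>S\<in>UNIV. ?U x * indicator {x \<in> orthant S. L \<le> (f x)\<^sup>2 * gauss x} x)"
      by (rule member_le_sum) auto
    finally show "?U x * indicator {x. L \<le> (f x)\<^sup>2 * gauss x} x \<le> \<dots>" .
  qed
  also have "\<dots> = (\<Sum>S\<in>UNIV. \<integral>\<^sup>+x. ?U x * indicator {x \<in> orthant S. L \<le> (f x)\<^sup>2 * gauss x} x \<partial>lborel)"
    by (rule nn_integral_sum) measurable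
  also have "\<dots> \<le> (\<Sum>S\<in>(UNIV :: 'n set set). ennreal (4 * exp (real CARD('n) / 2) * real CARD('n) * r\<^sup>2) * ?Q)"
    by (intro sum_mono gaussian_tail_orthant) (use assms in auto)
  also have "\<dots> = ennreal (real CARD('n set) * (4 * exp (real CARD('n) / 2) * real CARD('n)) * r\<^sup>2) * ?Q"
    by (simp add: ennreal_mult ennreal_of_nat_eq_real_of_nat mult.assoc)
  finally show ?thesis .
qed

section \<open>Logarithmic integrals\<close>

text \<open>\<open>B\<close> pays for the logarithm on the dyadic layers, where it is at most linear
  in the layer index. A bound by \<open>2 ^ j\<close> is enough because the tail estimate gains
  \<open>4 ^ (- j)\<close>. The rate \<epsilon> is chosen so that the exponential produces exactly
  \<open>2 ^ Suc j\<close>.\<close>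

lemma power_linear_le_power2:
  assumes "0 \<le> a" "0 < d"
  shows "\<exists>B>0. \<forall>j::nat. (a + real d * real (Suc j)) ^ k \<le> B * 2 ^ j"
proof -
  define \<epsilon> where "\<epsilon> = ln 2 / real d"
  have \<epsilon>: "\<epsilon> > 0" using assms by (simp add: \<epsilon>_def)
  define B where "B = (1 / \<epsilon>) ^ k * fact k * exp (a * \<epsilon>) * 2"
  have "(a + real d * real (Suc j)) ^ k \<le> B * 2 ^ j" for j
  proof -
    let ?y = "\<epsilon> * (a + real d * real (Suc j))"
    have "(a + real d * real (Suc j)) ^ k = (1 / \<epsilon>) ^ k * ?y ^ k"
      using \<epsilon> by (simp add: power_mult_distrib[symmetric] del: of_nat_Suc)
    also have "\<dots> \<le> (1 / \<epsilon>) ^ k * (fact k * exp ?y)"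
      using \<epsilon> assms by (intro mult_left_mono power_le_fact_exp) auto
    also have "?y = a * \<epsilon> + real (Suc j) * ln 2" using assms by (simp add: \<epsilon>_def field_simps)
    also have "exp \<dots> = exp (a * \<epsilon>) * 2 ^ Suc j"
      by (simp only: exp_add exp_of_nat_mult) simp
    finally show ?thesis by (simp add: B_def ac_simps)
  qed
  moreover have "B > 0" using \<epsilon> by (simp add: B_def)
  ultimately show ?thesis by (intro exI[of _ B] conjI allI)
qed

text \<open>Take the first \<open>n\<close> with \<open>q < L * 2 ^ (n * d)\<close>; then
  \<open>ln q\<close> is at most \<open>max 0 (ln L) + n * d\<close>. If \<open>n = Suc j\<close>,
  the \<open>j\<close>-th term of the series is switched on and dominates by the choice of
  \<open>B\<close>; if \<open>n = 0\<close>, the term \<open>B * q\<close> does. The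
  \<open>max 0\<close> keeps the base nonnegative when \<open>L < 1\<close>.\<close>

lemma log_power_dyadic:
  fixes q L B :: real
  assumes B: "\<And>j. (max 0 (ln L) + real d * real (Suc j)) ^ k \<le> B * 2 ^ j"
    and "1 \<le> q" "0 < L" "0 < d"
  shows "ennreal (q * ln q ^ k) \<le> ennreal (B * q)
     + (\<Sum>j. ennreal (B * 2 ^ j) * (ennreal q * indicator {L * 2 ^ (j * d)..} q))"
proof -
  have "0 \<le> (max 0 (ln L) + real d * real (Suc 0)) ^ k"
    by (intro zero_le_power add_nonneg_nonneg) auto
  also have "\<dots> \<le> B * 2 ^ 0" by (rule B)
  finally have "B \<ge> 0" by simp
  have "\<exists>n. q < L * 2 ^ (n * d)"
  proof -
    obtain n where "q / L < 2 ^ n" using real_arch_pow[of 2 "q / L"] by auto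
    also have "\<dots> \<le> (2 :: real) ^ (n * d)" using \<open>0 < d\<close> by (intro power_increasing) auto
    finally show ?thesis using \<open>0 < L\<close> by (auto simp: field_simps)
  qed
  define n where "n = (LEAST n. q < L * 2 ^ (n * d))"
  have n: "q < L * 2 ^ (n * d)" "\<And>m. m < n \<Longrightarrow> \<not> q < L * 2 ^ (m * d)"
    using LeastI_ex[OF \<open>\<exists>n. q < L * 2 ^ (n * d)\<close>] not_less_Least unfolding n_def by auto
  \<comment> \<open>The condition \<open>n \<le> Suc j\<close> lets \<open>j = 0\<close> serve
    \<open>n = 0\<close> as well as \<open>n = 1\<close>.\<close>
  have bound: "q * ln q ^ k \<le> (B * 2 ^ j) * q" if "n \<le> Suc j" for j
  proof -
    have "ln q \<le> ln (L * 2 ^ (Suc j * d))"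
    proof -
      have "L * 2 ^ (n * d) \<le> L * 2 ^ (Suc j * d)" using that \<open>0 < L\<close> by (intro mult_left_mono power_increasing mult_right_mono) auto
      then show ?thesis using n \<open>1 \<le> q\<close> by (intro ln_mono) auto
    qed
    also have "\<dots> = ln L + real (Suc j * d) * ln 2" using \<open>0 < L\<close> by (simp add: ln_mult ln_realpow del: mult_Suc power_Suc)
    also have "\<dots> \<le> max 0 (ln L) + real (Suc j * d) * 1" using ln2_le_25_over_36 by (intro add_mono mult_left_mono) auto
    finally have "ln q ^ k \<le> (max 0 (ln L) + real d * real (Suc j)) ^ k"
      using \<open>1 \<le> q\<close> by (intro power_mono) (auto simp: algebra_simps)
    also have "\<dots> \<le> B * 2 ^ j" by (rule B)
    finally show ?thesis using \<open>1 \<le> q\<close> by (simp add: mult.commute mult_right_mono)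
  qed
  show ?thesis
  proof (cases n)
    case 0
    then have "ennreal (q * ln q ^ k) \<le> ennreal (B * q)" using bound[of 0] by (intro ennreal_leI) simp
    then show ?thesis by (simp add: add_increasing2)
  next
    case (Suc j)
    let ?t = "\<lambda>j. ennreal (B * 2 ^ j) * (ennreal q * indicator {L * 2 ^ (j * d)..} q)"
    have "ennreal (q * ln q ^ k) \<le> ennreal ((B * 2 ^ j) * q)" using bound[of j] Suc by (intro ennreal_leI) simp
    also have "\<dots> = ?t j" using n(2)[of j] Suc \<open>B \<ge> 0\<close> \<open>1 \<le> q\<close> by (simp add: ennreal_mult not_less)
    also have "\<dots> \<le> (\<Sum>j. ?t j)" using sum_le_suminf[of ?t "{j}"] by simp
    finally show ?thesis by (simp add: add_increasing)
  qed
qed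

text \<open>Layer \<open>j\<close> is estimated at scale \<open>(1 / 2) ^ j\<close>. Its weight
  \<open>B * 2 ^ j\<close> against the gain \<open>4 ^ (- j)\<close> leaves a geometric series with
  sum \<open>2\<close>.\<close>

lemma gaussian_log_tail:
  fixes f :: "real ^ 'n::finite \<Rightarrow> real" and v :: "'n \<Rightarrow> real ^ 'n \<Rightarrow> real"
  assumes [measurable]: "f \<in> borel_measurable borel" "\<And>i. v i \<in> borel_measurable borel"
    and f: "\<And>R. set_integrable lborel (cball 0 R) f"
    and v: "\<And>i R. set_integrable lborel (cball 0 R) (v i)"
    and weak: "\<And>T i. (\<And>i. bump_tower (T i)) \<Longrightarrow>
      (LINT x|lborel. f x * prod_jet T ((\<lambda>_. 0)(i := Suc 0)) x) = - (LINT x|lborel. v i x * prod_jet T (\<lambda>_. 0) x)"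
    and M: "(\<integral>\<^sup>+x. ennreal ((f x)\<^sup>2 * gauss x) \<partial>lborel) \<le> ennreal M" "0 < M"
    and L: "L = 4 * exp (real CARD('n) / 2) * M"
    and B: "0 < B" "\<And>j. (max 0 (ln L) + real CARD('n) * real (Suc j)) ^ k \<le> B * 2 ^ j"
  shows "(\<integral>\<^sup>+x. ennreal ((f x)\<^sup>2 * gauss x * ln ((f x)\<^sup>2 * gauss x) ^ k) * indicator {x. 1 \<le> (f x)\<^sup>2 * gauss x} x \<partial>lborel)
    \<le> ennreal (B * M) + ennreal (2 * B * (real CARD('n set) * (4 * exp (real CARD('n) / 2) * real CARD('n))))
       * (\<integral>\<^sup>+x. ennreal ((\<Sum>i\<in>UNIV. (v i x)\<^sup>2) * gauss x) \<partial>lborel)" (is "_ \<le> _ + ennreal (2 * B * ?c) * ?Q")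
proof -
  let ?q = "\<lambda>x. (f x)\<^sup>2 * gauss x"
  have "0 < L" using M L by simp
  have q0: "?q x \<ge> 0" for x using gauss_pos[of x] by simp
  have "(\<integral>\<^sup>+x. ennreal (?q x * ln (?q x) ^ k) * indicator {x. 1 \<le> ?q x} x \<partial>lborel)
    \<le> (\<integral>\<^sup>+x. ennreal B * ennreal (?q x)
         + (\<Sum>j. ennreal (B * 2 ^ j) * (ennreal (?q x) * indicator {x. L * 2 ^ (j * CARD('n)) \<le> ?q x} x)) \<partial>lborel)"
  proof (rule nn_integral_mono)
    fix x :: "real ^ 'n"
    have ind: "indicator {L * 2 ^ (j * CARD('n))..} (?q x) = (indicator {x. L * 2 ^ (j * CARD('n)) \<le> ?q x} x :: ennreal)" for j
      by (simp add: indicator_def)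
    show "ennreal (?q x * ln (?q x) ^ k) * indicator {x. 1 \<le> ?q x} x \<le> ennreal B * ennreal (?q x)
         + (\<Sum>j. ennreal (B * 2 ^ j) * (ennreal (?q x) * indicator {x. L * 2 ^ (j * CARD('n)) \<le> ?q x} x))"
    proof (cases "1 \<le> ?q x")
      case True
      have "ennreal (B * ?q x) = ennreal B * ennreal (?q x)" using B(1) q0[of x] by (simp add: ennreal_mult)
      then show ?thesis
        using log_power_dyadic[OF B(2), of "?q x"] True \<open>0 < L\<close> unfolding ind by simp
    qed simp
  qed
  also have "\<dots> = ennreal B * (\<integral>\<^sup>+x. ennreal (?q x) \<partial>lborel)
      + (\<Sum>j. ennreal (B * 2 ^ j) * (\<integral>\<^sup>+x. ennreal (?q x) * indicator {x. L * 2 ^ (j * CARD('n)) \<le> ?q x} x \<partial>lborel))"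
    by (subst nn_integral_add, measurable) (subst nn_integral_suminf, measurable, simp add: nn_integral_cmult)
  also have "\<dots> \<le> ennreal B * ennreal M + (\<Sum>j. ennreal (B * ?c * (1 / 2) ^ j) * ?Q)"
  proof (intro add_mono mult_left_mono M suminf_le summableI)
    fix j :: nat
    have "ennreal (B * 2 ^ j) * (\<integral>\<^sup>+x. ennreal (?q x) * indicator {x. L * 2 ^ (j * CARD('n)) \<le> ?q x} x \<partial>lborel)
       \<le> ennreal (B * 2 ^ j) * (ennreal (?c * ((1 / 2) ^ j)\<^sup>2) * ?Q)"
    proof (intro mult_left_mono gaussian_tail)
      \<comment> \<open>The cube volume cancels the growth of the level, so the condition at every
        layer is the equation defining \<open>L\<close>.\<close>
      show "4 * exp (real CARD('n) / 2) * M \<le> L * 2 ^ (j * CARD('n)) * ((1 / 2) ^ j) ^ CARD('n)"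
        by (simp add: L power_mult[symmetric] power_one_over)
    qed (use f v weak M \<open>0 < L\<close> in \<open>auto simp: power_le_one\<close>)
    also have "\<dots> = ennreal ((B * 2 ^ j) * (?c * ((1 / 2) ^ j)\<^sup>2)) * ?Q"
      using B by (subst ennreal_mult) (auto simp: mult.assoc)
    also have "(B * 2 ^ j) * (?c * ((1 / 2) ^ j)\<^sup>2) = B * ?c * (1 / 2) ^ j * (2 ^ j * (1 / 2) ^ j)"
      by (simp only: power2_eq_square ac_simps)
    also have "(2 :: real) ^ j * (1 / 2) ^ j = 1" by (simp add: power_mult_distrib[symmetric])
    finally show "ennreal (B * 2 ^ j) * (\<integral>\<^sup>+x. ennreal (?q x) * indicator {x. L * 2 ^ (j * CARD('n)) \<le> ?q x} x \<partial>lborel)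
       \<le> ennreal (B * ?c * (1 / 2) ^ j) * ?Q" by simp
  qed simp
  also have "(\<Sum>j. ennreal (B * ?c * (1 / 2) ^ j) * ?Q) = (\<Sum>j. ennreal (B * ?c * (1 / 2) ^ j)) * ?Q"
    by (rule ennreal_suminf_multc)
  also have "(\<Sum>j. ennreal (B * ?c * (1 / 2) ^ j)) = ennreal (B * ?c * 2)"
  proof (rule suminf_ennreal_eq)
    show "(\<lambda>j. B * ?c * (1 / 2) ^ j) sums (B * ?c * 2)"
      using geometric_sums[of "1 / 2 :: real"] by (intro sums_mult) simp
  qed (use B in auto)
  finally show ?thesis using B M by (simp add: ennreal_mult[symmetric] mult.commute mult.left_commute)
qed

section \<open>Pointwise splitting of the logarithmic integrand\<close>

lemma power_sum_le:
  fixes a :: "'n::finite \<Rightarrow> real"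
  assumes "\<And>i. 0 \<le> a i"
  shows "(\<Sum>i\<in>UNIV. a i) ^ k \<le> real CARD('n) ^ k * (\<Sum>i\<in>UNIV. a i ^ k)"
proof -
  define m where "m = Max (range a)"
  have "m \<in> range a" unfolding m_def by (intro Max_in) auto
  then obtain i where i: "m = a i" by auto
  have "(\<Sum>i\<in>UNIV. a i) \<le> (\<Sum>i\<in>(UNIV :: 'n set). m)" unfolding m_def by (intro sum_mono Max_ge) auto
  then have "(\<Sum>i\<in>UNIV. a i) ^ k \<le> (real CARD('n) * a i) ^ k"
    using assms i by (intro power_mono) (auto intro: sum_nonneg)
  also have "\<dots> = real CARD('n) ^ k * a i ^ k" by (rule power_mult_distrib)
  also have "a i ^ k \<le> (\<Sum>i\<in>UNIV. a i ^ k)" using assms by (intro member_le_sum) auto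
  finally show ?thesis by (simp add: mult_left_mono)
qed

text \<open>One factor \<open>t\<close> cancels \<open>exp \<bar>ln t\<bar> = 1 / t\<close>, the
  other is at most \<open>1\<close>. At \<open>t = 0\<close> the square makes the value
  \<open>0\<close> whatever \<open>ln 0\<close> is, which agrees with the convention that the
  integrand vanishes where \<open>f = 0\<close>.\<close>

lemma square_log_power_le:
  fixes t :: real assumes "0 \<le> t" "t \<le> 1" shows "t\<^sup>2 * \<bar>ln t\<bar> ^ k \<le> fact k"
proof (cases "t = 0")
  case False
  then have t: "0 < t" "ln t \<le> 0" using assms by auto
  have "t\<^sup>2 * \<bar>ln t\<bar> ^ k \<le> t * (fact k * exp \<bar>ln t\<bar>)"
    using assms by (intro mult_mono power_le_fact_exp) (auto simp: power2_eq_square mult_left_le)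
  also have "\<dots> = fact k" using t by (simp add: abs_of_nonpos exp_minus)
  finally show ?thesis .
qed simp

text \<open>Where \<open>|f|\<close> exceeds \<open>exp (\<parallel>x\<parallel>\<^sup>2 / 2)\<close> it is bounded by \<open>f\<^sup>2 gauss\<close>; elsewhere its logarithm is
  bounded by a quadratic weight.\<close>

lemma square_log_gauss_le:
  fixes x :: "real ^ 'n::finite" and y :: real
  shows "ennreal (y\<^sup>2 * \<bar>ln \<bar>y\<bar>\<bar> ^ k * gauss x) \<le> ennreal (fact k) * ennreal (gauss x)
    + (ennreal (real CARD('n) ^ k) * (\<Sum>i\<in>UNIV. ennreal ((1 + \<bar>x $ i\<bar>) ^ (2 * k) * y\<^sup>2 * gauss x))
    + ennreal (y\<^sup>2 * gauss x * ln (y\<^sup>2 * gauss x) ^ k) * indicator {1..} (y\<^sup>2 * gauss x))"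
  (is "_ \<le> ?A + (?B + ?C)")
proof -
  have g: "0 < gauss x" by (rule gauss_pos)
  consider "\<bar>y\<bar> \<le> 1" | "1 < \<bar>y\<bar>" "\<bar>y\<bar> \<le> exp ((norm x)\<^sup>2 / 2)" | "1 < \<bar>y\<bar>" "exp ((norm x)\<^sup>2 / 2) < \<bar>y\<bar>" by linarith
  then show ?thesis
  proof cases
    case 1
    have "ennreal (y\<^sup>2 * \<bar>ln \<bar>y\<bar>\<bar> ^ k * gauss x) \<le> ennreal (fact k * gauss x)"
      using square_log_power_le[of "\<bar>y\<bar>" k] 1 g by (intro ennreal_leI mult_right_mono) auto
    also have "\<dots> = ?A" using g by (simp add: ennreal_mult)
    finally show ?thesis by (simp add: add_increasing2)
  next
    case 2
    have "ln \<bar>y\<bar> \<le> ln (exp ((norm x)\<^sup>2 / 2))" using 2 by (intro ln_mono) auto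
    moreover have "0 < ln \<bar>y\<bar>" using 2 by simp
    ultimately have "\<bar>ln \<bar>y\<bar>\<bar> \<le> (norm x)\<^sup>2" by simp
    then have "\<bar>ln \<bar>y\<bar>\<bar> ^ k \<le> ((norm x)\<^sup>2) ^ k" by (intro power_mono) auto
    also have "\<dots> \<le> real CARD('n) ^ k * (\<Sum>i\<in>UNIV. ((x $ i)\<^sup>2) ^ k)"
      unfolding norm_vec_square by (rule power_sum_le) simp
    also have "\<dots> \<le> real CARD('n) ^ k * (\<Sum>i\<in>UNIV. (1 + \<bar>x $ i\<bar>) ^ (2 * k))"
    proof (intro mult_left_mono sum_mono)
      fix i
      have "((x $ i)\<^sup>2) ^ k = \<bar>x $ i\<bar> ^ (2 * k)" by (simp add: power_mult)
      also have "\<dots> \<le> (1 + \<bar>x $ i\<bar>) ^ (2 * k)" by (intro power_mono) auto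
      finally show "((x $ i)\<^sup>2) ^ k \<le> (1 + \<bar>x $ i\<bar>) ^ (2 * k)" .
    qed simp
    finally have "\<bar>ln \<bar>y\<bar>\<bar> ^ k * (y\<^sup>2 * gauss x) \<le> real CARD('n) ^ k * (\<Sum>i\<in>UNIV. (1 + \<bar>x $ i\<bar>) ^ (2 * k)) * (y\<^sup>2 * gauss x)"
      using g by (intro mult_right_mono) auto
    also have "\<dots> = real CARD('n) ^ k * (\<Sum>i\<in>UNIV. (1 + \<bar>x $ i\<bar>) ^ (2 * k) * y\<^sup>2 * gauss x)"
      by (simp add: sum_distrib_right mult.assoc)
    finally have "ennreal (y\<^sup>2 * \<bar>ln \<bar>y\<bar>\<bar> ^ k * gauss x) \<le> ennreal (real CARD('n) ^ k * (\<Sum>i\<in>UNIV. (1 + \<bar>x $ i\<bar>) ^ (2 * k) * y\<^sup>2 * gauss x))"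
      by (intro ennreal_leI) (simp only: ac_simps)
    also have "\<dots> = ?B" using g by (subst ennreal_mult) (auto simp: sum_nonneg sum_ennreal)
    finally show ?thesis by (simp add: add_increasing2 add_increasing)
  next
    case 3
    have ge: "\<bar>y\<bar> \<le> y\<^sup>2 * gauss x"
    proof -
      have "1 = exp ((norm x)\<^sup>2 / 2) * gauss x" by (simp add: gauss_def exp_add[symmetric])
      also have "\<dots> \<le> \<bar>y\<bar> * gauss x" using 3 g by (intro mult_right_mono) auto
      finally have "\<bar>y\<bar> * 1 \<le> \<bar>y\<bar> * (\<bar>y\<bar> * gauss x)" by (intro mult_left_mono) auto
      then show ?thesis by (simp add: power2_eq_square mult.assoc[symmetric])
    qed
    then have "ln \<bar>y\<bar> \<le> ln (y\<^sup>2 * gauss x)" using 3 by (intro ln_mono) auto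
    then have "\<bar>ln \<bar>y\<bar>\<bar> ^ k \<le> ln (y\<^sup>2 * gauss x) ^ k" using 3 by (intro power_mono) auto
    then have "ennreal (y\<^sup>2 * \<bar>ln \<bar>y\<bar>\<bar> ^ k * gauss x) \<le> ennreal (y\<^sup>2 * gauss x * ln (y\<^sup>2 * gauss x) ^ k)"
      using g mult_left_mono[of "\<bar>ln \<bar>y\<bar>\<bar> ^ k" "ln (y\<^sup>2 * gauss x) ^ k" "y\<^sup>2 * gauss x"]
      by (intro ennreal_leI) (simp add: ac_simps)
    also have "\<dots> = ?C" using ge 3 by simp
    finally show ?thesis by (simp add: add_increasing)
  qed
qed

text \<open>The pieces of \<open>square_log_gauss_le\<close> are integrated separately: the first
  yields Gaussian mass, the second uses pure derivatives up to order \<open>k\<close>, the third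
  uses the gradient and an additive \<open>B * M\<close>. The bound \<open>M\<close> is fixed in
  advance because the level \<open>L\<close> at which the dyadic layers start is proportional to it,
  and \<open>B\<close> depends on \<open>L\<close>.\<close>

lemma gaussian_higher_log_sobolev:
  fixes M :: real and k :: nat
  assumes "0 < M" "1 \<le> k"
  shows "\<exists>C>0. \<forall>F :: ('n::finite \<Rightarrow> nat) \<Rightarrow> real ^ 'n \<Rightarrow> real.
    (\<forall>\<alpha>. F \<alpha> \<in> borel_measurable borel) \<longrightarrow>
    (\<forall>\<alpha> R. mi_order \<alpha> \<le> k \<longrightarrow> set_integrable lborel (cball 0 R) (F \<alpha>)) \<longrightarrow>
    (\<forall>\<alpha> i T. mi_order \<alpha> < k \<longrightarrow> (\<forall>j. bump_tower (T j)) \<longrightarrow>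
      (LINT x|lborel. F \<alpha> x * prod_jet T ((\<lambda>_. 0)(i := Suc 0)) x)
       = - (LINT x|lborel. F (\<alpha>(i := Suc (\<alpha> i))) x * prod_jet T (\<lambda>_. 0) x)) \<longrightarrow>
    (\<integral>\<^sup>+x. ennreal ((F (\<lambda>_. 0) x)\<^sup>2 * gauss x) \<partial>lborel) \<le> ennreal M \<longrightarrow>
    (\<integral>\<^sup>+x. ennreal ((F (\<lambda>_. 0) x)\<^sup>2 * \<bar>ln \<bar>F (\<lambda>_. 0) x\<bar>\<bar> ^ k * gauss x) \<partial>lborel)
      \<le> ennreal C * (1 + (\<integral>\<^sup>+x. ennreal (gauss (x :: real ^ 'n)) \<partial>lborel)
          + (\<Sum>\<alpha> | mi_order \<alpha> \<le> k. \<integral>\<^sup>+x. ennreal ((F \<alpha> x)\<^sup>2 * gauss x) \<partial>lborel))"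
proof -
  define L where "L = 4 * exp (real CARD('n) / 2) * M"
  obtain B where B: "0 < B" "\<And>j. (max 0 (ln L) + real CARD('n) * real (Suc j)) ^ k \<le> B * 2 ^ j"
    using power_linear_le_power2[of "max 0 (ln L)" "CARD('n)" k] by auto
  define c\<^sub>1 where "c\<^sub>1 = 2 * B * (real CARD('n set) * (4 * exp (real CARD('n) / 2) * real CARD('n)))"
  define c\<^sub>2 where "c\<^sub>2 = real CARD('n) ^ k * (real CARD('n) * (\<Prod>l<k. 4 * moment_const l))"
  define C where "C = fact k + B * M + c\<^sub>1 + c\<^sub>2"
  have c: "0 \<le> c\<^sub>1" "0 \<le> c\<^sub>2" "0 \<le> B * M"
    using B assms by (auto simp: c\<^sub>1_def c\<^sub>2_def moment_const_nonneg intro!: mult_nonneg_nonneg prod_nonneg)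
  have "C > 0" using c by (simp add: C_def add_pos_nonneg)
  show ?thesis
  proof (intro exI[of _ C] conjI allI impI \<open>C > 0\<close>)
    fix F :: "('n \<Rightarrow> nat) \<Rightarrow> real ^ 'n \<Rightarrow> real"
    assume meas: "\<forall>\<alpha>. F \<alpha> \<in> borel_measurable borel"
      and int: "\<forall>\<alpha> R. mi_order \<alpha> \<le> k \<longrightarrow> set_integrable lborel (cball 0 R) (F \<alpha>)"
      and weak: "\<forall>\<alpha> i T. mi_order \<alpha> < k \<longrightarrow> (\<forall>j. bump_tower (T j)) \<longrightarrow>
      (LINT x|lborel. F \<alpha> x * prod_jet T ((\<lambda>_. 0)(i := Suc 0)) x)
       = - (LINT x|lborel. F (\<alpha>(i := Suc (\<alpha> i))) x * prod_jet T (\<lambda>_. 0) x)"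
      and M: "(\<integral>\<^sup>+x. ennreal ((F (\<lambda>_. 0) x)\<^sup>2 * gauss x) \<partial>lborel) \<le> ennreal M"
    have [measurable]: "F \<alpha> \<in> borel_measurable borel" for \<alpha> using meas by blast
    let ?f = "F (\<lambda>_. 0)"
    let ?I = "\<lambda>\<alpha>. \<integral>\<^sup>+x. ennreal ((F \<alpha> x)\<^sup>2 * gauss x) \<partial>lborel"
    define S where "S = (\<Sum>\<alpha> | mi_order \<alpha> \<le> k. ?I \<alpha>)"
    define Z where "Z = (\<integral>\<^sup>+x. ennreal (gauss (x :: real ^ 'n)) \<partial>lborel)"
    \<comment> \<open>Multi-indices concentrated in one coordinate: the weight
      \<open>(norm x) ^ (2 * k)\<close> has been split into single coordinates, so no mixed
      derivatives arise.\<close>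
    let ?p = "\<lambda>(i::'n) l. ((\<lambda>_. 0)(i := l)) :: 'n \<Rightarrow> nat"
    have order: "mi_order (?p i l) = l" for i l
      unfolding mi_order_def by (subst sum.remove[of _ i]) auto
    have p0: "?p i 0 = (\<lambda>_. 0)" for i by auto
    have moments: "(\<integral>\<^sup>+x. ennreal ((1 + \<bar>x $ i\<bar>) ^ (2 * k) * (?f x)\<^sup>2 * gauss x) \<partial>lborel)
        \<le> ennreal (\<Prod>l<k. 4 * moment_const l) * S" for i
    proof -
      have "(\<integral>\<^sup>+x. ennreal ((1 + \<bar>x $ i\<bar>) ^ (2 * k) * (F (?p i 0) x)\<^sup>2 * gauss x) \<partial>lborel)
         \<le> ennreal (\<Prod>l<k. 4 * moment_const l) * (\<Sum>l\<le>k. ?I (?p i (0 + l)))"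
      proof (rule gaussian_moments[where k = k and F = "\<lambda>l. F (?p i l)"])
        show "set_integrable lborel (cball 0 R) (F (?p i j))" if "j \<le> k" for j R
          using int that by (simp add: order)
        fix T :: "'n \<Rightarrow> nat \<Rightarrow> real \<Rightarrow> real" and j
        assume T: "\<And>i. bump_tower (T i)" and "j < k"
        have "(?p i j)(i := Suc (?p i j i)) = ?p i (Suc j)" by auto
        then show "(LINT x|lborel. F (?p i j) x * prod_jet T ((\<lambda>_. 0)(i := Suc 0)) x)
          = - (LINT x|lborel. F (?p i (Suc j)) x * prod_jet T (\<lambda>_. 0) x)"
          using weak[rule_format, of "?p i j" T i] T \<open>j < k\<close> by (simp add: order)
      qed auto
      \<comment> \<open>Distinct \<open>l\<close> give distinct multi-indices, so the sum over
        \<open>l\<close> is part of the sum \<open>S\<close>.\<close>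
      also have "(\<Sum>l\<le>k. ?I (?p i (0 + l))) = (\<Sum>\<alpha>\<in>?p i ` {..k}. ?I \<alpha>)"
        by (subst sum.reindex) (auto simp: inj_on_def fun_upd_eqD)
      also have "\<dots> \<le> S"
        unfolding S_def by (intro sum_mono2 finite_mi_order_le) (auto simp: order)
      finally show ?thesis unfolding p0 by (simp add: mult_left_mono)
    qed
    have "(\<integral>\<^sup>+x. ennreal ((\<Sum>i\<in>UNIV. (F (?p i (Suc 0)) x)\<^sup>2) * gauss x) \<partial>lborel)
       = (\<integral>\<^sup>+x. (\<Sum>i\<in>UNIV. ennreal ((F (?p i (Suc 0)) x)\<^sup>2 * gauss x)) \<partial>lborel)"
      unfolding sum_distrib_right
      by (intro nn_integral_cong sum_ennreal[symmetric] mult_nonneg_nonneg less_imp_le[OF gauss_pos]) simp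
    also have "\<dots> = (\<Sum>i\<in>UNIV. ?I (?p i (Suc 0)))" by (rule nn_integral_sum) measurable
    also have "\<dots> = (\<Sum>\<alpha>\<in>(\<lambda>i. ?p i (Suc 0)) ` UNIV. ?I \<alpha>)"
    proof (subst sum.reindex)
      show "inj (\<lambda>i. ?p i (Suc 0))" by (rule injI) (metis fun_upd_apply nat.simps(3))
    qed simp
    also have "\<dots> \<le> S"
      unfolding S_def using \<open>1 \<le> k\<close> by (intro sum_mono2 finite_mi_order_le) (auto simp: order)
    finally have grad: "(\<integral>\<^sup>+x. ennreal ((\<Sum>i\<in>UNIV. (F (?p i (Suc 0)) x)\<^sup>2) * gauss x) \<partial>lborel) \<le> S" .
    have "(\<integral>\<^sup>+x. ennreal ((?f x)\<^sup>2 * gauss x * ln ((?f x)\<^sup>2 * gauss x) ^ k) * indicator {x. 1 \<le> (?f x)\<^sup>2 * gauss x} x \<partial>lborel)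
      \<le> ennreal (B * M) + ennreal c\<^sub>1 * (\<integral>\<^sup>+x. ennreal ((\<Sum>i\<in>UNIV. (F (?p i (Suc 0)) x)\<^sup>2) * gauss x) \<partial>lborel)"
      unfolding c\<^sub>1_def
    proof (rule gaussian_log_tail)
      show "set_integrable lborel (cball 0 R) ?f" for R using int by (simp add: mi_order_def)
      show "set_integrable lborel (cball 0 R) (F (?p i (Suc 0)))" for i R
        using int \<open>1 \<le> k\<close> by (simp add: order)
      fix T :: "'n \<Rightarrow> nat \<Rightarrow> real \<Rightarrow> real" and i
      assume T: "\<And>i. bump_tower (T i)"
      show "(LINT x|lborel. ?f x * prod_jet T ((\<lambda>_. 0)(i := Suc 0)) x)
          = - (LINT x|lborel. F (?p i (Suc 0)) x * prod_jet T (\<lambda>_. 0) x)"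
        using weak[rule_format, of "\<lambda>_. 0" T i] T \<open>1 \<le> k\<close> by (simp add: mi_order_def)
    qed (use M assms L_def B in auto)
    also have "\<dots> \<le> ennreal (B * M) + ennreal c\<^sub>1 * S" by (intro add_left_mono mult_left_mono grad) simp
    finally have tail: "(\<integral>\<^sup>+x. ennreal ((?f x)\<^sup>2 * gauss x * ln ((?f x)\<^sup>2 * gauss x) ^ k) * indicator {x. 1 \<le> (?f x)\<^sup>2 * gauss x} x \<partial>lborel)
      \<le> ennreal (B * M) + ennreal c\<^sub>1 * S" .
    have "(\<integral>\<^sup>+x. ennreal ((?f x)\<^sup>2 * \<bar>ln \<bar>?f x\<bar>\<bar> ^ k * gauss x) \<partial>lborel)
      \<le> (\<integral>\<^sup>+x. ennreal (fact k) * ennreal (gauss x)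
        + (ennreal (real CARD('n) ^ k) * (\<Sum>i\<in>UNIV. ennreal ((1 + \<bar>x $ i\<bar>) ^ (2 * k) * (?f x)\<^sup>2 * gauss x))
        + ennreal ((?f x)\<^sup>2 * gauss x * ln ((?f x)\<^sup>2 * gauss x) ^ k) * indicator {x. 1 \<le> (?f x)\<^sup>2 * gauss x} x) \<partial>lborel)"
    proof (rule nn_integral_mono)
      fix x :: "real ^ 'n"
      have "indicator {1..} ((?f x)\<^sup>2 * gauss x) = (indicator {x. 1 \<le> (?f x)\<^sup>2 * gauss x} x :: ennreal)"
        by (simp add: indicator_def)
      then show "ennreal ((?f x)\<^sup>2 * \<bar>ln \<bar>?f x\<bar>\<bar> ^ k * gauss x) \<le> ennreal (fact k) * ennreal (gauss x)
        + (ennreal (real CARD('n) ^ k) * (\<Sum>i\<in>UNIV. ennreal ((1 + \<bar>x $ i\<bar>) ^ (2 * k) * (?f x)\<^sup>2 * gauss x))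
        + ennreal ((?f x)\<^sup>2 * gauss x * ln ((?f x)\<^sup>2 * gauss x) ^ k) * indicator {x. 1 \<le> (?f x)\<^sup>2 * gauss x} x)"
        using square_log_gauss_le[of "?f x" k x] by (simp only:)
    qed
    also have "\<dots> = ennreal (fact k) * Z
        + (ennreal (real CARD('n) ^ k) * (\<Sum>i\<in>UNIV. \<integral>\<^sup>+x. ennreal ((1 + \<bar>x $ i\<bar>) ^ (2 * k) * (?f x)\<^sup>2 * gauss x) \<partial>lborel)
        + (\<integral>\<^sup>+x. ennreal ((?f x)\<^sup>2 * gauss x * ln ((?f x)\<^sup>2 * gauss x) ^ k) * indicator {x. 1 \<le> (?f x)\<^sup>2 * gauss x} x \<partial>lborel))"
      unfolding Z_def
      by (subst nn_integral_add, measurable, subst nn_integral_add, measurable)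
        (subst nn_integral_cmult, measurable, subst nn_integral_cmult, measurable, subst nn_integral_sum, measurable)
    also have "\<dots> \<le> ennreal (fact k) * Z
        + (ennreal (real CARD('n) ^ k) * (\<Sum>i\<in>(UNIV :: 'n set). ennreal (\<Prod>l<k. 4 * moment_const l) * S)
        + (ennreal (B * M) + ennreal c\<^sub>1 * S))"
      by (intro add_mono mult_left_mono sum_mono moments tail order_refl) simp_all
    also have "ennreal (real CARD('n) ^ k) * (\<Sum>i\<in>(UNIV :: 'n set). ennreal (\<Prod>l<k. 4 * moment_const l) * S) = ennreal c\<^sub>2 * S"
      unfolding c\<^sub>2_def
      by (simp add: ennreal_mult moment_const_nonneg prod_nonneg ennreal_of_nat_eq_real_of_nat mult.assoc)
    also have "ennreal (fact k) * Z + (ennreal c\<^sub>2 * S + (ennreal (B * M) + ennreal c\<^sub>1 * S))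
       \<le> ennreal C * Z + (ennreal (c\<^sub>2 + c\<^sub>1) * S + ennreal C * 1)"
    proof -
      have "ennreal c\<^sub>2 * S + ennreal c\<^sub>1 * S = ennreal (c\<^sub>2 + c\<^sub>1) * S"
        using c by (simp add: distrib_right)
      moreover have "ennreal (fact k) * Z \<le> ennreal C * Z"
        using c by (intro mult_right_mono ennreal_leI) (auto simp: C_def)
      moreover have "ennreal (B * M) \<le> ennreal C * 1"
        using c by (simp only: mult_1_right, intro ennreal_leI) (auto simp: C_def)
      ultimately show ?thesis by (simp add: add_mono ac_simps)
    qed
    also have "\<dots> \<le> ennreal C * Z + (ennreal C * S + ennreal C * 1)"
      using c B assms by (intro add_mono mult_right_mono ennreal_leI order_refl) (auto simp: C_def)
    also have "\<dots> = ennreal C * (1 + Z + S)" by (simp only: distrib_left ac_simps)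
    finally show "(\<integral>\<^sup>+x. ennreal ((?f x)\<^sup>2 * \<bar>ln \<bar>?f x\<bar>\<bar> ^ k * gauss x) \<partial>lborel)
      \<le> ennreal C * (1 + (\<integral>\<^sup>+x. ennreal (gauss (x :: real ^ 'n)) \<partial>lborel)
          + (\<Sum>\<alpha> | mi_order \<alpha> \<le> k. \<integral>\<^sup>+x. ennreal ((F \<alpha> x)\<^sup>2 * gauss x) \<partial>lborel))"
      by (simp only: Z_def S_def)
  qed
qed

section \<open>Reduction to the Gaussian measure\<close>

lemma mi_order_upd: "mi_order (\<alpha>(i := Suc (\<alpha> i))) = Suc (mi_order \<alpha>)"
  unfolding mi_order_def by (subst (1 2) sum.remove[of _ i]) auto

text \<open>The bound is the order-zero term of the defining sum. Measurability comes from
  continuity almost everywhere: \<open>a\<close> is continuous on the complement of a null set, and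
  changing it to \<open>0\<close> on that set preserves Lebesgue measurability.\<close>

lemma holder_class_bounded:
  fixes a :: "real ^ 'n::finite \<Rightarrow> real"
  assumes a: "a \<in> holder_class \<eta> \<alpha> K" and "0 < K"
  shows "a \<in> borel_measurable lebesgue" "AE x in lebesgue. \<bar>a x\<bar> \<le> K"
proof -
  obtain D where D: "ae_partials (nat \<lfloor>\<eta>\<rfloor>) a D"
    and le: "(\<Sum>\<nu> | mi_order \<nu> \<le> nat \<lfloor>\<eta>\<rfloor>. Linf_norm (D \<nu>)) +
            (\<Sum>\<nu> | mi_order \<nu> = nat \<lfloor>\<eta>\<rfloor>. log_holder_seminorm (\<eta> - of_int \<lfloor>\<eta>\<rfloor>) \<alpha> (D \<nu>)) \<le> ennreal K"
    using a by (auto simp: holder_class_def)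
  have D0: "D (\<lambda>_. 0) = a" and cont: "AE x in lebesgue. isCont a x"
    using D by (auto simp: ae_partials_def)
  have "Linf_norm a \<le> (\<Sum>\<nu> | mi_order \<nu> \<le> nat \<lfloor>\<eta>\<rfloor>. Linf_norm (D \<nu>))"
    unfolding D0[symmetric]
    by (rule member_le_sum) (auto simp: mi_order_def intro: finite_mi_order_le[unfolded mi_order_def])
  also have "\<dots> \<le> \<dots> + (\<Sum>\<nu> | mi_order \<nu> = nat \<lfloor>\<eta>\<rfloor>. log_holder_seminorm (\<eta> - of_int \<lfloor>\<eta>\<rfloor>) \<alpha> (D \<nu>))"
    by simp
  also note le
  finally have ess: "esssup lebesgue (\<lambda>x. ennreal \<bar>a x\<bar>) \<le> ennreal K" by (simp add: Linf_norm_def)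
  show "AE x in lebesgue. \<bar>a x\<bar> \<le> K"
    using esssup_AE[of "\<lambda>x. ennreal \<bar>a x\<bar>" lebesgue]
  proof eventually_elim
    case (elim x)
    then have "ennreal \<bar>a x\<bar> \<le> ennreal K" using ess by (rule order_trans)
    then show ?case using \<open>0 < K\<close> by simp
  qed
  obtain N where N: "N \<in> null_sets lebesgue" "{x. \<not> isCont a x} \<subseteq> N"
    using cont by (auto simp: eventually_ae_filter)
  have [measurable]: "- N \<in> sets lebesgue" 
    using sets.compl_sets[OF null_setsD2[OF N(1)]] by (simp add: Compl_eq_Diff_UNIV)
  have "continuous_on (- N) a" using N(2) by (auto intro!: continuous_at_imp_continuous_on)
  then have "a \<in> borel_measurable (lebesgue_on (- N))"
    by (rule continuous_imp_measurable_on_sets_lebesgue) measurable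
  then have "(\<lambda>x. if x \<in> - N then a x else 0) \<in> borel_measurable lebesgue"
    by (rule borel_measurable_if_I) measurable
  moreover have "AE x in lebesgue. (if x \<in> - N then a x else 0) = a x"
    using AE_not_in[OF N(1)] by eventually_elim simp
  ultimately show "a \<in> borel_measurable lebesgue" by (rule borel_measurable_AE)
qed

text \<open>Weak derivatives live on the completed measure, while the translation and Fubini
  arguments run over \<open>lborel\<close> with Borel functions. A Borel representative keeps all
  pairings with Borel test functions.\<close>

lemma locally_integrable_borel_version:
  fixes g :: "real ^ 'n::finite \<Rightarrow> real"
  assumes g: "g \<in> borel_measurable lebesgue" and loc: "locally_integrable g"
  shows "\<exists>g'. g' \<in> borel_measurable borel \<and> (AE x in lebesgue. g x = g' x) \<and>
     (\<forall>R. set_integrable lborel (cball 0 R) g') \<and>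
     (\<forall>p\<in>borel_measurable borel. (LINT x|lebesgue. g x * p x) = (LINT x|lborel. g' x * p x))"
proof -
  obtain g' where g' [measurable]: "g' \<in> borel_measurable borel" and ae: "AE x in lborel. g x = g' x"
    using completion_ex_borel_measurable_real[OF g] by auto
  then have AE: "AE x in lebesgue. g x = g' x" by (intro AE_completion)
  have "set_integrable lborel (cball 0 R) g'" for R
  proof -
    have m: "(\<lambda>x. indicator (cball 0 R) x *\<^sub>R g' x) \<in> borel_measurable borel"
      using g' by (intro borel_measurable_scaleR borel_measurable_indicator) auto
    have "integrable lebesgue (\<lambda>x. indicator (cball 0 R) x *\<^sub>R g x)"
      using loc by (auto simp: locally_integrable_def set_integrable_def)
    moreover have "(\<lambda>x. indicator (cball 0 R) x *\<^sub>R g' x) \<in> borel_measurable lebesgue"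
      using m by (intro measurable_completion) simp
    moreover have "AE x in lebesgue. indicator (cball 0 R) x *\<^sub>R g x = indicator (cball 0 R) x *\<^sub>R g' x"
      using AE by eventually_elim simp
    ultimately have "integrable lebesgue (\<lambda>x. indicator (cball 0 R) x *\<^sub>R g' x)"
      by (rule Bochner_Integration.integrable_cong_AE_imp)
    then show ?thesis unfolding set_integrable_def using m by (subst (asm) integrable_completion) auto
  qed
  moreover have "(LINT x|lebesgue. g x * p x) = (LINT x|lborel. g' x * p x)"
    if p: "p \<in> borel_measurable borel" for p
  proof -
    have m: "(\<lambda>x. g' x * p x) \<in> borel_measurable borel" by (rule borel_measurable_times[OF g' p])
    have "(LINT x|lebesgue. g x * p x) = (LINT x|lebesgue. g' x * p x)"
    proof (rule integral_cong_AE)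
      show "(\<lambda>x. g x * p x) \<in> borel_measurable lebesgue"
        by (rule borel_measurable_times[OF g measurable_completion]) (simp add: p)
      show "(\<lambda>x. g' x * p x) \<in> borel_measurable lebesgue"
        using m by (intro measurable_completion) simp
      show "AE x in lebesgue. g x * p x = g' x * p x" using AE by eventually_elim simp
    qed
    also have "\<dots> = (LINT x|lborel. g' x * p x)" using m by (intro integral_completion) simp
    finally show ?thesis .
  qed
  ultimately show ?thesis using g' AE by blast
qed

text \<open>The identity for \<alpha> is tested with the jet whose \<open>i\<close>-th tower is
  shifted, that is, with the \<open>i\<close>-th derivative of the test function; the identity for
  the raised index is tested with the original jet. Both have the same left-hand side, and their
  signs differ by one factor \<open>-1\<close>.\<close>

lemma weak_deriv_step:
  fixes f g g' :: "real ^ 'n::finite \<Rightarrow> real"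
  assumes "weak_deriv \<alpha> f g" "weak_deriv (\<alpha>(i := Suc (\<alpha> i))) f g'" and T: "\<And>j. bump_tower (T j)"
  shows "(LINT x|lebesgue. g x * prod_jet T ((\<lambda>_. 0)(i := Suc 0)) x)
      = - (LINT x|lebesgue. g' x * prod_jet T (\<lambda>_. 0) x)"
proof -
  define T' where "T' = T(i := \<lambda>n. T i (n + 1))"
  have "bump_tower (T' j)" for j using T bump_tower_shift[of "T i" 1] by (simp add: T'_def)
  then have jets: "test_jet (prod_jet T)" "test_jet (prod_jet T')" using T by (simp_all add: test_jet_prod_jet)
  have eq: "prod_jet T' \<nu> = prod_jet T (\<nu>(i := Suc (\<nu> i)))" for \<nu>
    unfolding prod_jet_def T'_def by (intro ext prod.cong) auto
  have "(LINT x|lebesgue. f x * prod_jet T' \<alpha> x)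
     = (-1) ^ mi_order \<alpha> * (LINT x|lebesgue. g x * prod_jet T' (\<lambda>_. 0) x)"
    using assms(1) jets(2) unfolding weak_deriv_def by blast
  then have "(LINT x|lebesgue. f x * prod_jet T (\<alpha>(i := Suc (\<alpha> i))) x)
     = (-1) ^ mi_order \<alpha> * (LINT x|lebesgue. g x * prod_jet T ((\<lambda>_. 0)(i := Suc 0)) x)"
    by (simp only: eq)
  moreover have "(LINT x|lebesgue. f x * prod_jet T (\<alpha>(i := Suc (\<alpha> i))) x)
     = (-1) ^ Suc (mi_order \<alpha>) * (LINT x|lebesgue. g' x * prod_jet T (\<lambda>_. 0) x)"
    using assms(2) jets(1) unfolding weak_deriv_def mi_order_upd by blast
  ultimately show ?thesis by (cases "even (mi_order \<alpha>)") simp_all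
qed

text \<open>The family of derivatives contains its own member of order zero, which is tied to
  \<open>f\<close> only through the weak identity.\<close>

lemma weak_deriv_0_AE:
  fixes f g :: "real ^ 'n::finite \<Rightarrow> real"
  assumes w: "weak_deriv (\<lambda>_. 0) f g" and meas: "f \<in> borel_measurable lebesgue" "g \<in> borel_measurable lebesgue"
  shows "AE x in lebesgue. f x = g x"
proof -
  have loc: "locally_integrable f" "locally_integrable g" using w by (auto simp: weak_deriv_def)
  obtain f' where f': "f' \<in> borel_measurable borel" "AE x in lebesgue. f x = f' x"
     "\<And>R. set_integrable lborel (cball 0 R) f'"
     "\<And>p. p\<in>borel_measurable borel \<Longrightarrow> (LINT x|lebesgue. f x * p x) = (LINT x|lborel. f' x * p x)"
    using locally_integrable_borel_version[OF meas(1) loc(1)] by auto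
  obtain g' where g': "g' \<in> borel_measurable borel" "AE x in lebesgue. g x = g' x"
     "\<And>R. set_integrable lborel (cball 0 R) g'"
     "\<And>p. p\<in>borel_measurable borel \<Longrightarrow> (LINT x|lebesgue. g x * p x) = (LINT x|lborel. g' x * p x)"
    using locally_integrable_borel_version[OF meas(2) loc(2)] by auto
  have "AE x in lborel. f' x - g' x = 0"
  proof (rule AE_zero_if_weakly_zero)
    show "set_integrable lborel (cball 0 R) (\<lambda>x. f' x - g' x)" for R
      using f'(3) g'(3) by (intro set_integral_diff)
    fix T :: "'n \<Rightarrow> nat \<Rightarrow> real \<Rightarrow> real" assume T: "\<And>i. bump_tower (T i)"
    have "(LINT x|lborel. f' x * prod_jet T (\<lambda>_. 0) x) = (LINT x|lborel. g' x * prod_jet T (\<lambda>_. 0) x)"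
      using w test_jet_prod_jet[of T, OF T] f'(4) g'(4) prod_jet_measurable[of T, OF T]
      by (auto simp: weak_deriv_def mi_order_def)
    then show "(LINT x|lborel. (f' x - g' x) * prod_jet T (\<lambda>_. 0) x) = 0"
      using integrable_mult_prod_jet[of T f', OF T f'(3)] integrable_mult_prod_jet[of T g', OF T g'(3)]
      by (simp add: left_diff_distrib)
  qed
  then have "AE x in lebesgue. f' x - g' x = 0" by (rule AE_completion)
  with f'(2) g'(2) show ?thesis by eventually_elim simp
qed

text \<open>The constant \<open>c\<close> is controlled by the normalisation: total mass \<open>1\<close> and \<open>|a| \<le> K\<close> place
  \<open>exp c\<close> between \<open>exp (- K) / Z\<close> and \<open>exp K / Z\<close>.\<close>

lemma perturbed_gaussian_compare:
  fixes a :: "real ^ 'n::finite \<Rightarrow> real" and c K :: real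
  defines "Z \<equiv> \<integral>\<^sup>+x. ennreal (gauss (x :: real ^ 'n)) \<partial>lborel"
  assumes [measurable]: "a \<in> borel_measurable lebesgue" and bound: "AE x in lebesgue. \<bar>a x\<bar> \<le> K"
    and prob: "prob_space (perturbed_gaussian a c)"
  shows "0 < Z" "Z < \<infinity>"
    and "\<And>h. h \<in> borel_measurable lebesgue \<Longrightarrow> (\<integral>\<^sup>+x. h x \<partial>perturbed_gaussian a c)
      \<le> ennreal (exp (2 * K) / enn2real Z) * (\<integral>\<^sup>+x. h x * ennreal (gauss x) \<partial>lebesgue)"
    and "\<And>h. h \<in> borel_measurable lebesgue \<Longrightarrow> (\<integral>\<^sup>+x. h x * ennreal (gauss x) \<partial>lebesgue)
      \<le> ennreal (exp (2 * K) * enn2real Z) * (\<integral>\<^sup>+x. h x \<partial>perturbed_gaussian a c)"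
proof -
  have gm [measurable]: "(gauss :: real ^ 'n \<Rightarrow> real) \<in> borel_measurable lebesgue"
    using measurable_completion[of "gauss :: real ^ 'n \<Rightarrow> real" lborel borel] by simp
  have nm [measurable]: "(norm :: real ^ 'n \<Rightarrow> real) \<in> borel_measurable lebesgue"
    using measurable_completion[of "norm :: real ^ 'n \<Rightarrow> real" lborel borel] by simp
  have mu: "(\<integral>\<^sup>+x. h x \<partial>perturbed_gaussian a c) = (\<integral>\<^sup>+x. ennreal (exp (a x + c)) * (h x * ennreal (gauss x)) \<partial>lebesgue)"
    if [measurable]: "h \<in> borel_measurable lebesgue" for h
  proof -
    have "(\<integral>\<^sup>+x. h x \<partial>perturbed_gaussian a c) = (\<integral>\<^sup>+x. ennreal (exp (- (norm x)\<^sup>2 / 2 + a x + c)) * h x \<partial>lebesgue)"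
      unfolding perturbed_gaussian_def by (rule nn_integral_density) measurable
    also have "\<dots> = (\<integral>\<^sup>+x. ennreal (exp (a x + c)) * (h x * ennreal (gauss x)) \<partial>lebesgue)"
    proof (intro nn_integral_cong)
      fix x :: "real ^ 'n"
      have "exp (- (norm x)\<^sup>2 / 2 + a x + c) = exp (a x + c) * gauss x"
        by (simp add: gauss_def exp_add[symmetric] ac_simps)
      then show "ennreal (exp (- (norm x)\<^sup>2 / 2 + a x + c)) * h x = ennreal (exp (a x + c)) * (h x * ennreal (gauss x))"
        by (simp only: ennreal_mult''[OF less_imp_le[OF gauss_pos]]) (simp only: ac_simps)
    qed
    finally show ?thesis .
  qed
  have upper: "(\<integral>\<^sup>+x. h x \<partial>perturbed_gaussian a c) \<le> ennreal (exp (K + c)) * (\<integral>\<^sup>+x. h x * ennreal (gauss x) \<partial>lebesgue)"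
    if [measurable]: "h \<in> borel_measurable lebesgue" for h
    unfolding mu[OF that]
  proof (subst nn_integral_cmult[symmetric], measurable, rule nn_integral_mono_AE)
    show "AE x in lebesgue. ennreal (exp (a x + c)) * (h x * ennreal (gauss x)) \<le> ennreal (exp (K + c)) * (h x * ennreal (gauss x))"
      using bound
    proof eventually_elim
      case (elim x)
      then show ?case by (intro mult_right_mono ennreal_leI) auto
    qed
  qed
  have lower: "(\<integral>\<^sup>+x. h x * ennreal (gauss x) \<partial>lebesgue) \<le> ennreal (exp (K - c)) * (\<integral>\<^sup>+x. h x \<partial>perturbed_gaussian a c)"
    if [measurable]: "h \<in> borel_measurable lebesgue" for h
    unfolding mu[OF that]
  proof (subst nn_integral_cmult[symmetric], measurable, rule nn_integral_mono_AE)
    show "AE x in lebesgue. h x * ennreal (gauss x) \<le> ennreal (exp (K - c)) * (ennreal (exp (a x + c)) * (h x * ennreal (gauss x)))"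
      using bound
    proof eventually_elim
      case (elim x)
      have "1 \<le> exp (K - c) * exp (a x + c)" using elim by (simp add: exp_add[symmetric])
      then have "ennreal 1 \<le> ennreal (exp (K - c) * exp (a x + c))" by (rule ennreal_leI)
      then have "1 * (h x * ennreal (gauss x)) \<le> (ennreal (exp (K - c)) * ennreal (exp (a x + c))) * (h x * ennreal (gauss x))"
        by (intro mult_right_mono) (simp_all add: ennreal_mult')
      then show ?case by (simp add: mult.assoc)
    qed
  qed
  have Z_eq: "(\<integral>\<^sup>+x. 1 * ennreal (gauss (x :: real ^ 'n)) \<partial>lebesgue) = Z"
    by (simp add: Z_def nn_integral_completion)
  have one: "(\<integral>\<^sup>+x. 1 \<partial>perturbed_gaussian a c) = 1"
    using prob_space.emeasure_space_1[OF prob] by simp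
  have 1: "1 \<le> ennreal (exp (K + c)) * Z" using upper[of "\<lambda>_. 1"] unfolding one Z_eq by simp
  have 2: "Z \<le> ennreal (exp (K - c))" using lower[of "\<lambda>_. 1"] unfolding one Z_eq by simp
  show "0 < Z" using 1 by (cases "Z = 0") (auto simp: zero_less_iff_neq_zero)
  show "Z < \<infinity>" using 2 by (rule le_less_trans) simp
  then obtain z where z: "Z = ennreal z" "0 \<le> z" by (cases Z) auto
  with \<open>0 < Z\<close> have "0 < z" by simp
  have le1: "1 \<le> exp (K + c) * z" using 1 z by (simp add: ennreal_mult'[symmetric])
  have le2: "z \<le> exp (K - c)" using 2 z by simp
  \<comment> \<open>Combining the upper estimate of one kind with the lower one of the other cancels
    \<open>c\<close> and leaves \<open>exp (2 * K)\<close>.\<close>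
  have "exp (K + c) * z \<le> exp (K + c) * exp (K - c)" by (rule mult_left_mono[OF le2]) simp
  also have "\<dots> = exp (2 * K)" by (simp add: exp_add[symmetric])
  finally have e1: "exp (K + c) \<le> exp (2 * K) / enn2real Z"
    using z \<open>0 < z\<close> by (simp add: pos_le_divide_eq)
  have "exp (K - c) * 1 \<le> exp (K - c) * (exp (K + c) * z)" by (rule mult_left_mono[OF le1]) simp
  also have "\<dots> = exp (2 * K) * z" by (simp add: exp_add[symmetric] mult.assoc[symmetric])
  finally have e2: "exp (K - c) \<le> exp (2 * K) * enn2real Z" using z by simp
  fix h :: "real ^ 'n \<Rightarrow> ennreal" assume h: "h \<in> borel_measurable lebesgue"
  show "(\<integral>\<^sup>+x. h x \<partial>perturbed_gaussian a c)
      \<le> ennreal (exp (2 * K) / enn2real Z) * (\<integral>\<^sup>+x. h x * ennreal (gauss x) \<partial>lebesgue)"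
    by (rule order_trans[OF upper[OF h]]) (intro mult_right_mono ennreal_leI e1, simp)
  show "(\<integral>\<^sup>+x. h x * ennreal (gauss x) \<partial>lebesgue)
      \<le> ennreal (exp (2 * K) * enn2real Z) * (\<integral>\<^sup>+x. h x \<partial>perturbed_gaussian a c)"
    by (rule order_trans[OF lower[OF h]]) (intro mult_right_mono ennreal_leI e2, simp)
qed

lemma nn_integral_square_eq_L2:
  assumes "in_L2 M g" shows "(\<integral>\<^sup>+x. ennreal ((g x)\<^sup>2) \<partial>M) = ennreal ((L2_norm M g)\<^sup>2)"
proof -
  have "(\<integral>\<^sup>+x. ennreal ((g x)\<^sup>2) \<partial>M) = ennreal (LINT x|M. (g x)\<^sup>2)"
    using assms unfolding in_L2_def by (intro nn_integral_eq_integral AE_I2 zero_le_power2) blast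
  moreover have "0 \<le> (LINT x|M. (g x)\<^sup>2)" by (intro integral_nonneg_AE AE_I2 zero_le_power2)
  ultimately show ?thesis by (simp only: L2_norm_def real_sqrt_pow2)
qed

text \<open>The mass bound \<open>b\<close> must be fixed before \<open>a\<close> and
  \<open>c\<close>. This is possible because the comparison with the Gaussian involves only
  \<open>K\<close> and the mass \<open>z\<close>, which depends on the dimension alone.\<close>

lemma perturbed_gaussian_log_sobolev:
  fixes K :: real and k :: nat
  assumes K: "0 < K" and k: "1 \<le> k"
  shows "\<exists>C>0. \<forall>(a :: real ^ 'n::finite \<Rightarrow> real) (c :: real) (f :: real ^ 'n \<Rightarrow> real) Df.
     a \<in> borel_measurable lebesgue \<longrightarrow> (AE x in lebesgue. \<bar>a x\<bar> \<le> K) \<longrightarrow>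
     prob_space (perturbed_gaussian a c) \<longrightarrow>
     in_L2 (perturbed_gaussian a c) f \<longrightarrow> L2_norm (perturbed_gaussian a c) f = 1 \<longrightarrow>
     (\<forall>\<alpha>. mi_order \<alpha> \<le> k \<longrightarrow> weak_deriv \<alpha> f (Df \<alpha>) \<and> in_L2 (perturbed_gaussian a c) (Df \<alpha>)) \<longrightarrow>
     (\<integral>\<^sup>+ x. ennreal (\<bar>f x\<bar>\<^sup>2 * \<bar>ln \<bar>f x\<bar>\<bar> ^ k) \<partial>perturbed_gaussian a c)
        \<le> ennreal (C * (\<Sum>\<alpha> | mi_order \<alpha> \<le> k. (L2_norm (perturbed_gaussian a c) (Df \<alpha>))\<^sup>2))"
proof -
  define Z where "Z = (\<integral>\<^sup>+x. ennreal (gauss (x :: real ^ 'n)) \<partial>lborel)"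
  define z where "z = enn2real Z"
  \<comment> \<open>Positivity of \<open>z\<close> is derived only once some perturbed Gaussian is a
    probability measure; the \<open>max 1\<close> makes \<open>b\<close> positive
    beforehand.\<close>
  define b where "b = max 1 (exp (2 * K) * z)"
  have "0 < b" by (simp add: b_def)
  obtain C where C: "0 < C" and main: "\<And>F :: ('n \<Rightarrow> nat) \<Rightarrow> real ^ 'n \<Rightarrow> real.
    \<forall>\<alpha>. F \<alpha> \<in> borel_measurable borel \<Longrightarrow>
    \<forall>\<alpha> R. mi_order \<alpha> \<le> k \<longrightarrow> set_integrable lborel (cball 0 R) (F \<alpha>) \<Longrightarrow>
    \<forall>\<alpha> i T. mi_order \<alpha> < k \<longrightarrow> (\<forall>j. bump_tower (T j)) \<longrightarrow>
      (LINT x|lborel. F \<alpha> x * prod_jet T ((\<lambda>_. 0)(i := Suc 0)) x)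
       = - (LINT x|lborel. F (\<alpha>(i := Suc (\<alpha> i))) x * prod_jet T (\<lambda>_. 0) x) \<Longrightarrow>
    (\<integral>\<^sup>+x. ennreal ((F (\<lambda>_. 0) x)\<^sup>2 * gauss x) \<partial>lborel) \<le> ennreal b \<Longrightarrow>
    (\<integral>\<^sup>+x. ennreal ((F (\<lambda>_. 0) x)\<^sup>2 * \<bar>ln \<bar>F (\<lambda>_. 0) x\<bar>\<bar> ^ k * gauss x) \<partial>lborel)
      \<le> ennreal C * (1 + Z + (\<Sum>\<alpha> | mi_order \<alpha> \<le> k. \<integral>\<^sup>+x. ennreal ((F \<alpha> x)\<^sup>2 * gauss x) \<partial>lborel))"
    using gaussian_higher_log_sobolev[OF _ k, of b, where 'n = 'n] \<open>0 < b\<close> unfolding Z_def by blast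
  \<comment> \<open>The final \<open>+ 1\<close> ensures positivity for the same reason: at
    \<open>z = 0\<close> the quotient would be \<open>0\<close>.\<close>
  define C' where "C' = exp (2 * K) / z * (C * (1 + z + b)) + 1"
  have "z \<ge> 0" "b \<ge> 0" by (auto simp: z_def b_def)
  then have "C' > 0" using C by (simp add: C'_def add_nonneg_pos)
  show ?thesis
  proof (intro exI[of _ C'] conjI allI impI \<open>C' > 0\<close>)
    fix a :: "real ^ 'n \<Rightarrow> real" and c and f :: "real ^ 'n \<Rightarrow> real" and Df
    let ?\<mu> = "perturbed_gaussian a c"
    assume a: "a \<in> borel_measurable lebesgue" "AE x in lebesgue. \<bar>a x\<bar> \<le> K" "prob_space ?\<mu>"
      and f: "in_L2 ?\<mu> f" "L2_norm ?\<mu> f = 1"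
      and Df: "\<forall>\<alpha>. mi_order \<alpha> \<le> k \<longrightarrow> weak_deriv \<alpha> f (Df \<alpha>) \<and> in_L2 ?\<mu> (Df \<alpha>)"
    note compare = perturbed_gaussian_compare[OF a, folded Z_def, folded z_def]
    have Z: "Z = ennreal z" using compare(2) by (simp add: z_def)
    have L2_meas: "g \<in> borel_measurable lebesgue" if "in_L2 ?\<mu> g" for g
      using that by (auto simp: in_L2_def perturbed_gaussian_def measurable_def)
    have ord0: "mi_order (\<lambda>_::'n. 0) = 0" by (simp add: mi_order_def)
    \<comment> \<open>Above order \<open>k\<close> nothing is assumed about \<open>Df\<close>; the
      zero function there keeps the whole family Borel.\<close>
    have ex: "\<forall>\<alpha>. \<exists>g'. g' \<in> borel_measurable borel \<and> (mi_order \<alpha> \<le> k \<longrightarrow> (AE x in lebesgue. Df \<alpha> x = g' x) \<and>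
     (\<forall>R. set_integrable lborel (cball 0 R) g') \<and>
     (\<forall>p\<in>borel_measurable borel. (LINT x|lebesgue. Df \<alpha> x * p x) = (LINT x|lborel. g' x * p x)))" (is "\<forall>\<alpha>. ?version \<alpha>")
    proof
      fix \<alpha>
      show "?version \<alpha>"
      proof (cases "mi_order \<alpha> \<le> k")
        case True
        then have "weak_deriv \<alpha> f (Df \<alpha>)" "in_L2 ?\<mu> (Df \<alpha>)" using Df by auto
        then show ?thesis
          using locally_integrable_borel_version[of "Df \<alpha>"] L2_meas by (auto simp: weak_deriv_def)
      qed (auto intro: exI[of _ "\<lambda>_. 0"])
    qed
    obtain F where "\<forall>\<alpha>. F \<alpha> \<in> borel_measurable borel \<and> (mi_order \<alpha> \<le> k \<longrightarrow> (AE x in lebesgue. Df \<alpha> x = F \<alpha> x) \<and>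
     (\<forall>R. set_integrable lborel (cball 0 R) (F \<alpha>)) \<and>
     (\<forall>p\<in>borel_measurable borel. (LINT x|lebesgue. Df \<alpha> x * p x) = (LINT x|lborel. F \<alpha> x * p x)))"
      using choice[OF ex] by (elim exE)
    then have F: "\<And>\<alpha>. F \<alpha> \<in> borel_measurable borel"
      "\<And>\<alpha>. mi_order \<alpha> \<le> k \<Longrightarrow> AE x in lebesgue. Df \<alpha> x = F \<alpha> x"
      "\<And>\<alpha> R. mi_order \<alpha> \<le> k \<Longrightarrow> set_integrable lborel (cball 0 R) (F \<alpha>)"
      "\<And>\<alpha> p. mi_order \<alpha> \<le> k \<Longrightarrow> p \<in> borel_measurable borel \<Longrightarrow>
         (LINT x|lebesgue. Df \<alpha> x * p x) = (LINT x|lborel. F \<alpha> x * p x)"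
      by simp_all
    have f_F: "AE x in lebesgue. f x = F (\<lambda>_. 0) x"
    proof -
      have "AE x in lebesgue. f x = Df (\<lambda>_. 0) x"
        using Df f ord0 by (intro weak_deriv_0_AE L2_meas) auto
      with F(2)[of "\<lambda>_. 0"] ord0 show ?thesis by (auto elim: eventually_elim2)
    qed
    have sq: "(\<integral>\<^sup>+x. ennreal ((F \<alpha> x)\<^sup>2 * gauss x) \<partial>lborel) \<le> ennreal b * ennreal ((L2_norm ?\<mu> g)\<^sup>2)"
      if g: "in_L2 ?\<mu> g" and ae: "AE x in lebesgue. g x = F \<alpha> x" for g \<alpha>
    proof -
      note [measurable] = L2_meas[OF g]
      have "(\<integral>\<^sup>+x. ennreal ((F \<alpha> x)\<^sup>2 * gauss x) \<partial>lborel) = (\<integral>\<^sup>+x. ennreal ((F \<alpha> x)\<^sup>2 * gauss x) \<partial>lebesgue)"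
        by (simp add: nn_integral_completion)
      also have "\<dots> = (\<integral>\<^sup>+x. ennreal ((g x)\<^sup>2) * ennreal (gauss x) \<partial>lebesgue)"
        by (rule nn_integral_cong_AE, use ae in eventually_elim) (simp add: ennreal_mult' gauss_pos less_imp_le)
      also have "\<dots> \<le> ennreal (exp (2 * K) * z) * (\<integral>\<^sup>+x. ennreal ((g x)\<^sup>2) \<partial>?\<mu>)"
        by (rule compare(4)) measurable
      also have "\<dots> \<le> ennreal b * (\<integral>\<^sup>+x. ennreal ((g x)\<^sup>2) \<partial>?\<mu>)"
        by (intro mult_right_mono ennreal_leI) (auto simp: b_def)
      finally show ?thesis by (simp only: nn_integral_square_eq_L2[OF g])
    qed
    define S where "S = (\<Sum>\<alpha> | mi_order \<alpha> \<le> k. (L2_norm ?\<mu> (Df \<alpha>))\<^sup>2)"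
    have S0: "0 \<le> S" unfolding S_def by (intro sum_nonneg) simp
    \<comment> \<open>This is where the normalisation of \<open>f\<close> makes the inhomogeneous
      estimate usable: the order-zero term gives \<open>1 \<le> S\<close>, so the additive
      \<open>1 + z\<close> is at most \<open>(1 + z) * S\<close>.\<close>
    have "(L2_norm ?\<mu> (Df (\<lambda>_. 0)))\<^sup>2 = 1"
    proof -
      have AE_D: "AE x in lebesgue. f x = Df (\<lambda>_. 0) x"
        using Df f ord0 by (intro weak_deriv_0_AE L2_meas) auto
      have "AE x in ?\<mu>. f x = Df (\<lambda>_. 0) x"
        unfolding perturbed_gaussian_def
      proof (subst AE_density)
        have [measurable]: "a \<in> borel_measurable lebesgue" "(norm :: real ^ 'n \<Rightarrow> real) \<in> borel_measurable lebesgue"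
          using a measurable_completion[of "norm :: real ^ 'n \<Rightarrow> real" lborel borel] by auto
        show "(\<lambda>x. ennreal (exp (- (norm x)\<^sup>2 / 2 + a x + c))) \<in> borel_measurable lebesgue" by measurable
      qed (use AE_D in eventually_elim, simp)
      then have "AE x in ?\<mu>. (Df (\<lambda>_. 0) x)\<^sup>2 = (f x)\<^sup>2" by eventually_elim simp
      moreover have "integrable ?\<mu> (\<lambda>x. (Df (\<lambda>_. 0) x)\<^sup>2)" "integrable ?\<mu> (\<lambda>x. (f x)\<^sup>2)"
        using Df f ord0 by (auto simp: in_L2_def)
      ultimately have "(LINT x|?\<mu>. (Df (\<lambda>_. 0) x)\<^sup>2) = (LINT x|?\<mu>. (f x)\<^sup>2)"
        by (intro integral_cong_AE borel_measurable_integrable)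
      then show ?thesis using f(2) by (simp add: L2_norm_def)
    qed
    moreover have "(L2_norm ?\<mu> (Df (\<lambda>_. 0)))\<^sup>2 \<le> S"
      unfolding S_def by (rule member_le_sum[where f = "\<lambda>\<alpha>. (L2_norm ?\<mu> (Df \<alpha>))\<^sup>2"]) (auto simp: ord0 finite_mi_order_le)
    ultimately have S1: "1 \<le> S" by simp
    note [measurable] = L2_meas[OF f(1)]
    have "(\<integral>\<^sup>+ x. ennreal (\<bar>f x\<bar>\<^sup>2 * \<bar>ln \<bar>f x\<bar>\<bar> ^ k) \<partial>?\<mu>)
      \<le> ennreal (exp (2 * K) / z) * (\<integral>\<^sup>+x. ennreal (\<bar>f x\<bar>\<^sup>2 * \<bar>ln \<bar>f x\<bar>\<bar> ^ k) * ennreal (gauss x) \<partial>lebesgue)"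
      by (rule compare(3)) measurable
    also have "(\<integral>\<^sup>+x. ennreal (\<bar>f x\<bar>\<^sup>2 * \<bar>ln \<bar>f x\<bar>\<bar> ^ k) * ennreal (gauss x) \<partial>lebesgue)
      = (\<integral>\<^sup>+x. ennreal ((F (\<lambda>_. 0) x)\<^sup>2 * \<bar>ln \<bar>F (\<lambda>_. 0) x\<bar>\<bar> ^ k * gauss x) \<partial>lebesgue)"
    proof (rule nn_integral_cong_AE)
      show "AE x in lebesgue. ennreal (\<bar>f x\<bar>\<^sup>2 * \<bar>ln \<bar>f x\<bar>\<bar> ^ k) * ennreal (gauss x)
        = ennreal ((F (\<lambda>_. 0) x)\<^sup>2 * \<bar>ln \<bar>F (\<lambda>_. 0) x\<bar>\<bar> ^ k * gauss x)"
        using f_F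
      proof eventually_elim
        case (elim x)
        show ?case
          unfolding elim by (subst ennreal_mult''[OF less_imp_le[OF gauss_pos]]) (simp only: power2_abs)
      qed
    qed
    also have "\<dots> = (\<integral>\<^sup>+x. ennreal ((F (\<lambda>_. 0) x)\<^sup>2 * \<bar>ln \<bar>F (\<lambda>_. 0) x\<bar>\<bar> ^ k * gauss x) \<partial>lborel)"
      by (simp add: nn_integral_completion)
    also have "\<dots> \<le> ennreal C * (1 + Z + (\<Sum>\<alpha> | mi_order \<alpha> \<le> k. \<integral>\<^sup>+x. ennreal ((F \<alpha> x)\<^sup>2 * gauss x) \<partial>lborel))"
    proof (rule main)
      show "\<forall>\<alpha>. F \<alpha> \<in> borel_measurable borel" using F(1) by blast
      show "\<forall>\<alpha> R. mi_order \<alpha> \<le> k \<longrightarrow> set_integrable lborel (cball 0 R) (F \<alpha>)" using F(3) by blast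
      show "(\<integral>\<^sup>+x. ennreal ((F (\<lambda>_. 0) x)\<^sup>2 * gauss x) \<partial>lborel) \<le> ennreal b"
        using sq[OF f(1) f_F] f(2) by simp
      show "\<forall>\<alpha> i T. mi_order \<alpha> < k \<longrightarrow> (\<forall>j. bump_tower (T j)) \<longrightarrow>
        (LINT x|lborel. F \<alpha> x * prod_jet T ((\<lambda>_. 0)(i := Suc 0)) x)
         = - (LINT x|lborel. F (\<alpha>(i := Suc (\<alpha> i))) x * prod_jet T (\<lambda>_. 0) x)"
      proof (intro allI impI)
        fix \<alpha> :: "'n \<Rightarrow> nat" and i and T :: "'n \<Rightarrow> nat \<Rightarrow> real \<Rightarrow> real"
        assume "mi_order \<alpha> < k" and T: "\<forall>j. bump_tower (T j)"
        then have ord: "mi_order \<alpha> \<le> k" "mi_order (\<alpha>(i := Suc (\<alpha> i))) \<le> k" by (auto simp: mi_order_upd)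
        have "(LINT x|lebesgue. Df \<alpha> x * prod_jet T ((\<lambda>_. 0)(i := Suc 0)) x)
          = - (LINT x|lebesgue. Df (\<alpha>(i := Suc (\<alpha> i))) x * prod_jet T (\<lambda>_. 0) x)"
          using Df ord T by (intro weak_deriv_step[of \<alpha> f]) auto
        moreover have "prod_jet T \<nu> \<in> borel_measurable borel" for \<nu> using T by (intro prod_jet_measurable) auto
        ultimately show "(LINT x|lborel. F \<alpha> x * prod_jet T ((\<lambda>_. 0)(i := Suc 0)) x)
           = - (LINT x|lborel. F (\<alpha>(i := Suc (\<alpha> i))) x * prod_jet T (\<lambda>_. 0) x)"
          using F(4)[OF ord(1)] F(4)[OF ord(2)] by simp
      qed
    qed
    also have "(\<Sum>\<alpha> | mi_order \<alpha> \<le> k. \<integral>\<^sup>+x. ennreal ((F \<alpha> x)\<^sup>2 * gauss x) \<partial>lborel)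
      \<le> (\<Sum>\<alpha> | mi_order \<alpha> \<le> k. ennreal b * ennreal ((L2_norm ?\<mu> (Df \<alpha>))\<^sup>2))"
      using Df F(2) by (intro sum_mono sq) auto
    also have "\<dots> = ennreal (b * S)"
      using \<open>b \<ge> 0\<close> S0 by (simp add: S_def sum_distrib_left[symmetric] sum_ennreal ennreal_mult sum_nonneg)
    also have "1 + Z + ennreal (b * S) = ennreal (1 + z + b * S)"
      using \<open>z \<ge> 0\<close> \<open>b \<ge> 0\<close> S0 unfolding Z by simp
    also have "ennreal (exp (2 * K) / z) * (ennreal C * ennreal (1 + z + b * S))
       = ennreal (exp (2 * K) / z * (C * (1 + z + b * S)))"
    proof -
      have "0 \<le> 1 + z + b * S" using \<open>z \<ge> 0\<close> \<open>b \<ge> 0\<close> S0 by (intro add_nonneg_nonneg mult_nonneg_nonneg) auto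
      then show ?thesis using C \<open>z \<ge> 0\<close>
        by (subst ennreal_mult[symmetric], simp, simp, subst ennreal_mult[symmetric]) auto
    qed
    also have "\<dots> \<le> ennreal (C' * S)"
    proof (rule ennreal_leI)
      have "1 + z + b * S \<le> (1 + z + b) * S"
        using mult_left_mono[OF S1, of "1 + z"] \<open>z \<ge> 0\<close> by (simp add: algebra_simps)
      then have "exp (2 * K) / z * (C * (1 + z + b * S)) \<le> exp (2 * K) / z * (C * ((1 + z + b) * S))"
        using C \<open>z \<ge> 0\<close> by (intro mult_left_mono) auto
      also have "\<dots> = (exp (2 * K) / z * (C * (1 + z + b))) * S" by (simp only: mult.assoc)
      also have "\<dots> \<le> C' * S" unfolding C'_def by (intro mult_right_mono S0) simp
      finally show "exp (2 * K) / z * (C * (1 + z + b * S)) \<le> C' * S" .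
    qed
    finally show "(\<integral>\<^sup>+ x. ennreal (\<bar>f x\<bar>\<^sup>2 * \<bar>ln \<bar>f x\<bar>\<bar> ^ k) \<partial>?\<mu>)
        \<le> ennreal (C' * (\<Sum>\<alpha> | mi_order \<alpha> \<le> k. (L2_norm ?\<mu> (Df \<alpha>))\<^sup>2))"
      by (simp add: S_def mult_left_mono add_left_mono)
  qed
qed

theorem corollary2:
  fixes \<beta> \<theta> K :: real
  assumes "\<beta> \<ge> 0" and "\<theta> > 1" and "K > 0"
  shows "\<exists>C>0. \<forall>(a :: real ^ 'n::finite \<Rightarrow> real) (c :: real) \<mu>.
           a \<in> holder_class \<beta> \<theta> K \<longrightarrow>
           \<mu> = perturbed_gaussian a c \<longrightarrow> prob_space \<mu> \<longrightarrow>
           (\<forall>k\<in>{1..nat \<lfloor>\<beta>\<rfloor> + 1}. \<forall>(f :: real ^ 'n \<Rightarrow> real) Df.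
              in_L2 \<mu> f \<longrightarrow> L2_norm \<mu> f = 1 \<longrightarrow>
              (\<forall>\<alpha>. mi_order \<alpha> \<le> k \<longrightarrow> weak_deriv \<alpha> f (Df \<alpha>) \<and> in_L2 \<mu> (Df \<alpha>)) \<longrightarrow>
              (\<integral>\<^sup>+ x. ennreal (\<bar>f x\<bar>\<^sup>2 * \<bar>ln \<bar>f x\<bar>\<bar> ^ k) \<partial>\<mu>)
                \<le> ennreal (C * (\<Sum>\<alpha> | mi_order \<alpha> \<le> k. (L2_norm \<mu> (Df \<alpha>))\<^sup>2)))"
proof -
  let ?P = "\<lambda>k C. \<forall>(a :: real ^ 'n \<Rightarrow> real) (c :: real) (f :: real ^ 'n \<Rightarrow> real) Df.
     a \<in> borel_measurable lebesgue \<longrightarrow> (AE x in lebesgue. \<bar>a x\<bar> \<le> K) \<longrightarrow>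
     prob_space (perturbed_gaussian a c) \<longrightarrow>
     in_L2 (perturbed_gaussian a c) f \<longrightarrow> L2_norm (perturbed_gaussian a c) f = 1 \<longrightarrow>
     (\<forall>\<alpha>. mi_order \<alpha> \<le> k \<longrightarrow> weak_deriv \<alpha> f (Df \<alpha>) \<and> in_L2 (perturbed_gaussian a c) (Df \<alpha>)) \<longrightarrow>
     (\<integral>\<^sup>+ x. ennreal (\<bar>f x\<bar>\<^sup>2 * \<bar>ln \<bar>f x\<bar>\<bar> ^ k) \<partial>perturbed_gaussian a c)
        \<le> ennreal (C * (\<Sum>\<alpha> | mi_order \<alpha> \<le> k. (L2_norm (perturbed_gaussian a c) (Df \<alpha>))\<^sup>2))"
  have "\<forall>k\<in>{1..nat \<lfloor>\<beta>\<rfloor> + 1}. \<exists>C>0. ?P k C"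
    using perturbed_gaussian_log_sobolev[OF \<open>K > 0\<close>, where 'n = 'n] by simp
  then obtain C where C: "\<And>k. k \<in> {1..nat \<lfloor>\<beta>\<rfloor> + 1} \<Longrightarrow> 0 < C k \<and> ?P k (C k)"
    by (subst (asm) bchoice_iff) blast
  \<comment> \<open>Only finitely many \<open>k\<close> occur, and the sum of their positive
    constants dominates each of them.\<close>
  define B where "B = (\<Sum>k\<in>{1..nat \<lfloor>\<beta>\<rfloor> + 1}. C k)"
  have "B > 0" unfolding B_def using C by (intro sum_pos) auto
  have le: "C k \<le> B" if "k \<in> {1..nat \<lfloor>\<beta>\<rfloor> + 1}" for k
  proof -
    have "0 \<le> C j" if "j \<in> {1..nat \<lfloor>\<beta>\<rfloor> + 1}" for j using C[OF that] by simp
    then show ?thesis unfolding B_def using that by (intro member_le_sum) auto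
  qed
  show ?thesis
  proof (intro exI[of _ B] conjI allI impI ballI \<open>B > 0\<close>)
    fix a :: "real ^ 'n \<Rightarrow> real" and c \<mu> k and f :: "real ^ 'n \<Rightarrow> real" and Df
    assume a: "a \<in> holder_class \<beta> \<theta> K" and \<mu>: "\<mu> = perturbed_gaussian a c" and "prob_space \<mu>"
      and k: "k \<in> {1..nat \<lfloor>\<beta>\<rfloor> + 1}" and f: "in_L2 \<mu> f" "L2_norm \<mu> f = 1"
      and Df: "\<forall>\<alpha>. mi_order \<alpha> \<le> k \<longrightarrow> weak_deriv \<alpha> f (Df \<alpha>) \<and> in_L2 \<mu> (Df \<alpha>)"
    let ?S = "\<Sum>\<alpha> | mi_order \<alpha> \<le> k. (L2_norm \<mu> (Df \<alpha>))\<^sup>2"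
    have "(\<integral>\<^sup>+ x. ennreal (\<bar>f x\<bar>\<^sup>2 * \<bar>ln \<bar>f x\<bar>\<bar> ^ k) \<partial>\<mu>) \<le> ennreal (C k * ?S)"
      using C[OF k, THEN conjunct2, rule_format, of a c f Df]
        holder_class_bounded[OF a \<open>K > 0\<close>] \<open>prob_space \<mu>\<close> f Df unfolding \<mu> by blast
    also have "\<dots> \<le> ennreal (B * ?S)"
      by (intro ennreal_leI mult_right_mono le[OF k] sum_nonneg) simp
    finally show "(\<integral>\<^sup>+ x. ennreal (\<bar>f x\<bar>\<^sup>2 * \<bar>ln \<bar>f x\<bar>\<bar> ^ k) \<partial>\<mu>) \<le> ennreal (B * ?S)" .
  qed
qed

end
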